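(* Let $A,B$ be linear operators in a complex Hilbert space $H$ with $\operatorname{dom}(A)\subseteq\operatorname{dom}(B)$. (i) Let $0\notin W_e(B)$. Then $$w_e(A,B)\subseteq\bigcap_{K\text{ compact}}\overline{w(A+K,B)}\subseteq\bigcap_{K\in L(H),\ \operatorname{rank}K<\infty}\overline{w(A+K,B)}\subseteq\bigcap_{K\in L(H),\ \operatorname{rank}K<\infty}\overline{W(A+K,B)}=\bigcap_{K\text{ compact}}\overline{W(A+K,B)}$$ and $$\overline{W_e(A,B)}\subseteq w_e(A,B).$$ (ii) Assume that $B$ is uniformly positive. Then $$w_e(A,B)=W_e\big(B^{-\frac12}AB^{-\frac12}\big),$$ the sets are closed and convex, and they coincide with the four intersections displayed in (i).
   Context: For a linear operator $S$ in $H$: $W(S)=\{\langle Sx,x\rangle:x\in\operatorname{dom}(S),\|x\|=1\}$, and $W_e(S)$ is the set of all $\mu\in\mathbb C$ for which there are $x_n\in\operatorname{dom}(S)$ with $\|x_n\|=1$, $x_n\to0$ weakly and $\langle Sx_n,x_n\rangle\to\mu$. For linear operators $A,B$ in $H$ with $\operatorname{dom}(A)\subseteq\operatorname{dom}(B)$ (and $A-\lambda B$ defined on $\operatorname{dom}(A)$): $W(A,B)=\{\lambda:0\in\overline{W(A-\lambda B)}\}$, $w(A,B)=\left\{\frac{\langle Ax,x\rangle}{\langle Bx,x\rangle}:x\in\operatorname{dom}(A),\langle Bx,x\rangle\ne0\right\}$, $W_e(A,B)=\{\lambda:0\in W_e(A-\lambda B)\}$, and $w_e(A,B)$ is the set of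 all limits $\lim_{n\to\infty}\frac{\langle Ax_n,x_n\rangle}{\langle Bx_n,x_n\rangle}$ with $x_n\in\operatorname{dom}(A)$, $\langle Bx_n,x_n\rangle\neq0$, $\|x_n\|=1$, $x_n\to0$ weakly. $L(H)$ is the space of bounded linear operators on $H$; compact operators $K$ are elements of $L(H)$. $B$ is uniformly positive if it is selfadjoint and $B\ge c$ for some $c>0$; $B^{-1/2}AB^{-1/2}$ has domain $\{y\in H:B^{-1/2}y\in\operatorname{dom}(A)\}$. *)

theory Defs
  imports "HOL-Analysis.Analysis"
begin

section \<open>Complex Hilbert spaces\<close>

text \<open>
  The inner product \<open>cinner\<close> is linear in its first argument.  Building on \<^class>\<open>real_inner\<close>
  means that the norm, the metric and the topology are those of the underlying real inner product
  \<open>Re (cinner x y)\<close>; hence \<open>(norm x)\<^sup>2 = Re (cinner x x)\<close>, and positive definiteness is inherited.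
\<close>

class complex_inner = real_inner +
  fixes scaleC :: "complex \<Rightarrow> 'a \<Rightarrow> 'a"  (infixr "*\<^sub>C" 75)
    and cinner :: "'a \<Rightarrow> 'a \<Rightarrow> complex"
  assumes scaleC_add_right: "a *\<^sub>C (x + y) = a *\<^sub>C x + a *\<^sub>C y"
    and scaleC_add_left: "(a + b) *\<^sub>C x = a *\<^sub>C x + b *\<^sub>C x"
    and scaleC_scaleC: "a *\<^sub>C (b *\<^sub>C x) = (a * b) *\<^sub>C x"
    and scaleC_of_real: "complex_of_real r *\<^sub>C x = r *\<^sub>R x"
    and cinner_commute: "cinner x y = cnj (cinner y x)"
    and cinner_add_left: "cinner (x + y) z = cinner x z + cinner y z"
    and cinner_scaleC_left: "cinner (a *\<^sub>C x) y = a * cinner x y"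
    and inner_eq_Re_cinner: "inner x y = Re (cinner x y)"

class chilbert_space = complex_inner + complete_space

interpretation complex_vector: vector_space "scaleC :: complex \<Rightarrow> 'a \<Rightarrow> 'a::complex_inner"
proof
  fix x :: 'a
  show "1 *\<^sub>C x = x"
    using scaleC_of_real[of 1 x] by simp
qed (simp_all add: scaleC_add_right scaleC_add_left scaleC_scaleC)

instantiation complex :: chilbert_space
begin

definition scaleC_complex :: "complex \<Rightarrow> complex \<Rightarrow> complex"
  where "scaleC_complex a x = a * x"

definition cinner_complex :: "complex \<Rightarrow> complex \<Rightarrow> complex"
  where "cinner_complex x y = x * cnj y"

instance
  by standard
    (simp_all add: scaleC_complex_def cinner_complex_def inner_complex_def algebra_simps
      scaleR_conv_of_real)

end

definition weakly_null :: "(nat \<Rightarrow> 'a::complex_inner) \<Rightarrow> bool"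
  where "weakly_null X \<longleftrightarrow> (\<forall>y. (\<lambda>n. cinner (X n) y) \<longlonglongrightarrow> 0)"


section \<open>Linear operators in a Hilbert space\<close>

text \<open>
  An operator in \<open>H\<close> is a partial map: \<^term>\<open>dom S\<close> is its domain, \<^term>\<open>ran S\<close> its range and
  \<^term>\<open>the (S x)\<close> its value at \<open>x \<in> dom S\<close>.  Equality of partial maps is equality of operators
  including their domains, and \<open>S \<circ>\<^sub>m T\<close> is the product \<open>ST\<close> with its natural domain
  \<open>{x \<in> dom T. Tx \<in> dom S}\<close>.
\<close>

type_synonym 'a operator = "'a \<Rightarrow> 'a option"

definition linear_operator :: "'a::complex_inner operator \<Rightarrow> bool"
  where "linear_operator S \<longleftrightarrow>
    complex_vector.subspace (dom S) \<and>
    (\<forall>x\<in>dom S. \<forall>y\<in>dom S. the (S (x + y)) = the (S x) + the (S y)) \<and>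
    (\<forall>c. \<forall>x\<in>dom S. the (S (c *\<^sub>C x)) = c *\<^sub>C the (S x))"

definition op_add :: "'a::complex_inner operator \<Rightarrow> 'a operator \<Rightarrow> 'a operator"
  where "op_add S T = (\<lambda>x. if x \<in> dom S \<inter> dom T then Some (the (S x) + the (T x)) else None)"

definition op_scale :: "complex \<Rightarrow> 'a::complex_inner operator \<Rightarrow> 'a operator"
  where "op_scale c S = (\<lambda>x. map_option (scaleC c) (S x))"

definition op_inverse :: "'a operator \<Rightarrow> 'a operator"
  where "op_inverse S = (\<lambda>y. if y \<in> ran S then Some (THE x. S x = Some y) else None)"

definition op_adjoint :: "'a::complex_inner operator \<Rightarrow> 'a operator"
  where "op_adjoint S =
    (\<lambda>y. if \<exists>z. \<forall>x\<in>dom S. cinner (the (S x)) y = cinner x z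
         then Some (THE z. \<forall>x\<in>dom S. cinner (the (S x)) y = cinner x z) else None)"

definition selfadjoint :: "'a::complex_inner operator \<Rightarrow> bool"
  where "selfadjoint S \<longleftrightarrow>
    linear_operator S \<and> closure (dom S) = UNIV \<and> op_adjoint S = S"

text \<open>
  \<open>S \<ge> c\<close> in the sense of quadratic forms.  It is only used for selfadjoint \<open>S\<close>, whose quadratic
  form is real, so taking the real part loses nothing.
\<close>

definition bounded_below_by :: "'a::complex_inner operator \<Rightarrow> real \<Rightarrow> bool"
  where "bounded_below_by S c \<longleftrightarrow> (\<forall>x\<in>dom S. Re (cinner (the (S x)) x) \<ge> c * (norm x)\<^sup>2)"

definition uniformly_positive :: "'a::complex_inner operator \<Rightarrow> bool"
  where "uniformly_positive S \<longleftrightarrow> selfadjoint S \<and> (\<exists>c>0. bounded_below_by S c)"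

text \<open>The nonnegative selfadjoint square root of a nonnegative selfadjoint operator.\<close>

definition op_sqrt :: "'a::complex_inner operator \<Rightarrow> 'a operator"
  where "op_sqrt S = (THE T. selfadjoint T \<and> bounded_below_by T 0 \<and> T \<circ>\<^sub>m T = S)"

text \<open>
  \<open>S\<^bsup>-1/2\<^esup>\<close>, read as \<open>(S\<^bsup>-1\<^esup>)\<^bsup>1/2\<^esup>\<close>; meant for uniformly positive \<open>S\<close>, where \<open>S\<^bsup>-1\<^esup>\<close> is bounded and
  everywhere defined.
\<close>

definition inv_sqrt :: "'a::complex_inner operator \<Rightarrow> 'a operator"
  where "inv_sqrt S = op_sqrt (op_inverse S)"

text \<open>
  Elements of \<open>L(H)\<close> are total functions; \<^const>\<open>bounded_linear\<close> covers only real scalars.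
\<close>

definition bounded_clinear :: "('a::complex_inner \<Rightarrow> 'a) \<Rightarrow> bool"
  where "bounded_clinear K \<longleftrightarrow> bounded_linear K \<and> (\<forall>c x. K (c *\<^sub>C x) = c *\<^sub>C K x)"

definition compact_op :: "('a::complex_inner \<Rightarrow> 'a) \<Rightarrow> bool"
  where "compact_op K \<longleftrightarrow> bounded_clinear K \<and> compact (closure (K ` cball 0 1))"

definition finite_rank_op :: "('a::complex_inner \<Rightarrow> 'a) \<Rightarrow> bool"
  where "finite_rank_op K \<longleftrightarrow>
    bounded_clinear K \<and> (\<exists>F. finite F \<and> range K \<subseteq> complex_vector.span F)"

definition op_perturb :: "'a::complex_inner operator \<Rightarrow> ('a \<Rightarrow> 'a) \<Rightarrow> 'a operator"
  where "op_perturb S K = op_add S (\<lambda>x. Some (K x))"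


section \<open>Numerical ranges\<close>

definition num_range :: "'a::complex_inner operator \<Rightarrow> complex set"
  where "num_range S = {cinner (the (S x)) x | x. x \<in> dom S \<and> norm x = 1}"

definition ess_num_range :: "'a::complex_inner operator \<Rightarrow> complex set"
  where "ess_num_range S =
    {\<mu>. \<exists>X. (\<forall>n. X n \<in> dom S \<and> norm (X n) = 1) \<and> weakly_null X \<and>
          (\<lambda>n. cinner (the (S (X n))) (X n)) \<longlonglongrightarrow> \<mu>}"

definition pencil :: "'a::complex_inner operator \<Rightarrow> 'a operator \<Rightarrow> complex \<Rightarrow> 'a operator"
  where "pencil A B \<mu> = op_add A (op_scale (- \<mu>) B)"

text \<open>
  For a pencil there are two notions each: \<open>W(A,B)\<close> and \<open>W\<^sub>e(A,B)\<close> come from the numerical ranges of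
  the operators \<open>A - \<mu>B\<close>, while \<open>w(A,B)\<close> and \<open>w\<^sub>e(A,B)\<close> are built from quotients of quadratic forms.
\<close>

definition pencil_num_range :: "'a::complex_inner operator \<Rightarrow> 'a operator \<Rightarrow> complex set"
  where "pencil_num_range A B = {\<mu>. 0 \<in> closure (num_range (pencil A B \<mu>))}"

definition quot_num_range :: "'a::complex_inner operator \<Rightarrow> 'a operator \<Rightarrow> complex set"
  where "quot_num_range A B =
    {cinner (the (A x)) x / cinner (the (B x)) x | x. x \<in> dom A \<and> cinner (the (B x)) x \<noteq> 0}"

definition pencil_ess_num_range :: "'a::complex_inner operator \<Rightarrow> 'a operator \<Rightarrow> complex set"
  where "pencil_ess_num_range A B = {\<mu>. 0 \<in> ess_num_range (pencil A B \<mu>)}"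

definition quot_ess_num_range :: "'a::complex_inner operator \<Rightarrow> 'a operator \<Rightarrow> complex set"
  where "quot_ess_num_range A B =
    {\<mu>. \<exists>X. (\<forall>n. X n \<in> dom A \<and> cinner (the (B (X n))) (X n) \<noteq> 0 \<and> norm (X n) = 1) \<and>
          weakly_null X \<and>
          (\<lambda>n. cinner (the (A (X n))) (X n) / cinner (the (B (X n))) (X n)) \<longlonglongrightarrow> \<mu>}"

end

theory Submission
  imports Defs
begin

text \<open>
  Put \<open>R = B\<^bsup>-1/2\<^esup>\<close>.  For \<open>x = Ry\<close> one has \<open>\<langle>Bx,x\<rangle> = \<parallel>y\<parallel>\<^sup>2\<close>, so \<open>w(A + K, B)\<close> is the ordinary numerical
  range of \<open>RAR + RKR\<close>.  The heart of (ii) is that a point \<open>\<mu>\<close> lying in the closures of these sets for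
  all \<open>K\<close> of finite rank belongs to \<open>w\<^sub>e(A, B)\<close>.  Given finitely many vectors \<open>z\<close>, consider on the unit
  sphere the real and imaginary parts of \<open>\<langle>(RAR - \<mu>)y,y\<rangle>\<close> and the form \<open>\<Sum>\<bar>\<langle>Ry,z\<rangle>\<bar>\<^sup>2\<close>.  The joint
  numerical range of three Hermitian forms is essentially convex.  If its closure misses \<open>0\<close>, a
  separating hyperplane yields a multiple \<open>K\<close> of \<open>\<Sum>\<langle>\<cdot>,z\<rangle>z\<close> for which \<open>\<mu>\<close> is not in the closure of
  \<open>w(A + K, B)\<close>.  Otherwise there are unit vectors \<open>y\<close> with \<open>\<langle>RARy,y\<rangle>\<close> close to \<open>\<mu>\<close> and \<open>Ry\<close> nearly
  orthogonal to the \<open>z\<close>, and iterating produces a weakly null sequence.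
\<close>

section \<open>Complex inner products and orthonormal sets\<close>

text \<open>Essential convexity is needed in one direction only: a point of the convex hull must be
  matched exactly in the complex form, while the third form, being nonnegative, may grow by a fixed
  factor. The two-vector Toeplitz-Hausdorff argument is therefore enough, provided that the squared
  coefficients stay comparable to the convex weights. Caratheodory in real dimension three bounds
  the number of merges and makes the factor uniform. The separating functional may ignore the
  complex form and then yields no perturbation. An orthonormal sequence in \<open>dom A\<close>
  excludes this case; it exists because on a finite-dimensional domain a large multiple of the
  orthogonal projection would drive all values away from \<mu>. The last equality in (i)
  approximates a compact K in norm by finite rank operators, but each approximation only supplies
  some \<nu> near \<mu>. No lower bound for the form of B is available there; a dichotomy on whether
  the forms of A + K and B can be small together takes its place.\<close>

lemma cinner_add_right: "cinner x (y + z) = cinner x y + cinner x z"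
  using cinner_commute[of x] cinner_commute[of _ x] by (metis cinner_add_left complex_cnj_add)

lemma cinner_scaleC_right: "cinner x (a *\<^sub>C y) = cnj a * cinner x y"
  by (metis cinner_commute cinner_scaleC_left complex_cnj_mult)

lemma cinner_self: "cinner x x = complex_of_real ((norm x)\<^sup>2)"
proof (rule complex_eqI)
  show "Re (cinner x x) = Re (complex_of_real ((norm x)\<^sup>2))"
    by (simp add: power2_norm_eq_inner inner_eq_Re_cinner)
  show "Im (cinner x x) = Im (complex_of_real ((norm x)\<^sup>2))"
    using cinner_commute[of x x] by (simp add: complex_eq_iff)
qed

lemma norm_scaleC: "norm (a *\<^sub>C x) = cmod a * norm (x :: 'a::complex_inner)"
proof -
  have "complex_of_real ((norm (a *\<^sub>C x))\<^sup>2) = complex_of_real ((cmod a * norm x)\<^sup>2)"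
    unfolding cinner_self[symmetric] cinner_scaleC_left cinner_scaleC_right
    by (simp add: cinner_self complex_norm_square power_mult_distrib mult_ac flip: of_real_power)
  then have "(norm (a *\<^sub>C x))\<^sup>2 = (cmod a * norm x)\<^sup>2"
    using of_real_eq_iff by blast
  then show ?thesis by (simp add: power2_eq_iff_nonneg)
qed

lemma scaleR_scaleC: "r *\<^sub>R x = complex_of_real r *\<^sub>C x"
  by (simp add: scaleC_of_real)

lemma ex_unimodular: "\<exists>c. cmod c = 1 \<and> c * w = complex_of_real (cmod w)"
proof (cases "w = 0")
  case False
  have "cnj w / complex_of_real (cmod w) * w = complex_of_real (cmod w)"
    using False complex_norm_square[of w] by (simp add: field_simps power2_eq_square)
  moreover have "cmod (cnj w / complex_of_real (cmod w)) = 1"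
    using False by (simp add: norm_divide)
  ultimately show ?thesis by blast
qed (auto intro: exI[of _ 1])

text \<open>A unimodular factor turns the complex inner product into its modulus, so the real
  Cauchy-Schwarz inequality applies.\<close>

lemma norm_cinner_le: "cmod (cinner x y) \<le> norm x * norm y"
proof -
  obtain c where c: "cmod c = 1" "c * cinner x y = complex_of_real (cmod (cinner x y))"
    using ex_unimodular by blast
  have "cmod (cinner x y) = inner (c *\<^sub>C x) y"
    by (simp add: inner_eq_Re_cinner cinner_scaleC_left c)
  also have "\<dots> \<le> norm (c *\<^sub>C x) * norm y" by (rule norm_cauchy_schwarz)
  finally show ?thesis by (simp add: norm_scaleC c)
qed

interpretation cinner: bounded_bilinear "cinner :: 'a::complex_inner \<Rightarrow> 'a \<Rightarrow> complex"
proof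
  fix r and a b :: 'a
  show "cinner (r *\<^sub>R a) b = r *\<^sub>R cinner a b"
    by (simp only: scaleR_scaleC[of r a] cinner_scaleC_left scaleR_conv_of_real)
  show "cinner a (r *\<^sub>R b) = r *\<^sub>R cinner a b"
    by (simp only: scaleR_scaleC[of r b] cinner_scaleC_right scaleR_conv_of_real
        complex_cnj_complex_of_real)
  show "\<exists>K. \<forall>a b::'a. norm (cinner a b) \<le> norm a * norm b * K"
    by (rule exI[of _ 1]) (simp add: norm_cinner_le)
qed (simp_all add: cinner_add_left cinner_add_right)

interpretation scaleC: bounded_bilinear "scaleC :: complex \<Rightarrow> 'a \<Rightarrow> 'a::complex_inner"
proof
  fix r a and b :: 'a
  show "(r *\<^sub>R a) *\<^sub>C b = r *\<^sub>R (a *\<^sub>C b)"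
    by (simp only: scaleR_scaleC[of r "a *\<^sub>C b"] scaleC_scaleC scaleR_conv_of_real)
  show "a *\<^sub>C (r *\<^sub>R b) = r *\<^sub>R (a *\<^sub>C b)"
    by (simp only: scaleR_scaleC[of r] scaleC_scaleC mult.commute)
  show "\<exists>K. \<forall>a. \<forall>b::'a. norm (a *\<^sub>C b) \<le> norm a * norm b * K"
    by (rule exI[of _ 1]) (simp add: norm_scaleC)
qed (simp_all add: scaleC_add_left scaleC_add_right)

lemmas cinner_lin = cinner.add_left cinner.add_right cinner.diff_left cinner.diff_right
  cinner.minus_left cinner.minus_right cinner.sum_left cinner.sum_right
  cinner_scaleC_left cinner_scaleC_right

lemma norm_add_square:
  "(norm (x + y))\<^sup>2 = (norm x)\<^sup>2 + (norm y)\<^sup>2 + 2 * Re (cinner (x :: 'a::complex_inner) y)"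
  by (simp add: power2_norm_eq_inner inner_add_left inner_add_right inner_commute
      flip: inner_eq_Re_cinner)

definition orthonormal :: "'a::complex_inner set \<Rightarrow> bool"
  where "orthonormal E \<longleftrightarrow>
    (\<forall>x\<in>E. norm x = 1) \<and> (\<forall>x\<in>E. \<forall>y\<in>E. x \<noteq> y \<longrightarrow> cinner x y = 0)"

text \<open>For a finite orthonormal \<open>E\<close> this is the orthogonal projection onto its
  span. For an arbitrary finite \<open>E\<close> it is still a nonnegative finite rank operator, and
  in that role it later supplies the perturbations.\<close>

definition oproj :: "'a::complex_inner set \<Rightarrow> 'a \<Rightarrow> 'a"
  where "oproj E x = (\<Sum>e\<in>E. cinner x e *\<^sub>C e)"

lemma oproj_in_span: "oproj E x \<in> complex_vector.span E"
  unfolding oproj_def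
  by (intro complex_vector.span_sum complex_vector.span_scale complex_vector.span_base)

lemma cinner_oproj:
  assumes "finite E" "orthonormal E" "e \<in> E"
  shows "cinner (oproj E x) e = cinner x e"
proof -
  have "cinner (oproj E x) e = (\<Sum>f\<in>E. if f = e then cinner x e else 0)"
    unfolding oproj_def cinner_lin
    using assms by (intro sum.cong refl) (auto simp: orthonormal_def cinner_self)
  then show ?thesis using assms by simp
qed

lemma cinner_span_eq_0:
  assumes "\<And>e. e \<in> E \<Longrightarrow> cinner x e = 0" "v \<in> complex_vector.span E"
  shows "cinner x v = 0"
  using assms(2)
proof (induction rule: complex_vector.span_induct)
  show "complex_vector.subspace {v. cinner x v = 0}"
    by (auto simp: complex_vector.subspace_def cinner_lin cinner.zero_right)
qed (use assms(1) in simp)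

lemma cinner_diff_oproj:
  assumes "finite E" "orthonormal E" "v \<in> complex_vector.span E"
  shows "cinner (x - oproj E x) v = 0"
  by (rule cinner_span_eq_0[OF _ assms(3)]) (simp add: cinner_lin cinner_oproj assms)

lemma norm_diff_oproj_le:
  assumes "finite E" "orthonormal E" "v \<in> complex_vector.span E"
  shows "norm (x - oproj E x) \<le> norm (x - v)"
proof -
  have "oproj E x - v \<in> complex_vector.span E"
    by (intro complex_vector.span_diff oproj_in_span assms)
  then have "cinner (x - oproj E x) (oproj E x - v) = 0"
    by (rule cinner_diff_oproj[OF assms(1,2)])
  then have "(norm (x - v))\<^sup>2 = (norm (x - oproj E x))\<^sup>2 + (norm (oproj E x - v))\<^sup>2"
    using norm_add_square[of "x - oproj E x" "oproj E x - v"] by simp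
  then show ?thesis
    by (metis le_add_same_cancel1 norm_ge_zero power2_le_imp_le zero_le_power2)
qed

lemma oproj_span:
  assumes "finite E" "orthonormal E" "v \<in> complex_vector.span E"
  shows "oproj E v = v"
  using norm_diff_oproj_le[OF assms, of v] by simp

text \<open>The single Gram-Schmidt step, shared by the finite orthonormalization and by the
  construction of infinite orthonormal sequences.\<close>

lemma oproj_residual:
  assumes "finite E" "orthonormal E" "x \<notin> complex_vector.span E"
  shows "\<exists>e c. c \<noteq> 0 \<and> norm e = 1 \<and> (\<forall>v\<in>E. cinner e v = 0) \<and> x = oproj E x + c *\<^sub>C e"
proof -
  define r where "r = norm (x - oproj E x)"
  have "r \<noteq> 0" using assms(3) oproj_in_span[of E x] by (auto simp: r_def)
  define e where "e = complex_of_real (inverse r) *\<^sub>C (x - oproj E x)"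
  have "norm e = 1"
    using \<open>r \<noteq> 0\<close> unfolding e_def norm_scaleC r_def by (simp add: norm_inverse)
  moreover have "\<forall>v\<in>E. cinner e v = 0"
    by (auto simp: e_def cinner_scaleC_left cinner_diff_oproj assms complex_vector.span_base)
  moreover have "x = oproj E x + complex_of_real r *\<^sub>C e"
    using \<open>r \<noteq> 0\<close> by (simp add: e_def scaleC_scaleC flip: of_real_mult)
  ultimately show ?thesis using \<open>r \<noteq> 0\<close> by (metis of_real_eq_0_iff)
qed

lemma gram_schmidt:
  assumes "finite F"
  shows "\<exists>E. finite E \<and> orthonormal E \<and> complex_vector.span E = complex_vector.span F"
  using assms
proof (induction F)
  case empty
  show ?case by (rule exI[of _ "{}"]) (simp add: orthonormal_def)
next
  case (insert v F)
  then obtain E where E: "finite E" "orthonormal E"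
    "complex_vector.span E = complex_vector.span F" by blast
  show ?case
  proof (cases "v \<in> complex_vector.span E")
    case True
    then have "complex_vector.span (insert v F) = complex_vector.span F"
      using E(3) by (intro complex_vector.span_redundant) simp
    then show ?thesis using E by (intro exI[of _ E]) simp
  next
    case False
    from oproj_residual[OF E(1,2) this] obtain e c where
      ec: "c \<noteq> 0" "norm e = 1" "\<forall>w\<in>E. cinner e w = 0" "v = oproj E v + c *\<^sub>C e" by blast
    have "\<forall>w\<in>E. cinner w e = 0"
      using ec(3) by (metis cinner_commute complex_cnj_zero)
    then have "orthonormal (insert e E)"
      using E(2) ec(2,3) by (auto simp: orthonormal_def)
    moreover have "complex_vector.span (insert e E) = complex_vector.span (insert v F)"
      (is "?L = ?R")
    proof
      have FL: "F \<subseteq> ?L"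
        using order_trans[OF complex_vector.span_superset[of F, folded E(3)]
            complex_vector.span_mono[of E "insert e E"]] by blast
      have ER: "E \<subseteq> ?R"
        using order_trans[OF complex_vector.span_superset[of E, unfolded E(3)]
            complex_vector.span_mono[of F "insert v F"]] by blast
      have "oproj E v \<in> ?L"
        using oproj_in_span complex_vector.span_mono[of E "insert e E"] by blast
      then have "oproj E v + c *\<^sub>C e \<in> ?L"
        by (rule complex_vector.span_add)
          (simp add: complex_vector.span_scale complex_vector.span_base)
      then have "v \<in> ?L" using ec(4) by simp
      then show "?R \<subseteq> ?L"
        using FL by (simp add: complex_vector.span_minimal)
      have "oproj E v \<in> ?R"
        using oproj_in_span[of E v] complex_vector.span_minimal[OF ER] by auto
      then have "v - oproj E v \<in> ?R"
        by (simp add: complex_vector.span_base complex_vector.span_diff)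
      moreover have "e = inverse c *\<^sub>C (v - oproj E v)"
        using ec(1) by (subst ec(4)) (simp add: scaleC_scaleC)
      ultimately have "e \<in> ?R" using complex_vector.span_scale by metis
      then show "?L \<subseteq> ?R"
        using ER by (simp add: complex_vector.span_minimal)
    qed
    ultimately show ?thesis using E(1) by (metis finite_insert)
  qed
qed

text \<open>If no finite orthonormal set spans \<open>D\<close>, the vectors chosen so far always
  miss a point of \<open>D\<close>; its normalized residual lies in the subspace \<open>D\<close>
  and continues the sequence.\<close>

lemma finite_basis_or_orthonormal_sequence:
  assumes D: "complex_vector.subspace D"
  obtains (finite_basis) E where "finite E" "orthonormal E" "D = complex_vector.span E"
  | (sequence) e :: "nat \<Rightarrow> 'a::complex_inner" where
      "\<And>n. e n \<in> D" "\<And>n. norm (e n) = 1" "\<And>m n. m \<noteq> n \<Longrightarrow> cinner (e m) (e n) = 0"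
proof (cases "\<exists>E. finite E \<and> orthonormal E \<and> D = complex_vector.span E")
  case False
  define P where "P f n r \<longleftrightarrow> r \<in> D \<and> norm r = 1 \<and> (\<forall>m<n. cinner r (f m) = 0)"
    for f :: "nat \<Rightarrow> 'a" and n r
  have "\<exists>e. \<forall>n. P e n (e n)"
  proof (rule dependent_wellorder_choice)
    show "P f n r = P g n r" if "\<And>m. m < n \<Longrightarrow> f m = g m" for r f g n
      using that by (auto simp: P_def)
    fix n f assume *: "P f m (f m)" if "m < n" for m
    have "orthonormal (f ` {..<n})"
      using * unfolding orthonormal_def P_def
      by (auto simp: image_iff) (metis cinner_commute complex_cnj_zero linorder_neqE_nat)
    moreover have "f ` {..<n} \<subseteq> D" using * by (auto simp: P_def)
    ultimately obtain x where x: "x \<in> D" "x \<notin> complex_vector.span (f ` {..<n})"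
      using False complex_vector.span_minimal[OF \<open>f ` {..<n} \<subseteq> D\<close> D] by blast
    from oproj_residual[OF _ \<open>orthonormal (f ` {..<n})\<close> x(2)] obtain e c where
      ec: "c \<noteq> 0" "norm e = 1" "\<forall>w\<in>f ` {..<n}. cinner e w = 0"
        "x = oproj (f ` {..<n}) x + c *\<^sub>C e" by auto
    have "e = inverse c *\<^sub>C (x - oproj (f ` {..<n}) x)"
      using ec(1) by (subst ec(4)) (simp add: scaleC_scaleC)
    then have "e \<in> D"
      using x(1) D oproj_in_span complex_vector.span_minimal[OF \<open>f ` {..<n} \<subseteq> D\<close> D]
      by (metis complex_vector.subspace_diff complex_vector.subspace_scale subsetD)
    then show "\<exists>r. P f n r" using ec by (auto simp: P_def)
  qed
  then obtain e where e: "\<And>n. P e n (e n)" by blast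
  then have "cinner (e m) (e n) = 0" if "m \<noteq> n" for m n
    using that unfolding P_def by (metis cinner_commute complex_cnj_zero linorder_neqE_nat)
  then show ?thesis using e sequence[of e] by (auto simp: P_def)
qed (use finite_basis in blast)

section \<open>Compact operators and weakly null sequences\<close>

lemma bounded_clinear_compose:
  assumes "bounded_clinear S" "bounded_clinear T"
  shows "bounded_clinear (\<lambda>x. S (T x))"
  using assms bounded_linear_compose[of S T] by (simp add: bounded_clinear_def)

lemma bounded_clinear_oproj: "bounded_clinear (oproj E)"
proof -
  have "bounded_linear (\<lambda>x. \<Sum>e\<in>E. cinner x e *\<^sub>C e)"
    by (intro bounded_linear_sum bounded_linear_compose[OF scaleC.bounded_linear_left]
        cinner.bounded_linear_left)
  moreover have "oproj E (c *\<^sub>C x) = c *\<^sub>C oproj E x" for c x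
    by (simp add: oproj_def cinner_scaleC_left scaleC.sum_right scaleC_scaleC)
  ultimately show ?thesis by (simp add: bounded_clinear_def oproj_def[abs_def])
qed

text \<open>Induction on \<open>E\<close>: each new vector replaces the set by a continuous image of
  its product with a closed disc.\<close>

lemma compact_bounded_combinations:
  assumes "finite E"
  shows "compact {\<Sum>e\<in>E. c e *\<^sub>C e | c. \<forall>e\<in>E. cmod (c e) \<le> M}"
  using assms
proof (induction E)
  case empty
  then show ?case by simp
next
  case (insert x E)
  let ?C = "\<lambda>E. {\<Sum>e\<in>E. c e *\<^sub>C e | c. \<forall>e\<in>E. cmod (c e) \<le> M}"
  have "?C (insert x E) = (\<lambda>(v, a). v + a *\<^sub>C x) ` (?C E \<times> cball 0 M)" (is "_ = ?R")
  proof
    show "?C (insert x E) \<subseteq> ?R"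
    proof
      fix y assume "y \<in> ?C (insert x E)"
      then obtain c where "y = (\<Sum>e\<in>insert x E. c e *\<^sub>C e)"
        "\<forall>e\<in>insert x E. cmod (c e) \<le> M" by blast
      then show "y \<in> ?R"
        using insert.hyps by (intro image_eqI[of _ _ "(\<Sum>e\<in>E. c e *\<^sub>C e, c x)"]) auto
    qed
    show "?R \<subseteq> ?C (insert x E)"
    proof
      fix y assume "y \<in> ?R"
      then obtain c a where c: "y = (\<Sum>e\<in>E. c e *\<^sub>C e) + a *\<^sub>C x"
        "\<forall>e\<in>E. cmod (c e) \<le> M" "cmod a \<le> M" by auto
      have "(\<Sum>e\<in>E. (c(x := a)) e *\<^sub>C e) = (\<Sum>e\<in>E. c e *\<^sub>C e)"
        using insert.hyps by (intro sum.cong) auto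
      then have "y = (\<Sum>e\<in>insert x E. (c(x := a)) e *\<^sub>C e)"
        using insert.hyps c(1) by (simp add: add.commute)
      then show "y \<in> ?C (insert x E)"
        using c(2,3) by (intro CollectI exI[of _ "c(x := a)"]) auto
    qed
  qed
  moreover have "compact ?R"
    by (intro compact_continuous_image compact_Times insert.IH compact_cball)
      (auto simp: case_prod_unfold intro!: continuous_intros scaleC.continuous_on)
  ultimately show ?case by metis
qed

lemma finite_rank_imp_compact_op:
  assumes "finite_rank_op K"
  shows "compact_op K"
proof -
  have K: "bounded_linear K" "bounded_clinear K"
    using assms by (auto simp: finite_rank_op_def bounded_clinear_def)
  obtain F where "finite F" "range K \<subseteq> complex_vector.span F"
    using assms by (auto simp: finite_rank_op_def)
  then obtain E where E: "finite E" "orthonormal E" "range K \<subseteq> complex_vector.span E"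
    using gram_schmidt by metis
  obtain M where M: "\<And>x. norm (K x) \<le> norm x * M"
    using bounded_linear.bounded[OF K(1)] by blast
  let ?C = "{\<Sum>e\<in>E. c e *\<^sub>C e | c. \<forall>e\<in>E. cmod (c e) \<le> \<bar>M\<bar>}"
  have "K ` cball 0 1 \<subseteq> ?C"
  proof
    fix y assume "y \<in> K ` cball 0 1"
    then obtain x where x: "y = K x" "norm x \<le> 1" by auto
    have "norm y \<le> norm x * \<bar>M\<bar>"
      using M[of x] x by (metis abs_ge_self mult_left_mono norm_ge_zero order_trans)
    also have "\<dots> \<le> \<bar>M\<bar>" using x by (simp add: mult_left_le_one_le)
    finally have y: "norm y \<le> \<bar>M\<bar>" .
    have "cmod (cinner y e) \<le> \<bar>M\<bar>" if "e \<in> E" for e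
      using norm_cinner_le[of y e] y E(2) that by (auto simp: orthonormal_def)
    moreover have "y = (\<Sum>e\<in>E. cinner y e *\<^sub>C e)"
      using oproj_span[OF E(1,2) subsetD[OF E(3)], of y] x(1) by (simp add: oproj_def)
    ultimately show "y \<in> ?C" by (intro CollectI exI[of _ "cinner y"]) auto
  qed
  then have "closure (K ` cball 0 1) \<subseteq> ?C"
    by (intro closure_minimal compact_imp_closed compact_bounded_combinations E)
  then have "compact (closure (K ` cball 0 1))"
    using compact_Int_closed[OF compact_bounded_combinations[OF E(1), of "\<bar>M\<bar>"],
        of "closure (K ` cball 0 1)"] by (simp add: Int_absorb1)
  then show ?thesis using K by (simp add: compact_op_def)
qed

text \<open>The vectors of a finite \<epsilon>-net of the image of the unit ball suffice: projecting
  onto their span is at least as good as moving to the nearest net point, and homogeneity extends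
  the bound to all \<open>x\<close>.\<close>

lemma compact_op_approx:
  assumes "compact_op K" "\<epsilon> > 0"
  obtains E where "finite E" "orthonormal E" "\<And>x. norm (K x - oproj E (K x)) \<le> \<epsilon> * norm x"
proof -
  have K: "\<And>c x. K (c *\<^sub>C x) = c *\<^sub>C K x" and "compact (closure (K ` cball 0 1))"
    using assms by (auto simp: compact_op_def bounded_clinear_def)
  then obtain F where F: "finite F" "closure (K ` cball 0 1) \<subseteq> (\<Union>k\<in>F. ball k \<epsilon>)"
    using \<open>\<epsilon> > 0\<close> unfolding compact_eq_totally_bounded by blast
  obtain E where E: "finite E" "orthonormal E"
    "complex_vector.span E = complex_vector.span F"
    using gram_schmidt[OF F(1)] by blast
  have "norm (K x - oproj E (K x)) \<le> \<epsilon> * norm x" for x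
  proof (cases "x = 0")
    case True
    then have "K x = 0" using K[of 0 x] by simp
    then show ?thesis using True by (simp add: oproj_def cinner.zero_left)
  next
    case False
    define u where "u = complex_of_real (inverse (norm x)) *\<^sub>C x"
    have u: "norm u = 1" "x = complex_of_real (norm x) *\<^sub>C u"
      using False by (simp_all add: u_def norm_scaleC scaleC_scaleC norm_inverse flip: of_real_mult)
    have "K u \<in> closure (K ` cball 0 1)"
      using u(1) by (intro closure_subset[THEN subsetD] imageI) simp
    then obtain k where k: "k \<in> F" "norm (K u - k) < \<epsilon>"
      using F(2) by (auto simp: dist_norm norm_minus_commute)
    have "k \<in> complex_vector.span E" using k(1) E(3) by (simp add: complex_vector.span_base)
    then have *: "norm (K u - oproj E (K u)) \<le> \<epsilon>"
      using norm_diff_oproj_le[OF E(1,2), of k "K u"] k(2) by linarith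
    have "K x - oproj E (K x) = complex_of_real (norm x) *\<^sub>C (K u - oproj E (K u))"
      using bounded_clinear_oproj[of E] K[of "norm x" u] u(2)
      by (simp add: bounded_clinear_def scaleC.diff_right)
    then show ?thesis using * False by (simp add: norm_scaleC mult.commute)
  qed
  then show ?thesis using that E by blast
qed

text \<open>The projected part of \<open>K\<close> tests \<open>X n\<close> against finitely many
  vectors and tends to zero; the remainder is small uniformly in n because the norms are
  bounded.\<close>

lemma weakly_null_compact_op:
  assumes K: "compact_op K" and X: "weakly_null X" and bd: "\<And>n. norm (X n) \<le> M"
  shows "(\<lambda>n. cinner (K (X n)) (X n)) \<longlonglongrightarrow> 0"
proof (rule LIMSEQ_I)
  fix r :: real assume "r > 0"
  have "M \<ge> 0" using bd[of 0] norm_ge_zero order_trans by blast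
  \<comment> \<open>The summand 1 covers M = 0 and makes the later estimate by r / 2 strict.\<close>
  define \<epsilon> where "\<epsilon> = r / (2 * (M\<^sup>2 + 1))"
  have "\<epsilon> > 0" using \<open>r > 0\<close> by (simp add: \<epsilon>_def add_nonneg_pos)
  then obtain E where E: "finite E" "orthonormal E"
    "\<And>x. norm (K x - oproj E (K x)) \<le> \<epsilon> * norm x"
    using compact_op_approx[OF K] by metis
  have "bounded_linear K" using K by (simp add: compact_op_def bounded_clinear_def)
  then obtain L where L: "\<And>x. norm (K x) \<le> norm x * L" "L \<ge> 0"
    using bounded_linear.nonneg_bounded by metis
  have "(\<lambda>n. cinner (K (X n)) e * cinner e (X n)) \<longlonglongrightarrow> 0" if "e \<in> E" for e
  proof (rule Lim_null_comparison[where g = "\<lambda>n. L * M * cmod (cinner (X n) e)"])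
    have "(\<lambda>n. cinner (X n) e) \<longlonglongrightarrow> 0" using X by (auto simp: weakly_null_def)
    then show "(\<lambda>n. L * M * cmod (cinner (X n) e)) \<longlonglongrightarrow> 0"
      by (intro tendsto_mult_right_zero tendsto_norm_zero)
    have "cmod (cinner (K (X n)) e) \<le> L * M" for n
    proof -
      have "cmod (cinner (K (X n)) e) \<le> norm (K (X n)) * norm e" by (rule norm_cinner_le)
      also have "\<dots> = norm (K (X n))" using E(2) that by (simp add: orthonormal_def)
      also have "\<dots> \<le> L * M"
        using L(1)[of "X n"] mult_right_mono[OF bd[of n] L(2)] by (simp add: mult.commute)
      finally show ?thesis .
    qed
    moreover have "cmod (cinner e (X n)) = cmod (cinner (X n) e)" for n
      by (metis cinner_commute complex_mod_cnj)
    ultimately show "\<forall>\<^sub>F n in sequentially. cmod (cinner (K (X n)) e * cinner e (X n))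
        \<le> L * M * cmod (cinner (X n) e)"
      by (intro always_eventually allI) (simp add: norm_mult mult_right_mono)
  qed
  then have "(\<lambda>n. \<Sum>e\<in>E. cinner (K (X n)) e * cinner e (X n)) \<longlonglongrightarrow> 0"
    by (rule tendsto_null_sum)
  moreover have "cinner (oproj E (K (X n))) (X n)
      = (\<Sum>e\<in>E. cinner (K (X n)) e * cinner e (X n))" for n
    by (simp add: oproj_def cinner_lin)
  ultimately have "(\<lambda>n. cinner (oproj E (K (X n))) (X n)) \<longlonglongrightarrow> 0" by simp
  then obtain N where N: "\<And>n. n \<ge> N \<Longrightarrow> cmod (cinner (oproj E (K (X n))) (X n)) < r / 2"
    using LIMSEQ_D[of _ 0 "r / 2"] \<open>r > 0\<close> by fastforce
  have "cmod (cinner (K (X n)) (X n)) < r" if "n \<ge> N" for n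
  proof -
    have "cmod (cinner (K (X n) - oproj E (K (X n))) (X n)) \<le> \<epsilon> * norm (X n) * norm (X n)"
      using norm_cinner_le E(3)[of "X n"] by (meson mult_right_mono norm_ge_zero order_trans)
    also have "\<dots> \<le> \<epsilon> * (M * M)"
      using mult_mono[OF bd[of n] bd[of n] \<open>M \<ge> 0\<close>] \<open>\<epsilon> > 0\<close> by (simp add: mult.assoc)
    also have "\<dots> < \<epsilon> * (M\<^sup>2 + 1)" using \<open>\<epsilon> > 0\<close> by (simp add: power2_eq_square)
    also have "\<dots> = r / 2"
      using add_nonneg_pos[of "M\<^sup>2" 1] unfolding \<epsilon>_def by (simp add: nonzero_divide_mult_cancel_right divide_simps)
    finally have "cmod (cinner (K (X n)) (X n) - cinner (oproj E (K (X n))) (X n)) < r / 2"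
      by (simp add: cinner.diff_left)
    then show ?thesis
      using N[OF that] norm_triangle_sub[of "cinner (K (X n)) (X n)" "cinner (oproj E (K (X n))) (X n)"]
      by linarith
  qed
  then show "\<exists>no. \<forall>n\<ge>no. norm (cinner (K (X n)) (X n) - 0) < r" by auto
qed

text \<open>A substitute for Bessel's inequality. Because each vector overlaps its predecessors by
  at most 1 in total, combinations of m vectors with coefficients in the unit disc have squared norm
  of order m, not m^2. Aligning phases with \<open>y\<close> then leaves only finitely many inner
  products of modulus at least \<epsilon>.\<close>

lemma weakly_null_almost_orthonormal:
  assumes z: "\<And>k. norm (z k) = 1" "\<And>k. (\<Sum>j<k. cmod (cinner (z k) (z j))) \<le> 1"
  shows "weakly_null z"
  unfolding weakly_null_def
proof
  fix y
  \<comment> \<open>The constant 3 is 1 for the new vector plus twice its total overlap with the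
    earlier ones.\<close>
  have comb: "(norm (\<Sum>k\<in>S. c k *\<^sub>C z k))\<^sup>2 \<le> 3 * card S"
    if "finite S" "\<And>k. cmod (c k) \<le> 1" for S c
    using that(1)
  proof (induction S rule: finite_linorder_max_induct)
    case (insert k S)
    let ?v = "\<Sum>j\<in>S. c j *\<^sub>C z j"
    have "k \<notin> S" using insert by auto
    have "Re (cinner (c k *\<^sub>C z k) ?v) \<le> cmod (cinner (c k *\<^sub>C z k) ?v)"
      by (rule complex_Re_le_cmod)
    also have "\<dots> \<le> (\<Sum>j\<in>S. cmod (cinner (c k *\<^sub>C z k) (c j *\<^sub>C z j)))"
      unfolding cinner.sum_right by (rule norm_sum)
    also have "\<dots> \<le> (\<Sum>j\<in>S. cmod (cinner (z k) (z j)))"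
    proof (rule sum_mono)
      fix j
      have "cmod (c k) * (cmod (c j) * cmod (cinner (z k) (z j)))
          \<le> 1 * (1 * cmod (cinner (z k) (z j)))"
        by (intro mult_mono that) auto
      then show "cmod (cinner (c k *\<^sub>C z k) (c j *\<^sub>C z j)) \<le> cmod (cinner (z k) (z j))"
        by (simp add: cinner_lin norm_mult mult_ac)
    qed
    also have "\<dots> \<le> (\<Sum>j<k. cmod (cinner (z k) (z j)))"
      using insert by (intro sum_mono2) auto
    also have "\<dots> \<le> 1" by (rule z)
    finally have "(norm (c k *\<^sub>C z k + ?v))\<^sup>2 \<le> (norm (c k *\<^sub>C z k))\<^sup>2 + 3 * card S + 2"
      unfolding norm_add_square using insert.IH by simp
    moreover have "(norm (c k *\<^sub>C z k))\<^sup>2 \<le> 1"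
      using that(2)[of k] by (simp add: norm_scaleC z power_le_one)
    ultimately show ?case using \<open>k \<notin> S\<close> insert by simp
  qed simp
  show "(\<lambda>n. cinner (z n) y) \<longlonglongrightarrow> 0"
  proof (rule tendstoI)
    fix \<epsilon> :: real assume "\<epsilon> > 0"
    let ?T = "{k. cmod (cinner (z k) y) \<ge> \<epsilon>}"
    define c where "c k = (SOME c. cmod c = 1 \<and>
        c * cinner (z k) y = complex_of_real (cmod (cinner (z k) y)))" for k
    have c: "cmod (c k) = 1"
      "c k * cinner (z k) y = complex_of_real (cmod (cinner (z k) y))" for k
      using someI_ex[OF ex_unimodular[of "cinner (z k) y"]] by (auto simp: c_def)
    \<comment> \<open>With the phases \<open>c k\<close> the moduli add up, so \<epsilon> m is at
      most sqrt (3 m) times the norm of \<open>y\<close>, where m is the cardinality of S; this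
      bounds m.\<close>
    have card: "card S \<le> 3 * (norm y)\<^sup>2 / \<epsilon>\<^sup>2" if S: "finite S" "S \<subseteq> ?T" for S
    proof (cases "S = {}")
      case False
      let ?v = "\<Sum>k\<in>S. c k *\<^sub>C z k"
      have "\<epsilon> * card S \<le> (\<Sum>k\<in>S. cmod (cinner (z k) y))"
        using sum_bounded_below[of S \<epsilon> "\<lambda>k. cmod (cinner (z k) y)"] S(2)
        by (simp add: mult.commute subset_iff)
      also have "\<dots> = Re (cinner ?v y)" by (simp add: cinner_lin c)
      also have "\<dots> \<le> norm ?v * norm y"
        using complex_Re_le_cmod norm_cinner_le order_trans by blast
      finally have "(\<epsilon> * card S)\<^sup>2 \<le> (norm ?v * norm y)\<^sup>2"
        using \<open>\<epsilon> > 0\<close> by (intro power_mono) auto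
      also have "\<dots> \<le> 3 * card S * (norm y)\<^sup>2"
        using comb[OF S(1), of c] c(1) by (simp add: power_mult_distrib mult_right_mono)
      finally have "card S * (\<epsilon>\<^sup>2 * card S) \<le> card S * (3 * (norm y)\<^sup>2)"
        by (simp add: power2_eq_square mult_ac)
      moreover have "card S > 0" using S False by (simp add: card_gt_0_iff)
      ultimately have "\<epsilon>\<^sup>2 * card S \<le> 3 * (norm y)\<^sup>2"
        by (metis mult_le_cancel_left_pos of_nat_0_less_iff)
      then show ?thesis using \<open>\<epsilon> > 0\<close> by (simp add: field_simps)
    qed simp
    have "finite ?T"
    proof (rule ccontr)
      assume "infinite ?T"
      then obtain S where "S \<subseteq> ?T" "finite S" "card S = Suc (nat \<lceil>3 * (norm y)\<^sup>2 / \<epsilon>\<^sup>2\<rceil>)"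
        using infinite_arbitrarily_large by metis
      then show False using card[of S] by linarith
    qed
    then have "\<forall>\<^sub>F k in sequentially. k \<notin> ?T"
      by (simp add: eventually_cofinite flip: cofinite_eq_sequentially)
    then show "\<forall>\<^sub>F k in sequentially. dist (cinner (z k) y) 0 < \<epsilon>"
      by eventually_elim auto
  qed
qed

lemma weakly_null_orthonormal:
  assumes "\<And>n. norm (e n) = 1" "\<And>m n. m \<noteq> n \<Longrightarrow> cinner (e m) (e n) = 0"
  shows "weakly_null e"
proof (rule weakly_null_almost_orthonormal)
  fix k
  have "(\<Sum>j<k. cmod (cinner (e k) (e j))) = 0"
    using assms(2)[of k] by (intro sum.neutral) auto
  then show "(\<Sum>j<k. cmod (cinner (e k) (e j))) \<le> 1" by simp
qed (rule assms(1))

lemma weakly_null_eventually_small: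
  assumes "weakly_null X" "finite Z" "\<epsilon> > 0"
  shows "\<forall>\<^sub>F n in sequentially. \<forall>z\<in>Z. cmod (cinner (X n) z) < \<epsilon>"
proof (intro eventually_ball_finite ballI assms)
  fix z
  have "(\<lambda>n. cinner (X n) z) \<longlonglongrightarrow> 0" using assms(1) by (simp add: weakly_null_def)
  from tendstoD[OF this assms(3)]
  show "\<forall>\<^sub>F n in sequentially. cmod (cinner (X n) z) < \<epsilon>" by simp
qed

section \<open>Limits of functions along weakly null unit sequences\<close>

text \<open>Common form of both essential numerical ranges: \<open>f\<close> is the quadratic form
  on a domain for W_e, and the quotient of two forms, on vectors where the denominator does not
  vanish, for w_e.\<close>

definition weak_limits :: "'a::complex_inner set \<Rightarrow> ('a \<Rightarrow> complex) \<Rightarrow> complex set"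
  where "weak_limits U f =
    {\<mu>. \<exists>X. (\<forall>n. X n \<in> U \<and> norm (X n) = 1) \<and> weakly_null X \<and> (\<lambda>n. f (X n)) \<longlonglongrightarrow> \<mu>}"

text \<open>Weakly null sequences are replaced by finitely many approximate orthogonality conditions,
  although the weak topology of a nonseparable space is not metrizable on the unit ball.\<close>

lemma weak_limits_iff:
  "\<mu> \<in> weak_limits U f \<longleftrightarrow>
    (\<forall>Z \<epsilon>. finite Z \<longrightarrow> \<epsilon> > 0 \<longrightarrow>
      (\<exists>v\<in>U. norm v = 1 \<and> cmod (f v - \<mu>) < \<epsilon> \<and> (\<forall>z\<in>Z. cmod (cinner v z) < \<epsilon>)))"
    (is "_ \<longleftrightarrow> ?R")
proof
  assume "\<mu> \<in> weak_limits U f"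
  then obtain X where X: "\<And>n. X n \<in> U" "\<And>n. norm (X n) = 1" "weakly_null X"
    "(\<lambda>n. f (X n)) \<longlonglongrightarrow> \<mu>" by (auto simp: weak_limits_def)
  show ?R
  proof (intro allI impI)
    fix Z :: "'a set" and \<epsilon> :: real assume "finite Z" "\<epsilon> > 0"
    then have "\<forall>\<^sub>F n in sequentially. (\<forall>z\<in>Z. cmod (cinner (X n) z) < \<epsilon>) \<and> dist (f (X n)) \<mu> < \<epsilon>"
      using X by (intro eventually_conj weakly_null_eventually_small tendstoD)
    then obtain n where "\<forall>z\<in>Z. cmod (cinner (X n) z) < \<epsilon>" "dist (f (X n)) \<mu> < \<epsilon>"
      using eventually_happens by force
    then show "\<exists>v\<in>U. norm v = 1 \<and> cmod (f v - \<mu>) < \<epsilon> \<and> (\<forall>z\<in>Z. cmod (cinner v z) < \<epsilon>)"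
      using X by (auto simp: dist_norm)
  qed
next
  assume R: ?R
  let ?e = "\<lambda>n. inverse (real (Suc n))"
  \<comment> \<open>Each vector is tested against its predecessors instead of a fixed set: n
    overlaps below 1 / (n + 1) sum to at most 1, which is the criterion for weak nullity.\<close>
  define P where "P X n v \<longleftrightarrow> v \<in> U \<and> norm v = 1 \<and> cmod (f v - \<mu>) < ?e n \<and>
    (\<forall>m<n. cmod (cinner v (X m)) < ?e n)" for X :: "nat \<Rightarrow> 'a" and n v
  have "\<exists>X. \<forall>n. P X n (X n)"
  proof (rule dependent_wellorder_choice)
    show "P X n v = P Y n v" if "\<And>m. m < n \<Longrightarrow> X m = Y m" for v X Y n
      using that by (auto simp: P_def)
    show "\<exists>v. P X n v" for n X
      using R[rule_format, of "X ` {..<n}" "?e n"] by (auto simp: P_def)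
  qed
  then obtain X where X: "\<And>n. P X n (X n)" by blast
  have "weakly_null X"
  proof (rule weakly_null_almost_orthonormal)
    fix k
    have "(\<Sum>j<k. cmod (cinner (X k) (X j))) \<le> (\<Sum>j<k. ?e k)"
      using X[of k] by (intro sum_mono) (auto simp: P_def less_imp_le)
    also have "\<dots> \<le> 1" by (simp add: field_simps)
    finally show "(\<Sum>j<k. cmod (cinner (X k) (X j))) \<le> 1" .
  qed (use X P_def in blast)
  moreover have "(\<lambda>n. f (X n) - \<mu>) \<longlonglongrightarrow> 0"
    using X by (intro Lim_null_comparison[OF _ LIMSEQ_inverse_real_of_nat])
      (auto simp: P_def less_imp_le)
  ultimately show "\<mu> \<in> weak_limits U f"
    using X by (auto simp: weak_limits_def P_def LIM_zero_iff intro!: exI[of _ X])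
qed

text \<open>The finite test characterization replaces a diagonal argument over sequences: an
  approximating limit point passes each test with half the tolerance.\<close>

lemma closed_weak_limits: "closed (weak_limits U f)"
proof -
  have "\<mu> \<in> weak_limits U f" if \<mu>: "\<mu> \<in> closure (weak_limits U f)" for \<mu>
    unfolding weak_limits_iff
  proof (intro allI impI)
    fix Z :: "'a set" and \<epsilon> :: real assume *: "finite Z" "\<epsilon> > 0"
    then obtain \<nu> where \<nu>: "\<nu> \<in> weak_limits U f" "cmod (\<nu> - \<mu>) < \<epsilon> / 2"
      using \<mu> closure_approachable[of \<mu>] by (metis dist_norm half_gt_zero)
    from \<nu>(1)[unfolded weak_limits_iff, rule_format, of Z "\<epsilon> / 2"] *
    obtain v where v: "v \<in> U" "norm v = 1" "cmod (f v - \<nu>) < \<epsilon> / 2"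
      "\<forall>z\<in>Z. cmod (cinner v z) < \<epsilon> / 2" by auto
    have "cmod (f v - \<mu>) < \<epsilon>"
      using norm_triangle_ineq[of "f v - \<nu>" "\<nu> - \<mu>"] v(3) \<nu>(2) by simp
    then show "\<exists>v\<in>U. norm v = 1 \<and> cmod (f v - \<mu>) < \<epsilon> \<and> (\<forall>z\<in>Z. cmod (cinner v z) < \<epsilon>)"
      using v * by (intro bexI[of _ v]) auto
  qed
  then show ?thesis using closure_subset_eq by blast
qed

section \<open>Numerical ranges under perturbation\<close>

abbreviation qform :: "'a::complex_inner operator \<Rightarrow> 'a \<Rightarrow> complex"
  where "qform S x \<equiv> cinner (the (S x)) x"

lemma dom_op_perturb [simp]: "dom (op_perturb A K) = dom A"
  by (auto simp: op_perturb_def op_add_def dom_def)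

lemma the_op_perturb: "x \<in> dom A \<Longrightarrow> the (op_perturb A K x) = the (A x) + K x"
  by (auto simp: op_perturb_def op_add_def)

lemma qform_op_perturb:
  "x \<in> dom A \<Longrightarrow> qform (op_perturb A K) x = qform A x + cinner (K x) x"
  by (simp add: the_op_perturb cinner.add_left)

lemma dom_pencil: "dom (pencil A B \<mu>) = dom A \<inter> dom B"
  by (auto simp: pencil_def op_add_def op_scale_def dom_def split: if_splits)

lemma qform_pencil:
  "x \<in> dom A \<Longrightarrow> x \<in> dom B \<Longrightarrow> qform (pencil A B \<mu>) x = qform A x - \<mu> * qform B x"
  by (auto simp: pencil_def op_add_def op_scale_def dom_def cinner_lin)

lemma linear_operatorD:
  assumes "linear_operator A"
  shows "complex_vector.subspace (dom A)"
    and "x \<in> dom A \<Longrightarrow> y \<in> dom A \<Longrightarrow> the (A (x + y)) = the (A x) + the (A y)"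
    and "x \<in> dom A \<Longrightarrow> the (A (c *\<^sub>C x)) = c *\<^sub>C the (A x)"
    and "x \<in> dom A \<Longrightarrow> c *\<^sub>C x \<in> dom A"
  using assms unfolding linear_operator_def complex_vector.subspace_def by blast+

lemma qform_scaleC:
  assumes "linear_operator A" "x \<in> dom A"
  shows "qform A (c *\<^sub>C x) = complex_of_real ((cmod c)\<^sup>2) * qform A x"
  using assms linear_operatorD(3)[OF assms]
  by (simp add: cinner_scaleC_left cinner_scaleC_right complex_norm_square mult.commute
      del: of_real_power)

lemma bounded_clinear_add: "bounded_clinear K \<Longrightarrow> K (x + y) = K x + K y"
  by (auto simp: bounded_clinear_def bounded_linear.linear linear_add)

lemma linear_operator_op_perturb:
  assumes "linear_operator A" "bounded_clinear K"
  shows "linear_operator (op_perturb A K)"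
  unfolding linear_operator_def
proof (intro conjI ballI allI)
  show "complex_vector.subspace (dom (op_perturb A K))"
    using linear_operatorD(1)[OF assms(1)] by simp
  fix x assume x: "x \<in> dom (op_perturb A K)"
  show "the (op_perturb A K (c *\<^sub>C x)) = c *\<^sub>C the (op_perturb A K x)" for c
    using x assms linear_operatorD[OF assms(1)]
    by (simp add: the_op_perturb scaleC_add_right bounded_clinear_def)
  fix y assume y: "y \<in> dom (op_perturb A K)"
  have "x + y \<in> dom A"
    using x y linear_operatorD(1)[OF assms(1)] by (simp add: complex_vector.subspace_add)
  then show "the (op_perturb A K (x + y)) = the (op_perturb A K x) + the (op_perturb A K y)"
    using x y linear_operatorD(2)[OF assms(1)] bounded_clinear_add[OF assms(2)]
    by (simp add: the_op_perturb)
qed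

lemma normalize_in_dom:
  assumes "linear_operator A" "x \<in> dom A" "x \<noteq> 0"
  obtains u c where "u \<in> dom A" "norm u = 1" "x = c *\<^sub>C u" "c \<noteq> 0"
proof
  let ?c = "complex_of_real (norm x)"
  show "inverse ?c *\<^sub>C x \<in> dom A" using assms by (simp add: linear_operatorD)
  show "norm (inverse ?c *\<^sub>C x) = 1" "x = ?c *\<^sub>C (inverse ?c *\<^sub>C x)" "?c \<noteq> 0"
    using assms(3) by (simp_all add: norm_scaleC norm_inverse scaleC_scaleC)
qed

lemma quot_num_range_unit:
  assumes "linear_operator A" "linear_operator B" "dom A \<subseteq> dom B"
  shows "quot_num_range A B =
    {qform A x / qform B x | x. x \<in> dom A \<and> norm x = 1 \<and> qform B x \<noteq> 0}"
proof
  show "quot_num_range A B \<subseteq> {qform A x / qform B x | x. x \<in> dom A \<and> norm x = 1 \<and> qform B x \<noteq> 0}"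
  proof
    fix \<mu> assume "\<mu> \<in> quot_num_range A B"
    then obtain x where x: "x \<in> dom A" "qform B x \<noteq> 0" "\<mu> = qform A x / qform B x"
      by (auto simp: quot_num_range_def)
    then have "x \<noteq> 0" by (auto simp: cinner.zero_right)
    then obtain u c where u: "u \<in> dom A" "norm u = 1" "x = c *\<^sub>C u" "c \<noteq> 0"
      using normalize_in_dom[OF assms(1) x(1)] by metis
    then have "qform A x = complex_of_real ((cmod c)\<^sup>2) * qform A u"
      "qform B x = complex_of_real ((cmod c)\<^sup>2) * qform B u"
      using assms qform_scaleC by blast+
    then have "\<mu> = qform A u / qform B u" "qform B u \<noteq> 0"
      using x u(4) by auto
    then show "\<mu> \<in> {qform A x / qform B x | x. x \<in> dom A \<and> norm x = 1 \<and> qform B x \<noteq> 0}"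
      using u by blast
  qed
qed (auto simp: quot_num_range_def)

lemma pencil_num_range_iff:
  assumes "dom A \<subseteq> dom B"
  shows "\<mu> \<in> pencil_num_range A B \<longleftrightarrow>
    (\<forall>\<epsilon>>0. \<exists>x\<in>dom A. norm x = 1 \<and> cmod (qform A x - \<mu> * qform B x) < \<epsilon>)"
proof -
  have "dom A \<inter> dom B = dom A" using assms by blast
  have "num_range (pencil A B \<mu>) = (\<lambda>x. qform A x - \<mu> * qform B x) ` {x \<in> dom A. norm x = 1}"
    unfolding num_range_def dom_pencil \<open>dom A \<inter> dom B = dom A\<close> setcompr_eq_image
    using assms by (intro image_cong refl) (simp add: qform_pencil subset_iff)
  then show ?thesis
    unfolding pencil_num_range_def mem_Collect_eq closure_approachable
    by (simp add: dist_norm Bex_def conj_assoc)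
qed

lemma quot_subset_pencil_num_range:
  assumes "linear_operator A" "linear_operator B" "dom A \<subseteq> dom B"
  shows "quot_num_range A B \<subseteq> pencil_num_range A B"
proof
  fix \<mu> assume "\<mu> \<in> quot_num_range A B"
  then obtain x where "x \<in> dom A" "norm x = 1" "qform A x - \<mu> * qform B x = 0"
    unfolding quot_num_range_unit[OF assms] by force
  then show "\<mu> \<in> pencil_num_range A B"
    unfolding pencil_num_range_iff[OF assms(3)] by (metis norm_zero)
qed

lemma ess_num_range_weak_limits: "ess_num_range S = weak_limits (dom S) (qform S)"
  by (simp add: ess_num_range_def weak_limits_def)

lemma quot_ess_num_range_weak_limits:
  "quot_ess_num_range A B =
    weak_limits {x \<in> dom A. qform B x \<noteq> 0} (\<lambda>x. qform A x / qform B x)"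
  by (simp add: quot_ess_num_range_def weak_limits_def conj_assoc)

lemma closed_quot_ess_num_range: "closed (quot_ess_num_range A B)"
  unfolding quot_ess_num_range_weak_limits by (rule closed_weak_limits)

text \<open>Negating the finite test characterization at 0 makes the hypothesis quantitative; the
  same \<eta> serves as test tolerance and as lower bound.\<close>

lemma not_in_ess_num_range_form_bound:
  assumes "0 \<notin> ess_num_range B"
  obtains Z \<eta> where "finite Z" "\<eta> > 0"
    "\<And>v. v \<in> dom B \<Longrightarrow> norm v = 1 \<Longrightarrow> \<forall>z\<in>Z. cmod (cinner v z) < \<eta> \<Longrightarrow> cmod (qform B v) \<ge> \<eta>"
  using assms unfolding ess_num_range_weak_limits weak_limits_iff
  by (metis (no_types, lifting) diff_zero linorder_not_le)

text \<open>Along a weakly null sequence the form of \<open>K\<close> tends to zero while the form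
  of \<open>B\<close> eventually stays above \<eta>, so the perturbation does not change the limit
  of the quotients.\<close>

lemma quot_ess_subset_closure_quot:
  assumes "linear_operator A" "dom A \<subseteq> dom B" "0 \<notin> ess_num_range B" "compact_op K"
  shows "quot_ess_num_range A B \<subseteq> closure (quot_num_range (op_perturb A K) B)"
proof
  fix \<mu> assume "\<mu> \<in> quot_ess_num_range A B"
  then obtain X where X: "\<And>n. X n \<in> dom A" "\<And>n. qform B (X n) \<noteq> 0" "\<And>n. norm (X n) = 1"
    "weakly_null X" "(\<lambda>n. qform A (X n) / qform B (X n)) \<longlonglongrightarrow> \<mu>"
    by (auto simp: quot_ess_num_range_def)
  obtain Z \<eta> where Z: "finite Z" "\<eta> > 0"
    "\<And>v. v \<in> dom B \<Longrightarrow> norm v = 1 \<Longrightarrow> \<forall>z\<in>Z. cmod (cinner v z) < \<eta> \<Longrightarrow> cmod (qform B v) \<ge> \<eta>"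
    using not_in_ess_num_range_form_bound[OF assms(3)] by metis
  have K0: "(\<lambda>n. cinner (K (X n)) (X n)) \<longlonglongrightarrow> 0"
    by (rule weakly_null_compact_op[OF assms(4) X(4), of 1]) (simp add: X)
  have "(\<lambda>n. cinner (K (X n)) (X n) / qform B (X n)) \<longlonglongrightarrow> 0"
  proof (rule Lim_null_comparison)
    show "(\<lambda>n. cmod (cinner (K (X n)) (X n)) / \<eta>) \<longlonglongrightarrow> 0"
      using tendsto_divide[OF tendsto_norm_zero[OF K0] tendsto_const[of \<eta>]] Z(2) by simp
    show "\<forall>\<^sub>F n in sequentially. cmod (cinner (K (X n)) (X n) / qform B (X n))
        \<le> cmod (cinner (K (X n)) (X n)) / \<eta>"
      using weakly_null_eventually_small[OF X(4) Z(1,2)]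
    proof eventually_elim
      case (elim n)
      then have "cmod (qform B (X n)) \<ge> \<eta>" using X assms(2) by (intro Z(3)) blast+
      then show ?case using Z(2) by (simp add: norm_divide frac_le)
    qed
  qed
  from tendsto_add[OF X(5) this]
  have "(\<lambda>n. qform (op_perturb A K) (X n) / qform B (X n)) \<longlonglongrightarrow> \<mu>"
    by (simp add: qform_op_perturb[OF X(1)] add_divide_distrib)
  moreover have "qform (op_perturb A K) (X n) / qform B (X n) \<in> quot_num_range (op_perturb A K) B"
    for n using X unfolding quot_num_range_def dom_op_perturb by blast
  ultimately show "\<mu> \<in> closure (quot_num_range (op_perturb A K) B)"
    unfolding closure_sequential
    by (intro exI[of _ "\<lambda>n. qform (op_perturb A K) (X n) / qform B (X n)"]) simp
qed

section \<open>From finite rank to compact perturbations\<close>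

text \<open>If the forms of A + K and B can be made small together on unit vectors, every number
  lies in W(A + K, B). Otherwise the form of B stays away from zero at the vectors obtained by
  approximation, and their quotients come arbitrarily close to \<mu>.\<close>

lemma closure_pencil_num_range_compact_approx:
  assumes A: "linear_operator A" and B: "linear_operator B" and AB: "dom A \<subseteq> dom B"
    and K: "compact_op K"
    and \<mu>: "\<And>F. finite_rank_op F \<Longrightarrow> \<mu> \<in> closure (pencil_num_range (op_perturb A F) B)"
  shows "\<mu> \<in> closure (pencil_num_range (op_perturb A K) B)"
proof -
  let ?a = "\<lambda>x. qform A x + cinner (K x) x" and ?b = "qform B"
  have Kl: "bounded_clinear K" using K by (simp add: compact_op_def)
  note AK = linear_operator_op_perturb[OF A Kl]
  have ABK: "dom (op_perturb A K) \<subseteq> dom B" using AB by simp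
  \<comment> \<open>One \<delta> comes from membership for the finite rank operator, the other from
    replacing \<open>oproj E (K x)\<close> by \<open>K x\<close>. The number \<nu> depends on
    \<delta>.\<close>
  have approx: "\<exists>x\<in>dom A. \<exists>\<nu>. norm x = 1 \<and> cmod (\<nu> - \<mu>) < \<delta> \<and> cmod (?a x - \<nu> * ?b x) < 2 * \<delta>"
    if \<delta>: "\<delta> > 0" for \<delta>
  proof -
    obtain E where E: "finite E" "orthonormal E" "\<And>x. norm (K x - oproj E (K x)) \<le> \<delta>/2 * norm x"
      using compact_op_approx[OF K half_gt_zero[OF \<delta>]] by metis
    have "finite_rank_op (\<lambda>x. oproj E (K x))"
      using E(1) bounded_clinear_compose[OF bounded_clinear_oproj Kl] oproj_in_span
      by (auto simp: finite_rank_op_def)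
    from \<mu>[OF this] obtain \<nu> where \<nu>: "cmod (\<nu> - \<mu>) < \<delta>"
      "\<nu> \<in> pencil_num_range (op_perturb A (\<lambda>x. oproj E (K x))) B"
      using \<delta> unfolding closure_approachable dist_norm by blast
    then obtain x where x: "x \<in> dom A" "norm x = 1"
      "cmod (qform A x + cinner (oproj E (K x)) x - \<nu> * ?b x) < \<delta>"
      using \<delta> AB pencil_num_range_iff[of "op_perturb A (\<lambda>x. oproj E (K x))" B]
      by (metis dom_op_perturb qform_op_perturb)
    have "cmod (cinner (K x - oproj E (K x)) x) \<le> norm (K x - oproj E (K x)) * norm x"
      by (rule norm_cinner_le)
    also have "\<dots> \<le> \<delta>/2" using E(3)[of x] x by simp
    finally have "cmod (cinner (K x - oproj E (K x)) x) < \<delta>" using \<delta> by simp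
    moreover have eq: "?a x - \<nu> * ?b x = (qform A x + cinner (oproj E (K x)) x - \<nu> * ?b x)
        + cinner (K x - oproj E (K x)) x"
      by (simp add: cinner.diff_left)
    ultimately have "cmod (?a x - \<nu> * ?b x) < 2 * \<delta>"
      unfolding eq using x(3) by (intro order_le_less_trans[OF norm_triangle_ineq]) linarith
    then show ?thesis using x \<nu> by blast
  qed
  show ?thesis
  proof (cases "\<forall>\<epsilon>>0. \<exists>x\<in>dom A. norm x = 1 \<and> cmod (?a x) < \<epsilon> \<and> cmod (?b x) < \<epsilon>")
    case True
    have "\<mu> \<in> pencil_num_range (op_perturb A K) B"
      unfolding pencil_num_range_iff[OF ABK] dom_op_perturb
    proof (intro allI impI)
      fix \<epsilon> :: real assume "\<epsilon> > 0"
      define \<delta> where "\<delta> = \<epsilon> / (1 + cmod \<mu>)"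
      have pos: "1 + cmod \<mu> > 0" by (simp add: add_pos_nonneg)
      then have "\<delta> > 0" using \<open>\<epsilon> > 0\<close> by (simp add: \<delta>_def)
      with True obtain x where x: "x \<in> dom A" "norm x = 1" "cmod (?a x) < \<delta>" "cmod (?b x) < \<delta>"
        by blast
      have "cmod (?a x - \<mu> * ?b x) \<le> cmod (?a x) + cmod \<mu> * cmod (?b x)"
        by (metis norm_mult norm_triangle_ineq4)
      also have "\<dots> < \<delta> + cmod \<mu> * \<delta>"
        using x by (intro add_less_le_mono mult_left_mono) auto
      also have "\<dots> = \<delta> * (1 + cmod \<mu>)" by (simp add: algebra_simps)
      also have "\<dots> = \<epsilon>" using pos by (simp add: \<delta>_def)
      finally show "\<exists>x\<in>dom A. norm x = 1 \<and>
          cmod (qform (op_perturb A K) x - \<mu> * qform B x) < \<epsilon>"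
        using x by (auto simp: qform_op_perturb)
    qed
    then show ?thesis using closure_subset by blast
  next
    case False
    then obtain \<eta> where \<eta>: "\<eta> > 0"
      "\<And>x. x \<in> dom A \<Longrightarrow> norm x = 1 \<Longrightarrow> cmod (?a x) < \<eta> \<Longrightarrow> cmod (?b x) \<ge> \<eta>"
      by (meson linorder_not_le)
    \<comment> \<open>Calibrated for a contradiction: if the form of B were below \<zeta>, then its
      product with \<nu> would be at most \<eta> / 2, the form of A + K would fall below \<eta>, and
      so the form of B would be at least \<eta> > \<zeta>.\<close>
    define \<zeta> where "\<zeta> = \<eta> / (2 * (2 + cmod \<mu>))"
    have pos: "2 + cmod \<mu> > 0" by (simp add: add_pos_nonneg)
    have \<zeta>: "\<zeta> > 0" "\<zeta> * (2 + cmod \<mu>) = \<eta> / 2" 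
      using \<eta>(1) pos by (simp_all add: \<zeta>_def field_simps)
    have "\<zeta> < \<eta>"
    proof -
      have "\<zeta> * 2 \<le> \<zeta> * (2 + cmod \<mu>)" using \<zeta>(1) by (intro mult_left_mono) auto
      then show ?thesis using \<zeta> \<eta>(1) by simp
    qed
    have "\<mu> \<in> closure (quot_num_range (op_perturb A K) B)"
      unfolding closure_approachable
    proof (intro allI impI)
      fix \<epsilon> :: real assume "\<epsilon> > 0"
      \<comment> \<open>In order, the entries bound the modulus of \<nu> by 1 + |\<mu>|, give 2
        \<delta> \<le> \<eta> / 2, absorb \<nu> - \<mu>, and make the error after division by a form
        of size \<zeta> at most \<epsilon> / 2.\<close>
      define \<delta> where "\<delta> = Min {1, \<eta> / 4, \<epsilon> / 2, \<epsilon> * \<zeta> / 4}"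
      have \<delta>: "\<delta> > 0" "\<delta> \<le> 1" "\<delta> \<le> \<eta> / 4" "\<delta> \<le> \<epsilon> / 2" "\<delta> \<le> \<epsilon> * \<zeta> / 4"
        using \<open>\<epsilon> > 0\<close> \<zeta>(1) \<eta>(1) by (simp_all add: \<delta>_def)
      obtain x \<nu> where x: "x \<in> dom A" "norm x = 1" "cmod (\<nu> - \<mu>) < \<delta>"
        "cmod (?a x - \<nu> * ?b x) < 2 * \<delta>"
        using approx[OF \<delta>(1)] by blast
      have b: "cmod (?b x) \<ge> \<zeta>"
      proof (rule ccontr)
        assume "\<not> cmod (?b x) \<ge> \<zeta>"
        then have small: "cmod (?b x) < \<zeta>" by simp
        have "cmod \<nu> \<le> 1 + cmod \<mu>" using x(3) \<delta>(2) norm_triangle_sub[of \<nu> \<mu>] by linarith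
        then have "cmod \<nu> * cmod (?b x) \<le> (1 + cmod \<mu>) * \<zeta>"
          using small by (intro mult_mono) auto
        also have "\<dots> \<le> (2 + cmod \<mu>) * \<zeta>" using \<zeta>(1) by (intro mult_right_mono) auto
        finally have "cmod (\<nu> * ?b x) \<le> \<eta> / 2" using \<zeta>(2) by (simp add: norm_mult mult.commute)
        then have "cmod (?a x) < \<eta>"
          using norm_triangle_sub[of "?a x" "\<nu> * ?b x"] x(4) \<delta>(3) by linarith
        then show False using \<eta>(2)[OF x(1,2)] small \<open>\<zeta> < \<eta>\<close> by linarith
      qed
      then have b0: "?b x \<noteq> 0" using \<zeta>(1) by auto
      have "cmod (?a x / ?b x - \<nu>) = cmod (?a x - \<nu> * ?b x) / cmod (?b x)"
        using b0 by (simp add: diff_divide_distrib flip: norm_divide)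
      also have "\<dots> < 2 * \<delta> / \<zeta>"
        using x(4) b \<zeta>(1) by (intro frac_less) auto
      also have "\<dots> \<le> \<epsilon> / 2" using \<delta>(5) \<zeta>(1) by (simp add: field_simps)
      finally have "cmod (?a x / ?b x - \<mu>) < \<epsilon>"
        using x(3) \<delta>(4) norm_triangle_ineq[of "?a x / ?b x - \<nu>" "\<nu> - \<mu>"] by simp
      moreover have "?a x / ?b x \<in> quot_num_range (op_perturb A K) B"
        unfolding quot_num_range_def dom_op_perturb mem_Collect_eq
        using x(1) b0 by (intro exI[of _ x]) (simp add: qform_op_perturb)
      ultimately show "\<exists>y\<in>quot_num_range (op_perturb A K) B. dist y \<mu> < \<epsilon>"
        by (auto simp: dist_norm)
    qed
    then show ?thesis
      using closure_mono[OF quot_subset_pencil_num_range[OF AK B ABK]] by blast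
  qed
qed

text \<open>Testing against \<open>Z0\<close> as well as \<open>Z\<close> keeps the form of B at
  least \<eta>, so smallness of the form of A - \<mu> B survives the division.\<close>

lemma pencil_ess_subset_quot_ess:
  assumes AB: "dom A \<subseteq> dom B" and "0 \<notin> ess_num_range B"
  shows "pencil_ess_num_range A B \<subseteq> quot_ess_num_range A B"
proof
  fix \<mu> assume "\<mu> \<in> pencil_ess_num_range A B"
  then have \<mu>: "0 \<in> weak_limits (dom (pencil A B \<mu>)) (qform (pencil A B \<mu>))"
    by (simp add: pencil_ess_num_range_def ess_num_range_weak_limits)
  obtain Z0 \<eta> where Z0: "finite Z0" "\<eta> > 0"
    "\<And>v. v \<in> dom B \<Longrightarrow> norm v = 1 \<Longrightarrow> \<forall>z\<in>Z0. cmod (cinner v z) < \<eta> \<Longrightarrow> cmod (qform B v) \<ge> \<eta>"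
    using not_in_ess_num_range_form_bound[OF assms(2)] by metis
  show "\<mu> \<in> quot_ess_num_range A B"
    unfolding quot_ess_num_range_weak_limits weak_limits_iff
  proof (intro allI impI)
    fix Z :: "'a set" and \<epsilon> :: real assume Z: "finite Z" "\<epsilon> > 0"
    define \<delta> where "\<delta> = Min {\<eta>, \<epsilon>, \<epsilon> * \<eta>}"
    have \<delta>: "\<delta> > 0" "\<delta> \<le> \<eta>" "\<delta> \<le> \<epsilon>" "\<delta> \<le> \<epsilon> * \<eta>"
      using Z(2) Z0(2) by (simp_all add: \<delta>_def)
    from \<mu>[unfolded weak_limits_iff, rule_format, of "Z \<union> Z0" \<delta>] Z(1) Z0(1) \<delta>(1)
    obtain v where v: "v \<in> dom A" "v \<in> dom B" "norm v = 1"
      "cmod (qform (pencil A B \<mu>) v) < \<delta>" "\<forall>z\<in>Z \<union> Z0. cmod (cinner v z) < \<delta>"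
      by (auto simp: dom_pencil)
    have b: "cmod (qform B v) \<ge> \<eta>"
      using v \<delta>(2) by (intro Z0(3)) force+
    then have b0: "qform B v \<noteq> 0" using Z0(2) by auto
    have "cmod (qform A v / qform B v - \<mu>) = cmod (qform A v - \<mu> * qform B v) / cmod (qform B v)"
      using b0 by (simp add: diff_divide_distrib flip: norm_divide)
    also have "\<dots> < \<delta> / \<eta>"
      using v(4) b Z0(2) by (intro frac_less) (auto simp: qform_pencil v)
    also have "\<dots> \<le> \<epsilon>" using \<delta>(4) Z0(2) by (simp add: field_simps)
    finally show "\<exists>v\<in>{x \<in> dom A. qform B x \<noteq> 0}. norm v = 1 \<and>
        cmod (qform A v / qform B v - \<mu>) < \<epsilon> \<and> (\<forall>z\<in>Z. cmod (cinner v z) < \<epsilon>)"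
      using v b0 \<delta>(3) by (intro bexI[of _ v]) force+
  qed
qed

section \<open>Square roots of positive operators\<close>

text \<open>The projection theorem: a minimizing sequence is Cauchy by the parallelogram law, and
  the variation of the distance at the limit gives orthogonality.\<close>

lemma ex_orthogonal_projection:
  fixes M :: "'a::chilbert_space set"
  assumes M: "complex_vector.subspace M" "closed M"
  shows "\<exists>y\<in>M. \<forall>v\<in>M. cinner (x - y) v = 0"
proof -
  have ne: "M \<noteq> {}" using M(1) by (auto simp: complex_vector.subspace_def)
  define e where "e n = inverse (real (Suc n))" for n
  have e: "e n > 0" "e \<longlonglongrightarrow> 0" "m \<ge> n \<Longrightarrow> e m \<le> e n" for m n
    using LIMSEQ_inverse_real_of_nat by (simp_all add: e_def[abs_def] le_imp_inverse_le)
  let ?d = "infdist x M"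
  have d_le: "?d\<^sup>2 \<le> (norm (x - v))\<^sup>2" if "v \<in> M" for v
    using infdist_le[OF that, of x] by (simp add: dist_norm infdist_nonneg power_mono)
  have "\<exists>y\<in>M. (norm (x - y))\<^sup>2 < ?d\<^sup>2 + e n" for n
  proof (rule ccontr)
    assume "\<not> ?thesis"
    then have "sqrt (?d\<^sup>2 + e n) \<le> dist x y" if "y \<in> M" for y
      using that by (intro real_le_lsqrt) (auto simp: dist_norm not_less)
    then have "sqrt (?d\<^sup>2 + e n) \<le> ?d"
      using ne by (simp add: infdist_notempty cINF_greatest)
    then have "?d\<^sup>2 + e n \<le> ?d\<^sup>2"
      using sqrt_le_D by blast
    then show False using e(1)[of n] by simp
  qed
  then obtain y where y: "\<And>n. y n \<in> M" "\<And>n. (norm (x - y n))\<^sup>2 < ?d\<^sup>2 + e n" by metis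
  \<comment> \<open>The midpoint of \<open>y m\<close> and \<open>y n\<close> lies in
    \<open>M\<close>, so its distance from \<open>x\<close> is at least \<open>?d\<close>; this
    leaves little room for the difference.\<close>
  have parallelogram: "(norm (y m - y n))\<^sup>2 \<le> 2 * (e m + e n)" for m n
  proof -
    let ?w = "complex_of_real (1/2) *\<^sub>C (y m + y n)"
    have "?w \<in> M"
      using M(1) y(1) by (simp add: complex_vector.subspace_add complex_vector.subspace_scale)
    moreover have "(x - y m) + (x - y n) = 2 *\<^sub>R (x - ?w)"
      unfolding scaleC_of_real by (simp add: algebra_simps scaleR_2)
    ultimately have "4 * ?d\<^sup>2 \<le> (norm ((x - y m) + (x - y n)))\<^sup>2"
      using d_le[of ?w] by (simp add: power_mult_distrib)
    moreover have "(norm (y m - y n))\<^sup>2 + (norm ((x - y m) + (x - y n)))\<^sup>2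
        = 2 * (norm (x - y m))\<^sup>2 + 2 * (norm (x - y n))\<^sup>2"
      by (simp add: power2_norm_eq_inner inner_simps inner_commute algebra_simps)
    ultimately show ?thesis using y(2)[of m] y(2)[of n] by argo
  qed
  have "Cauchy y"
  proof (rule metric_CauchyI)
    fix \<epsilon> :: real assume "\<epsilon> > 0"
    then obtain N where N: "e N < \<epsilon>\<^sup>2 / 4"
      using reals_Archimedean[of "\<epsilon>\<^sup>2 / 4"] by (auto simp: e_def)
    have "dist (y m) (y n) < \<epsilon>" if "m \<ge> N" "n \<ge> N" for m n
    proof -
      have "e m \<le> e N" "e n \<le> e N" using that e(3) by auto
      then have "(norm (y m - y n))\<^sup>2 < \<epsilon>\<^sup>2"
        using parallelogram[of m n] N by argo
      then show ?thesis
        using \<open>\<epsilon> > 0\<close> by (simp add: dist_norm power2_less_imp_less)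
    qed
    then show "\<exists>N. \<forall>m\<ge>N. \<forall>n\<ge>N. dist (y m) (y n) < \<epsilon>" by blast
  qed
  then obtain l where l: "y \<longlonglongrightarrow> l" using Cauchy_convergent convergentD by blast
  have "l \<in> M" using closed_sequentially[OF M(2) _ l] y(1) by blast
  have "(norm (x - l))\<^sup>2 \<le> ?d\<^sup>2 + 0"
  proof (rule LIMSEQ_le)
    show "(\<lambda>n. (norm (x - y n))\<^sup>2) \<longlonglongrightarrow> (norm (x - l))\<^sup>2" by (intro tendsto_intros l)
    show "(\<lambda>n. ?d\<^sup>2 + e n) \<longlonglongrightarrow> ?d\<^sup>2 + 0"
      by (intro tendsto_intros e)
    show "\<exists>N. \<forall>n\<ge>N. (norm (x - y n))\<^sup>2 \<le> ?d\<^sup>2 + e n"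
      using y(2) less_imp_le by blast
  qed
  then have minimal: "(norm (x - l))\<^sup>2 \<le> (norm (x - v))\<^sup>2" if "v \<in> M" for v
    using d_le[OF that] by linarith
  have Re0: "Re (cinner (x - l) v) = 0" if "v \<in> M" for v
  proof (cases "v = 0")
    case False
    \<comment> \<open>The minimizer of the quadratic polynomial that gives the squared distance
      along the direction \<open>v\<close>.\<close>
    define t where "t = Re (cinner (x - l) v) / (norm v)\<^sup>2"
    have "l + complex_of_real t *\<^sub>C v \<in> M"
      using M(1) \<open>l \<in> M\<close> that
      by (simp add: complex_vector.subspace_add complex_vector.subspace_scale)
    from minimal[OF this] have "(norm (x - l))\<^sup>2 \<le> (norm ((x - l) - t *\<^sub>R v))\<^sup>2"
      by (simp add: scaleC_of_real algebra_simps)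
    also have "\<dots> = (norm (x - l))\<^sup>2 - 2 * t * inner (x - l) v + t\<^sup>2 * (norm v)\<^sup>2"
      unfolding power2_norm_eq_inner
      by (simp add: inner_diff_left inner_diff_right inner_commute power2_eq_square algebra_simps)
    finally have "2 * t * inner (x - l) v \<le> t\<^sup>2 * (norm v)\<^sup>2" by simp
    moreover have "inner (x - l) v = t * (norm v)\<^sup>2"
      using False by (simp add: t_def inner_eq_Re_cinner)
    ultimately have "t\<^sup>2 * (norm v)\<^sup>2 \<le> 0" by (simp add: power2_eq_square)
    then have "t = 0" using False by (simp add: mult_le_0_iff)
    then show ?thesis using False by (simp add: t_def)
  qed (simp add: cinner.zero_right)
  have "cinner (x - l) v = 0" if "v \<in> M" for v
  proof (rule complex_eqI)
    \<comment> \<open>The imaginary part at \<open>v\<close> is a real part at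
      \<open>\<i> *\<^sub>C v\<close>.\<close>
    have "\<i> *\<^sub>C v \<in> M" using M(1) that by (simp add: complex_vector.subspace_scale)
    from Re0[OF this] show "Im (cinner (x - l) v) = Im 0"
      by (simp add: cinner_scaleC_right)
  qed (simp add: Re0 that)
  then show ?thesis using \<open>l \<in> M\<close> by blast
qed

lemma cinner_ext_dense:
  assumes "closure D = UNIV" "\<And>x. x \<in> D \<Longrightarrow> cinner x y = cinner x z"
  shows "y = z"
proof -
  have "D \<subseteq> {x. cinner x (y - z) = 0}" using assms(2) by (auto simp: cinner_lin)
  moreover have "closed {x. cinner x (y - z) = 0}"
    by (intro closed_Collect_eq continuous_intros cinner.continuous_on)
  ultimately have "y - z \<in> {x. cinner x (y - z) = 0}"
    using assms(1) closure_minimal by blast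
  then show ?thesis by (simp add: cinner_self)
qed

text \<open>The way selfadjointness yields membership in the domain: the adjoint relation alone
  suffices. Density of the domain determines the value described by \<open>THE\<close>.\<close>

lemma selfadjoint_mem:
  assumes "selfadjoint S" "\<And>x. x \<in> dom S \<Longrightarrow> cinner (the (S x)) y = cinner x z"
  shows "S y = Some z"
proof -
  have "(THE z. \<forall>x\<in>dom S. cinner (the (S x)) y = cinner x z) = z"
  proof (rule the_equality)
    fix w assume "\<forall>x\<in>dom S. cinner (the (S x)) y = cinner x w"
    then show "w = z"
      using assms cinner_ext_dense[of "dom S" w z] by (auto simp: selfadjoint_def)
  qed (use assms in blast)
  then have "op_adjoint S y = Some z" using assms(2) unfolding op_adjoint_def by auto
  then show ?thesis using assms(1) by (simp add: selfadjoint_def)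
qed

lemma selfadjoint_symmetric:
  assumes "selfadjoint S" "x \<in> dom S" "y \<in> dom S"
  shows "cinner (the (S x)) y = cinner x (the (S y))"
proof -
  have "op_adjoint S y \<noteq> None" using assms by (auto simp: selfadjoint_def)
  then obtain z where z: "\<forall>x\<in>dom S. cinner (the (S x)) y = cinner x z"
    unfolding op_adjoint_def by meson
  then have "S y = Some z" by (intro selfadjoint_mem assms(1)) blast
  then show ?thesis using z assms(2) by simp
qed

text \<open>Symmetry of an everywhere defined map; tested against all vectors, it already forces
  linearity.\<close>

definition sym_op :: "('a::complex_inner \<Rightarrow> 'a) \<Rightarrow> bool"
  where "sym_op T \<longleftrightarrow> (\<forall>x y. cinner (T x) y = cinner x (T y))"

lemma sym_op_linear:
  assumes "sym_op T"
  shows "T (x + y) = T x + T y" "T (c *\<^sub>C x) = c *\<^sub>C T x"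
proof -
  have T: "cinner z (T x) = cinner (T z) x" for x z using assms by (simp add: sym_op_def)
  show "T (x + y) = T x + T y" "T (c *\<^sub>C x) = c *\<^sub>C T x"
    by (rule cinner_ext_dense[of UNIV], simp, simp add: T cinner_lin)+
qed

lemma bounded_clinearI:
  assumes "\<And>x y. T (x + y) = T x + T y" "\<And>c x. T (c *\<^sub>C x) = c *\<^sub>C T x"
    "\<And>x. norm (T x) \<le> M * norm x"
  shows "bounded_clinear T"
proof -
  have "T (r *\<^sub>R x) = r *\<^sub>R T x" for r x
    by (simp only: scaleR_scaleC[of r] assms(2))
  then have "bounded_linear T"
    using assms by (intro bounded_linear_intro[of T M]) (simp_all add: mult.commute)
  then show ?thesis using assms(2) by (simp add: bounded_clinear_def)
qed

lemma selfadjoint_total: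
  assumes "sym_op R"
  shows "selfadjoint (\<lambda>x. Some (R x))"
proof -
  have "op_adjoint (\<lambda>x. Some (R x)) y = Some (R y)" for y
  proof -
    have *: "\<forall>x\<in>dom (\<lambda>x. Some (R x)). cinner (the (Some (R x))) y = cinner x (R y)"
      using assms by (simp add: sym_op_def)
    have "(THE z. \<forall>x\<in>dom (\<lambda>x. Some (R x)). cinner (the (Some (R x))) y = cinner x z) = R y"
    proof (rule the_equality, rule *)
      fix z assume "\<forall>x\<in>dom (\<lambda>x. Some (R x)). cinner (the (Some (R x))) y = cinner x z"
      then show "z = R y"
        using assms cinner_ext_dense[of UNIV z "R y"] by (simp_all add: sym_op_def dom_def)
    qed
    then show ?thesis using * unfolding op_adjoint_def by auto
  qed
  then show ?thesis
    using sym_op_linear[OF assms]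
    by (auto simp: selfadjoint_def linear_operator_def dom_def)
qed

section \<open>Existence of the positive square root by iteration\<close>

context
  fixes Z :: "'a::chilbert_space \<Rightarrow> 'a"
  assumes Z_sym: "sym_op Z" and Z_le: "\<And>x. norm (Z x) \<le> norm x"
begin

text \<open>Iterates the equation Y = (Z + Y^2) / 2. A fixed point satisfies (1 - Y)^2 = 1 - Z, so 1
  - Y is a square root of 1 - Z.\<close>

fun sqrt_iter :: "nat \<Rightarrow> 'a \<Rightarrow> 'a" where
  "sqrt_iter 0 x = 0"
| "sqrt_iter (Suc n) x = (1/2) *\<^sub>R (Z x + sqrt_iter n (sqrt_iter n x))"

text \<open>The same iteration for the scalar Z = 1. It majorizes the operator iteration, increments
  included, and so carries the convergence proof.\<close>

fun sqrt_bd :: "nat \<Rightarrow> real" where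
  "sqrt_bd 0 = 0"
| "sqrt_bd (Suc n) = (1 + (sqrt_bd n)\<^sup>2) / 2"

lemma sqrt_bd_range: "0 \<le> sqrt_bd n" "sqrt_bd n \<le> 1"
proof -
  have "0 \<le> sqrt_bd n \<and> sqrt_bd n \<le> 1"
    by (induction n) (auto simp: power_le_one)
  then show "0 \<le> sqrt_bd n" "sqrt_bd n \<le> 1" by auto
qed

lemma sqrt_bd_mono: "sqrt_bd n \<le> sqrt_bd (Suc n)"
  using sum_squares_bound[of "sqrt_bd n" 1] by simp

lemma sym_op_sqrt_iter: "sym_op (sqrt_iter n)"
proof (induction n)
  case 0
  then show ?case by (simp add: sym_op_def cinner.zero_left cinner.zero_right)
next
  case (Suc n)
  then show ?case
    using Z_sym by (simp add: sym_op_def cinner.scaleR_left cinner.scaleR_right cinner_lin)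
qed

lemma sqrt_iter_add: "sqrt_iter n (x + y) = sqrt_iter n x + sqrt_iter n y"
  by (rule sym_op_linear[OF sym_op_sqrt_iter])

lemma sqrt_iter_scaleR: "sqrt_iter n (r *\<^sub>R x) = r *\<^sub>R sqrt_iter n x"
  using sym_op_linear(2)[OF sym_op_sqrt_iter] by (metis scaleR_scaleC)

lemma sqrt_iter_diff: "sqrt_iter n (x - y) = sqrt_iter n x - sqrt_iter n y"
  by (metis add_diff_cancel_right' diff_add_cancel sqrt_iter_add)

text \<open>The iterates are polynomials in \<open>Z\<close>. A general \<open>T\<close> serves
  twice: for the commutation of the iterates with each other, and for the commutation of the limit
  with operators that commute with \<open>Z\<close>.\<close>

lemma commute_sqrt_iter:
  assumes "\<And>x y. T (x + y) = T x + T y" "\<And>r x. T (r *\<^sub>R x) = r *\<^sub>R T x"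
    "\<And>x. T (Z x) = Z (T x)"
  shows "T (sqrt_iter n x) = sqrt_iter n (T x)"
proof (induction n arbitrary: x)
  case 0
  then show ?case using assms(2)[of 0 0] by simp
qed (simp add: assms)

lemma sqrt_iter_commute: "sqrt_iter m (sqrt_iter n x) = sqrt_iter n (sqrt_iter m x)"
proof (rule commute_sqrt_iter[OF sqrt_iter_add sqrt_iter_scaleR])
  have "Z (sqrt_iter m x) = sqrt_iter m (Z x)" for x
    using sym_op_linear[OF Z_sym] by (intro commute_sqrt_iter) (auto simp: scaleR_scaleC[of _ "_::'a"])
  then show "sqrt_iter m (Z x) = Z (sqrt_iter m x)" for x by simp
qed

lemma norm_sqrt_iter: "norm (sqrt_iter n x) \<le> sqrt_bd n * norm x"
proof (induction n arbitrary: x)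
  case (Suc n)
  have "norm (sqrt_iter n (sqrt_iter n x)) \<le> sqrt_bd n * (sqrt_bd n * norm x)"
    using Suc[of "sqrt_iter n x"] mult_left_mono[OF Suc[of x] sqrt_bd_range(1)[of n]]
    by linarith
  then have "norm (Z x + sqrt_iter n (sqrt_iter n x)) \<le> (1 + (sqrt_bd n)\<^sup>2) * norm x"
    using norm_triangle_ineq[of "Z x" "sqrt_iter n (sqrt_iter n x)"] Z_le[of x]
    by (simp add: algebra_simps power2_eq_square)
  then show ?case by (simp del: scaleR_add_right)
qed simp

lemma norm_sqrt_iter_step:
  "norm (sqrt_iter (Suc n) x - sqrt_iter n x) \<le> (sqrt_bd (Suc n) - sqrt_bd n) * norm x"
proof (induction n arbitrary: x)
  case 0
  then show ?case using Z_le[of x] by simp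
next
  case (Suc n)
  let ?Y = "sqrt_iter n" and ?Y' = "sqrt_iter (Suc n)"
  let ?r = "sqrt_bd n" and ?r' = "sqrt_bd (Suc n)"
  let ?w = "?Y' x + ?Y x"
  have "sqrt_iter (Suc (Suc n)) x - ?Y' x = (1/2) *\<^sub>R (?Y' (?Y' x) - ?Y (?Y x))"
    unfolding sqrt_iter.simps(2)[of "Suc n"] sqrt_iter.simps(2)[of n x]
    by (simp add: scaleR_diff_right[symmetric] del: sqrt_iter.simps)
  \<comment> \<open>Commuting iterates allow the factorization (Y' - Y)(Y' + Y), which mirrors the
    difference of squares of the scalar bounds.\<close>
  also have "?Y' (?Y' x) - ?Y (?Y x) = ?Y' ?w - ?Y ?w"
    unfolding sqrt_iter_add using sqrt_iter_commute[of "Suc n" n x]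
    by (simp del: sqrt_iter.simps)
  finally have "norm (sqrt_iter (Suc (Suc n)) x - ?Y' x) = norm (?Y' ?w - ?Y ?w) / 2"
    by (simp del: sqrt_iter.simps)
  also have "\<dots> \<le> (?r' - ?r) * norm ?w / 2"
    using Suc[of ?w] by (simp del: sqrt_iter.simps sqrt_bd.simps)
  also have "\<dots> \<le> (?r' - ?r) * ((?r' + ?r) * norm x) / 2"
  proof -
    have "norm ?w \<le> (?r' + ?r) * norm x"
      using norm_triangle_ineq[of "?Y' x" "?Y x"] norm_sqrt_iter[of "Suc n" x] norm_sqrt_iter[of n x]
      by (simp add: distrib_right del: sqrt_iter.simps sqrt_bd.simps)
    then show ?thesis
      using sqrt_bd_mono[of n]
      by (intro divide_right_mono mult_left_mono) (simp_all del: sqrt_iter.simps sqrt_bd.simps)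
  qed
  also have "\<dots> = (sqrt_bd (Suc (Suc n)) - ?r') * norm x"
    unfolding sqrt_bd.simps(2)[of "Suc n"] sqrt_bd.simps(2)[of n]
    by (simp add: field_simps power2_eq_square)
  finally show ?case .
qed

lemma norm_sqrt_iter_diff:
  assumes "m \<le> n"
  shows "norm (sqrt_iter n x - sqrt_iter m x) \<le> (sqrt_bd n - sqrt_bd m) * norm x"
  using assms
proof (induction n rule: dec_induct)
  case (step n)
  have "norm (sqrt_iter (Suc n) x - sqrt_iter m x)
      \<le> norm (sqrt_iter (Suc n) x - sqrt_iter n x) + norm (sqrt_iter n x - sqrt_iter m x)"
    using norm_triangle_ineq[of "sqrt_iter (Suc n) x - sqrt_iter n x" "sqrt_iter n x - sqrt_iter m x"]
    by (simp del: sqrt_iter.simps)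
  also have "\<dots> \<le> (sqrt_bd (Suc n) - sqrt_bd n) * norm x + (sqrt_bd n - sqrt_bd m) * norm x"
    by (intro add_mono norm_sqrt_iter_step step)
  finally show ?case by (simp add: algebra_simps del: sqrt_iter.simps sqrt_bd.simps)
qed simp

lemma convergent_sqrt_iter: "convergent (\<lambda>n. sqrt_iter n x)"
proof -
  have "incseq sqrt_bd" by (rule incseq_SucI) (rule sqrt_bd_mono)
  then have "convergent sqrt_bd"
    using sqrt_bd_range by (intro Bseq_mono_convergent BseqI'[of _ 1]) (auto simp: incseq_def)
  then have C: "Cauchy (\<lambda>n. sqrt_bd n * norm x)"
    by (intro convergent_Cauchy convergent_mult convergent_const)
  have "Cauchy (\<lambda>n. sqrt_iter n x)"
  proof (rule metric_CauchyI)
    fix \<epsilon> :: real assume "\<epsilon> > 0"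
    then obtain N where N: "\<And>m n. m \<ge> N \<Longrightarrow> n \<ge> N \<Longrightarrow>
        dist (sqrt_bd m * norm x) (sqrt_bd n * norm x) < \<epsilon>"
      using metric_CauchyD[OF C] by metis
    have *: "dist (sqrt_iter n x) (sqrt_iter m x) < \<epsilon>" if "m \<ge> N" "n \<ge> m" for m n
      using norm_sqrt_iter_diff[OF that(2), of x] N[of n m] that
      by (simp add: dist_norm left_diff_distrib)
    have "dist (sqrt_iter m x) (sqrt_iter n x) < \<epsilon>" if "m \<ge> N" "n \<ge> N" for m n
      using *[of m n] *[of n m] that by (cases "m \<le> n") (auto simp: dist_commute)
    then show "\<exists>N. \<forall>m\<ge>N. \<forall>n\<ge>N. dist (sqrt_iter m x) (sqrt_iter n x) < \<epsilon>" by blast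
  qed
  then show ?thesis by (rule Cauchy_convergent)
qed

lemma sqrt_iter_limit:
  obtains Y where "sym_op Y" "\<And>x. norm (Y x) \<le> norm x" "\<And>x. 2 *\<^sub>R Y x = Z x + Y (Y x)"
    "\<And>T x. bounded_linear T \<Longrightarrow> (\<And>x. T (Z x) = Z (T x)) \<Longrightarrow> T (Y x) = Y (T x)"
proof
  define Y where "Y x = lim (\<lambda>n. sqrt_iter n x)" for x
  have Y: "(\<lambda>n. sqrt_iter n x) \<longlonglongrightarrow> Y x" for x
    using convergent_sqrt_iter by (simp add: Y_def convergent_LIMSEQ_iff)
  show "sym_op Y"
    unfolding sym_op_def
  proof (intro allI)
    fix x y
    have "(\<lambda>n. cinner (sqrt_iter n x) y) \<longlonglongrightarrow> cinner (Y x) y"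
      "(\<lambda>n. cinner x (sqrt_iter n y)) \<longlonglongrightarrow> cinner x (Y y)"
      by (intro cinner.tendsto Y tendsto_const)+
    moreover have "cinner (sqrt_iter n x) y = cinner x (sqrt_iter n y)" for n
      using sym_op_sqrt_iter[of n] by (simp add: sym_op_def)
    ultimately show "cinner (Y x) y = cinner x (Y y)"
      using LIMSEQ_unique[of "\<lambda>n. cinner x (sqrt_iter n y)"] by simp
  qed
  have le1: "norm (sqrt_iter n x) \<le> norm x" for n x
    using norm_sqrt_iter[of n x] mult_right_mono[OF sqrt_bd_range(2)[of n] norm_ge_zero[of x]]
    by simp
  show "norm (Y x) \<le> norm x" for x
    by (rule LIMSEQ_le_const2[OF tendsto_norm[OF Y]]) (use le1 in blast)
  show "2 *\<^sub>R Y x = Z x + Y (Y x)" for x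
  proof -
    \<comment> \<open>Strong convergence passes to the squares because all iterates are
      contractions.\<close>
    have "(\<lambda>n. sqrt_iter n (sqrt_iter n x - Y x)) \<longlonglongrightarrow> 0"
    proof (rule Lim_null_comparison)
      show "(\<lambda>n. norm (sqrt_iter n x - Y x)) \<longlonglongrightarrow> 0"
        using Y[of x] by (simp add: LIM_zero_iff tendsto_norm_zero)
    qed (use le1 in simp)
    from tendsto_add[OF this Y[of "Y x"]]
    have "(\<lambda>n. sqrt_iter n (sqrt_iter n x)) \<longlonglongrightarrow> Y (Y x)"
      by (simp add: sqrt_iter_diff)
    then have "(\<lambda>n. (1/2) *\<^sub>R (Z x + sqrt_iter n (sqrt_iter n x)))
        \<longlonglongrightarrow> (1/2) *\<^sub>R (Z x + Y (Y x))"
      by (intro tendsto_intros)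
    moreover have "(\<lambda>n. (1/2) *\<^sub>R (Z x + sqrt_iter n (sqrt_iter n x))) \<longlonglongrightarrow> Y x"
      using LIMSEQ_Suc[OF Y[of x]] by simp
    ultimately have "(1/2) *\<^sub>R (Z x + Y (Y x)) = Y x" using LIMSEQ_unique by blast
    then have "2 *\<^sub>R Y x = 2 *\<^sub>R ((1/2) *\<^sub>R (Z x + Y (Y x)))" by simp
    then show ?thesis by (simp only: scaleR_scaleR) simp
  qed
  show "T (Y x) = Y (T x)" if T: "bounded_linear T" "\<And>x. T (Z x) = Z (T x)" for T x
  proof -
    have "T (sqrt_iter n x) = sqrt_iter n (T x)" for n
      using T by (intro commute_sqrt_iter)
        (simp_all add: bounded_linear.linear linear_add linear_cmul)
    then have "(\<lambda>n. sqrt_iter n (T x)) \<longlonglongrightarrow> T (Y x)"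
      using bounded_linear.tendsto[OF T(1) Y[of x]] by simp
    then show ?thesis using Y LIMSEQ_unique by blast
  qed
qed

end

text \<open>The bound \<open>S_le\<close> plays the role of 0 \<le> S \<le> M: it gives a
  nonnegative form and makes 1 - S / M a contraction. The root is sqrt M times 1 - Y. The
  commutation clause prepares uniqueness.\<close>

lemma positive_sqrt_exists:
  fixes S :: "'a::chilbert_space \<Rightarrow> 'a"
  assumes S: "sym_op S" and M: "M > 0" and S_le: "\<And>x. (norm (S x))\<^sup>2 \<le> M * Re (cinner (S x) x)"
  obtains R where "sym_op R" "\<And>x. Re (cinner (R x) x) \<ge> 0" "\<And>x. R (R x) = S x"
    "\<And>T x. bounded_linear T \<Longrightarrow> (\<And>x. T (S x) = S (T x)) \<Longrightarrow> T (R x) = R (T x)"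
proof -
  define Z where "Z x = x - inverse M *\<^sub>R S x" for x
  have "sym_op Z"
    using S by (simp add: sym_op_def Z_def cinner_lin cinner.scaleR_left cinner.scaleR_right)
  moreover have "norm (Z x) \<le> norm x" for x
  proof -
    have "(norm (Z x))\<^sup>2 = (norm x)\<^sup>2 - 2 * inverse M * inner (S x) x + (inverse M)\<^sup>2 * (norm (S x))\<^sup>2"
      unfolding Z_def power2_norm_eq_inner
      by (simp add: inner_diff_left inner_diff_right inner_commute power2_eq_square algebra_simps)
    also have "(inverse M)\<^sup>2 * (norm (S x))\<^sup>2 \<le> (inverse M)\<^sup>2 * (M * inner (S x) x)"
      using S_le[of x] by (intro mult_left_mono) (simp_all add: inner_eq_Re_cinner)
    also have "\<dots> = inverse M * inner (S x) x"
      using M by (simp add: power2_eq_square)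
    finally have "(norm (Z x))\<^sup>2 \<le> (norm x)\<^sup>2 - inverse M * inner (S x) x" by simp
    moreover have "inner (S x) x \<ge> 0"
      using S_le[of x] M by (metis inner_eq_Re_cinner order_trans zero_le_mult_iff zero_le_power2
          not_less order_less_imp_le)
    ultimately have "(norm (Z x))\<^sup>2 \<le> (norm x)\<^sup>2"
      using M by (smt (verit) mult_nonneg_nonneg positive_imp_inverse_positive)
    then show ?thesis by (rule power2_le_imp_le) simp
  qed
  ultimately obtain Y where Y: "sym_op Y" "\<And>x. norm (Y x) \<le> norm x"
    "\<And>x. 2 *\<^sub>R Y x = Z x + Y (Y x)"
    "\<And>T x. bounded_linear T \<Longrightarrow> (\<And>x. T (Z x) = Z (T x)) \<Longrightarrow> T (Y x) = Y (T x)"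
    using sqrt_iter_limit[of Z] by metis
  define R where "R x = sqrt M *\<^sub>R (x - Y x)" for x
  show ?thesis
  proof
    show "sym_op R"
      using Y(1) by (simp add: sym_op_def R_def cinner_lin cinner.scaleR_left cinner.scaleR_right)
    show "Re (cinner (R x) x) \<ge> 0" for x
    proof -
      have "inner (Y x) x \<le> norm (Y x) * norm x" by (rule norm_cauchy_schwarz)
      also have "\<dots> \<le> norm x * norm x" by (intro mult_right_mono Y(2)) simp
      finally have "inner (x - Y x) x \<ge> 0"
        by (simp add: inner_diff_left power2_norm_eq_inner[symmetric] power2_eq_square)
      then show ?thesis using M by (simp add: R_def flip: inner_eq_Re_cinner)
    qed
    have Y_lin: "Y (a - b) = Y a - Y b" "Y (r *\<^sub>R a) = r *\<^sub>R Y a" for a b r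
      using sym_op_linear[OF Y(1)]
      by (metis add_diff_cancel_right' diff_add_cancel, metis scaleR_scaleC)
    show "R (R x) = S x" for x
    proof -
      have "R (R x) = M *\<^sub>R (x - 2 *\<^sub>R Y x + Y (Y x))"
        using M by (simp add: R_def Y_lin algebra_simps scaleR_2)
      also have "x - 2 *\<^sub>R Y x + Y (Y x) = inverse M *\<^sub>R S x"
        unfolding Y(3) by (simp add: Z_def)
      finally show ?thesis using M by simp
    qed
    show "T (R x) = R (T x)" if T: "bounded_linear T" "\<And>x. T (S x) = S (T x)" for T x
    proof -
      have lin: "T (a - b) = T a - T b" "T (r *\<^sub>R a) = r *\<^sub>R T a" for a b r
        using T(1) by (simp_all add: bounded_linear.linear linear_diff linear_cmul)
      have "T (Y x) = Y (T x)" by (rule Y(4)[OF T(1)]) (simp add: Z_def lin T(2))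
      then show ?thesis by (simp add: R_def lin)
    qed
  qed
qed

section \<open>Uniqueness of the positive square root\<close>

text \<open>Along w + t R w the nonnegative form equals 2 t \<alpha> + t^2 \<beta>, which is
  negative for small negative t unless \<alpha>, the squared norm of R w, is zero.\<close>

lemma positive_kernel:
  assumes "sym_op R" "\<And>x. Re (cinner (R x) x) \<ge> 0" "Re (cinner (R w) w) = 0"
  shows "R w = 0"
proof (rule ccontr)
  assume "R w \<noteq> 0"
  define \<alpha> \<beta> where "\<alpha> = (norm (R w))\<^sup>2" and "\<beta> = Re (cinner (R (R w)) (R w))"
  have "\<alpha> > 0" using \<open>R w \<noteq> 0\<close> by (simp add: \<alpha>_def)
  have "\<beta> \<ge> 0" using assms(2) by (simp add: \<beta>_def)
  \<comment> \<open>The summand 1 covers \<beta> = 0 and keeps t \<beta> above - \<alpha>.\<close>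
  define t where "t = - \<alpha> / (\<beta> + 1)"
  have "cinner (R (R w)) w = complex_of_real \<alpha>" "cinner (R w) (R w) = complex_of_real \<alpha>"
    using assms(1) by (simp_all add: sym_op_def cinner_self \<alpha>_def)
  then have "Re (cinner (R (w + complex_of_real t *\<^sub>C R w)) (w + complex_of_real t *\<^sub>C R w))
      = 2 * t * \<alpha> + t * t * \<beta>"
    using assms(3) by (simp add: sym_op_linear[OF assms(1)] cinner_lin \<beta>_def algebra_simps)
  then have "0 \<le> t * (2 * \<alpha> + t * \<beta>)"
    using assms(2)[of "w + complex_of_real t *\<^sub>C R w"] by (simp add: algebra_simps)
  moreover have "t < 0" using \<open>\<alpha> > 0\<close> \<open>\<beta> \<ge> 0\<close> by (simp add: t_def)
  moreover have "2 * \<alpha> + t * \<beta> > 0"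
  proof -
    have "\<alpha> * \<beta> / (\<beta> + 1) \<le> \<alpha>" using \<open>\<alpha> > 0\<close> \<open>\<beta> \<ge> 0\<close> by (simp add: field_simps)
    then show ?thesis using \<open>\<alpha> > 0\<close> by (simp add: t_def)
  qed
  ultimately show False by (simp add: zero_le_mult_iff)
qed

text \<open>For w = (R - T) x, commutation and equal squares give (R + T) w = 0. Both forms are
  nonnegative, hence vanish at w, so R w = T w = 0; by symmetry the squared norm of w is then the
  inner product of (R - T) w with x.\<close>

lemma positive_sqrt_unique:
  assumes R: "sym_op R" "\<And>x. Re (cinner (R x) x) \<ge> 0"
    and T: "sym_op T" "\<And>x. Re (cinner (T x) x) \<ge> 0"
    and sq: "\<And>x. R (R x) = T (T x)" and comm: "\<And>x. T (R x) = R (T x)"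
  shows "T = R"
proof
  fix x
  have Rd: "R (a - b) = R a - R b" and Td: "T (a - b) = T a - T b" for a b
    using sym_op_linear(1)[OF R(1)] sym_op_linear(1)[OF T(1)]
    by (metis add_diff_cancel_right' diff_add_cancel)+
  define w where "w = R x - T x"
  have "R w + T w = 0" by (simp add: w_def Rd Td sq comm)
  then have "Re (cinner (R w) w) + Re (cinner (T w) w) = 0"
    by (metis cinner.add_left cinner.zero_left plus_complex.sel(1) zero_complex.sel(1))
  then have "Re (cinner (R w) w) = 0" "Re (cinner (T w) w) = 0"
    using R(2)[of w] T(2)[of w] by auto
  then have "R w = 0" "T w = 0" using positive_kernel R T by blast+
  have "cinner w w = cinner (R w - T w) x"
    unfolding w_def using R(1) T(1) by (simp add: sym_op_def cinner_lin Rd Td)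
  also have "\<dots> = 0" by (simp add: \<open>R w = 0\<close> \<open>T w = 0\<close> cinner.zero_left)
  finally show "T x = R x" by (simp add: cinner_self w_def)
qed

text \<open>Evaluates the definite description in \<open>op_sqrt\<close>. A competing root T is
  everywhere defined because T T is, is bounded because S is, and commutes with S = T T, hence with
  R; uniqueness applies.\<close>

lemma op_sqrt_total:
  fixes S :: "'a::chilbert_space \<Rightarrow> 'a"
  assumes S: "sym_op S" and M: "M > 0" and S_le: "\<And>x. (norm (S x))\<^sup>2 \<le> M * Re (cinner (S x) x)"
  obtains R where "op_sqrt (\<lambda>x. Some (S x)) = (\<lambda>x. Some (R x))"
    "sym_op R" "\<And>x. R (R x) = S x"
proof -
  obtain R where R: "sym_op R" "\<And>x. Re (cinner (R x) x) \<ge> 0" "\<And>x. R (R x) = S x"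
    "\<And>T x. bounded_linear T \<Longrightarrow> (\<And>x. T (S x) = S (T x)) \<Longrightarrow> T (R x) = R (T x)"
    using positive_sqrt_exists[OF assms] by metis
  have S_bd: "norm (S x) \<le> M * norm x" for x
  proof (cases "S x = 0")
    case False
    have "norm (S x) * norm (S x) \<le> M * (norm (S x) * norm x)"
      using order_trans[OF S_le[of x] mult_left_mono[OF
            order_trans[OF complex_Re_le_cmod norm_cinner_le[of "S x" x]], of M]] M
      unfolding power2_eq_square by simp
    then show ?thesis using False by (simp add: mult.left_commute mult_le_cancel_left_pos)
  qed (use M in simp)
  have "op_sqrt (\<lambda>x. Some (S x)) = (\<lambda>x. Some (R x))"
    unfolding op_sqrt_def
  proof (rule the_equality)
    show "selfadjoint (\<lambda>x. Some (R x)) \<and> bounded_below_by (\<lambda>x. Some (R x)) 0 \<and>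
        (\<lambda>x. Some (R x)) \<circ>\<^sub>m (\<lambda>x. Some (R x)) = (\<lambda>x. Some (S x))"
      using selfadjoint_total[OF R(1)] R(2,3) by (simp add: bounded_below_by_def map_comp_def)
    fix T :: "'a operator"
    assume T: "selfadjoint T \<and> bounded_below_by T 0 \<and> T \<circ>\<^sub>m T = (\<lambda>x. Some (S x))"
    define t where "t x = the (T x)" for x
    have TT: "(T \<circ>\<^sub>m T) x = Some (S x)" for x using T by simp
    have Tt: "T x = Some (t x)" for x
      using TT[of x] by (auto simp: t_def map_comp_def split: option.splits)
    have tt: "t (t x) = S x" for x
      using TT[of x] by (simp add: map_comp_def Tt)
    have domT: "dom T = UNIV" using Tt by (auto simp: dom_def)
    have sym: "sym_op t"
      using selfadjoint_symmetric[of T] T domT by (simp add: sym_op_def t_def)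
    have pos: "Re (cinner (t x) x) \<ge> 0" for x
      using T domT by (simp add: bounded_below_by_def t_def)
    have "(norm (t x))\<^sup>2 \<le> (sqrt M * norm x)\<^sup>2" for x
    proof -
      have "complex_of_real ((norm (t x))\<^sup>2) = cinner (S x) x"
        unfolding cinner_self[symmetric] tt[symmetric] using sym by (simp add: sym_op_def)
      then have "(norm (t x))\<^sup>2 = Re (cinner (S x) x)" by (metis Re_complex_of_real)
      also have "\<dots> \<le> norm (S x) * norm x"
        using complex_Re_le_cmod norm_cinner_le order_trans by blast
      also have "\<dots> \<le> M * norm x * norm x" by (intro mult_right_mono S_bd) simp
      also have "\<dots> = (sqrt M * norm x)\<^sup>2"
        unfolding power_mult_distrib using M by (simp add: power2_eq_square[of "norm x"])
      finally show ?thesis .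
    qed
    then have "norm (t x) \<le> sqrt M * norm x" for x
      by (rule power2_le_imp_le) (use M in simp)
    then have "bounded_clinear t" by (rule bounded_clinearI[OF sym_op_linear[OF sym]])
    then have "bounded_linear t" by (simp add: bounded_clinear_def)
    then have comm: "t (R x) = R (t x)" for x by (rule R(4)) (simp flip: tt)
    have "t = R"
      by (rule positive_sqrt_unique[OF R(1,2) sym pos _ comm]) (simp add: R(3) tt)
    then show "T = (\<lambda>x. Some (R x))" using Tt by auto
  qed
  then show ?thesis using that R by metis
qed

section \<open>Inverse and inverse square root of a uniformly positive operator\<close>

text \<open>The lower bound makes \<open>B\<close> injective with closed range. A vector orthogonal
  to the range lies in the kernel of the adjoint, which is \<open>B\<close> itself, and is therefore
  zero.\<close>

lemma uniformly_positive_inverse: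
  fixes B :: "'a::chilbert_space operator"
  assumes "selfadjoint B" "c > 0" "bounded_below_by B c"
  obtains S where "op_inverse B = (\<lambda>y. Some (S y))" "\<And>y. B (S y) = Some y"
    "\<And>x. x \<in> dom B \<Longrightarrow> S (the (B x)) = x"
proof -
  have lin: "linear_operator B" and dense: "closure (dom B) = UNIV"
    using assms(1) by (auto simp: selfadjoint_def)
  have below: "c * norm x \<le> norm (the (B x))" if "x \<in> dom B" for x
  proof (cases "x = 0")
    case False
    have "c * (norm x)\<^sup>2 \<le> Re (qform B x)" using assms(3) that by (simp add: bounded_below_by_def)
    also have "\<dots> \<le> norm (the (B x)) * norm x"
      using complex_Re_le_cmod norm_cinner_le order_trans by blast
    finally have "(c * norm x) * norm x \<le> norm (the (B x)) * norm x"
      by (simp add: power2_eq_square mult.assoc)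
    then show ?thesis using False by (simp add: mult_le_cancel_right)
  qed simp
  have diff: "x - y \<in> dom B \<and> the (B (x - y)) = the (B x) - the (B y)"
    if "x \<in> dom B" "y \<in> dom B" for x y
  proof
    show d: "x - y \<in> dom B"
      using linear_operatorD(1)[OF lin] that by (rule complex_vector.subspace_diff)
    show "the (B (x - y)) = the (B x) - the (B y)"
      using linear_operatorD(2)[OF lin d that(2)] by simp
  qed
  have inj: "x = y" if "B x = Some v" "B y = Some v" for x y v
  proof -
    have "x \<in> dom B" "y \<in> dom B" using that by auto
    then have "c * norm (x - y) \<le> 0" using below[of "x - y"] diff[of x y] that by simp
    then show ?thesis using assms(2) by (simp add: mult_le_0_iff)
  qed
  have ran_eq: "ran B = (\<lambda>x. the (B x)) ` dom B" by (force simp: ran_def)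
  have sub: "complex_vector.subspace (ran B)"
    unfolding ran_eq complex_vector.subspace_def
  proof (intro conjI ballI allI)
    have "0 \<in> dom B" "the (B 0) = 0"
      using linear_operatorD(1)[OF lin] diff[of 0 0] by (auto simp: complex_vector.subspace_0)
    then show "0 \<in> (\<lambda>x. the (B x)) ` dom B" by (metis imageI)
    fix u assume "u \<in> (\<lambda>x. the (B x)) ` dom B"
    then obtain x where x: "x \<in> dom B" "u = the (B x)" by blast
    show "a *\<^sub>C u \<in> (\<lambda>x. the (B x)) ` dom B" for a
      using linear_operatorD(3,4)[OF lin x(1), of a] x(2) by (metis imageI)
    fix v assume "v \<in> (\<lambda>x. the (B x)) ` dom B"
    then obtain y where y: "y \<in> dom B" "v = the (B y)" by blast
    have "x + y \<in> dom B"
      using linear_operatorD(1)[OF lin] x(1) y(1) by (rule complex_vector.subspace_add)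
    then show "u + v \<in> (\<lambda>x. the (B x)) ` dom B"
      using linear_operatorD(2)[OF lin x(1) y(1)] x(2) y(2) by (metis imageI)
  qed
  have "closed (ran B)"
    unfolding closed_sequential_limits
  proof (intro allI impI, elim conjE)
    fix v l assume v: "\<forall>n. v n \<in> ran B" and l: "v \<longlonglongrightarrow> l"
    then have "\<forall>n. \<exists>x. x \<in> dom B \<and> v n = the (B x)" unfolding ran_eq by blast
    then obtain x where x: "\<And>n. x n \<in> dom B" "\<And>n. v n = the (B (x n))" by metis
    have "Cauchy x"
    proof (rule metric_CauchyI)
      fix \<epsilon> :: real assume "\<epsilon> > 0"
      then obtain N where N: "\<And>m n. m \<ge> N \<Longrightarrow> n \<ge> N \<Longrightarrow> dist (v m) (v n) < c * \<epsilon>"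
        using metric_CauchyD[OF LIMSEQ_imp_Cauchy[OF l], of "c * \<epsilon>"] assms(2) by auto
      have "dist (x m) (x n) < \<epsilon>" if "m \<ge> N" "n \<ge> N" for m n
      proof -
        have "c * dist (x m) (x n) \<le> dist (v m) (v n)"
          using below[of "x m - x n"] diff[OF x(1) x(1)] x(2) by (simp add: dist_norm)
        also have "\<dots> < c * \<epsilon>" using N that by blast
        finally show ?thesis using assms(2) by simp
      qed
      then show "\<exists>N. \<forall>m\<ge>N. \<forall>n\<ge>N. dist (x m) (x n) < \<epsilon>" by blast
    qed
    then obtain y where y: "x \<longlonglongrightarrow> y" using Cauchy_convergent convergentD by blast
    \<comment> \<open>Symmetry passes to the limit, and selfadjointness puts the limit into the
      domain: the graph is closed.\<close>
    have "B y = Some l"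
    proof (rule selfadjoint_mem[OF assms(1)])
      fix w assume w: "w \<in> dom B"
      have "(\<lambda>n. cinner (the (B w)) (x n)) \<longlonglongrightarrow> cinner (the (B w)) y"
        "(\<lambda>n. cinner w (v n)) \<longlonglongrightarrow> cinner w l"
        by (intro cinner.tendsto y l tendsto_const)+
      moreover have "cinner (the (B w)) (x n) = cinner w (v n)" for n
        using selfadjoint_symmetric[OF assms(1) w x(1)] x(2) by simp
      ultimately show "cinner (the (B w)) y = cinner w l"
        using LIMSEQ_unique[of "\<lambda>n. cinner w (v n)"] by simp
    qed
    then show "l \<in> ran B" by (auto simp: ran_def)
  qed
  have "ran B = UNIV"
  proof -
    have "v \<in> ran B" for v
    proof -
      obtain p where p: "p \<in> ran B" "\<And>u. u \<in> ran B \<Longrightarrow> cinner (v - p) u = 0"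
        using ex_orthogonal_projection[OF sub \<open>closed (ran B)\<close>] by blast
      have "cinner (the (B x)) (v - p) = cinner x 0" if "x \<in> dom B" for x
        using p(2)[of "the (B x)"] that cinner_commute[of "the (B x)" "v - p"]
        by (simp add: ran_eq cinner.zero_right)
      then have *: "B (v - p) = Some 0" by (rule selfadjoint_mem[OF assms(1)])
      then have "norm (v - p) \<le> 0"
        using below[of "v - p"] assms(2) by (simp add: mult_le_0_iff domI)
      then show ?thesis using p(1) by simp
    qed
    then show ?thesis by blast
  qed
  define S where "S y = (THE x. B x = Some y)" for y
  have BS: "B (S y) = Some y" for y
  proof -
    obtain x where "B x = Some y" using \<open>ran B = UNIV\<close> by (force simp: ran_def)
    then have "S y = x" unfolding S_def using inj by blast
    then show ?thesis using \<open>B x = Some y\<close> by simp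
  qed
  show ?thesis
  proof
    show "op_inverse B = (\<lambda>y. Some (S y))"
      by (simp add: op_inverse_def \<open>ran B = UNIV\<close> S_def)
    show "B (S y) = Some y" for y by (rule BS)
    show "S (the (B x)) = x" if "x \<in> dom B" for x
      using inj[OF BS] that by auto
  qed
qed

text \<open>Here \<open>r\<close> is B^(-1/2). The unbounded root B^(1/2) is never constructed: on
  \<open>dom B\<close> its value at \<open>x\<close> is represented by
  \<open>r (the (B x))\<close>.\<close>

lemma uniformly_positive_inv_sqrt:
  fixes B :: "'a::chilbert_space operator"
  assumes "uniformly_positive B"
  obtains r c where "inv_sqrt B = (\<lambda>x. Some (r x))" "sym_op r" "c > 0"
    "\<And>y. B (r (r y)) = Some y" "\<And>x. x \<in> dom B \<Longrightarrow> r (r (the (B x))) = x"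
    "bounded_below_by B c" "closure (dom B) = UNIV"
proof -
  obtain c where B: "selfadjoint B" "c > 0" "bounded_below_by B c"
    using assms by (auto simp: uniformly_positive_def)
  obtain S where S: "op_inverse B = (\<lambda>y. Some (S y))" "\<And>y. B (S y) = Some y"
    "\<And>x. x \<in> dom B \<Longrightarrow> S (the (B x)) = x"
    using uniformly_positive_inverse[OF B] by metis
  have "sym_op S"
    unfolding sym_op_def
  proof (intro allI)
    fix x y
    have "cinner (the (B (S x))) (S y) = cinner (S x) (the (B (S y)))"
      by (rule selfadjoint_symmetric[OF B(1)]) (use S(2) in auto)
    then show "cinner (S x) y = cinner x (S y)" by (simp add: S(2))
  qed
  moreover have "inverse c > 0" using B(2) by simp
  \<comment> \<open>The lower bound for \<open>B\<close> applied at \<open>S x\<close>, where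
    \<open>B (S x)\<close> is \<open>x\<close>.\<close>
  moreover have "(norm (S x))\<^sup>2 \<le> inverse c * Re (cinner (S x) x)" for x
  proof -
    have "c * (norm (S x))\<^sup>2 \<le> Re (cinner x (S x))"
      using B(3) S(2)[of x] by (force simp: bounded_below_by_def)
    then show ?thesis
      using B(2) \<open>sym_op S\<close> by (simp add: sym_op_def field_simps)
  qed
  ultimately obtain r where "op_sqrt (\<lambda>x. Some (S x)) = (\<lambda>x. Some (r x))" "sym_op r"
    "\<And>x. r (r x) = S x"
    using op_sqrt_total[of S "inverse c"] by metis
  then show ?thesis
    using that[of r c] B S by (simp add: inv_sqrt_def selfadjoint_def)
qed

section \<open>The Toeplitz--Hausdorff theorem\<close>

text \<open>Total functions linear on a subspace, so that the transformed operator RAR - \<mu> can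
  be treated without partial maps.\<close>

definition clinear_on :: "'a::complex_inner set \<Rightarrow> ('a \<Rightarrow> 'a) \<Rightarrow> bool"
  where "clinear_on D f \<longleftrightarrow> complex_vector.subspace D \<and>
    (\<forall>x\<in>D. \<forall>y\<in>D. f (x + y) = f x + f y) \<and> (\<forall>c. \<forall>x\<in>D. f (c *\<^sub>C x) = c *\<^sub>C f x)"

lemma clinear_onD:
  assumes "clinear_on D f"
  shows "complex_vector.subspace D"
    and "x \<in> D \<Longrightarrow> y \<in> D \<Longrightarrow> f (x + y) = f x + f y"
    and "x \<in> D \<Longrightarrow> f (c *\<^sub>C x) = c *\<^sub>C f x"
    and "x \<in> D \<Longrightarrow> y \<in> D \<Longrightarrow> a *\<^sub>C x + b *\<^sub>C y \<in> D"
    and "x \<in> D \<Longrightarrow> y \<in> D \<Longrightarrow> f (a *\<^sub>C x + b *\<^sub>C y) = a *\<^sub>C f x + b *\<^sub>C f y"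
  using assms
  by (auto simp: clinear_on_def complex_vector.subspace_add complex_vector.subspace_scale)

lemma clinear_on_operator: "linear_operator A \<longleftrightarrow> clinear_on (dom A) (\<lambda>x. the (A x))"
  by (simp add: linear_operator_def clinear_on_def)

lemma cinner_combination:
  "cinner (a *\<^sub>C u + b *\<^sub>C v) (c *\<^sub>C x + d *\<^sub>C y)
    = a * cnj c * cinner u x + a * cnj d * cinner u y + b * cnj c * cinner v x + b * cnj d * cinner v y"
  by (simp add: cinner_lin algebra_simps)

text \<open>The Toeplitz--Hausdorff argument with control of the coefficients: the weights of the
  combination are comparable to the weights of the convex combination of the values.\<close>

lemma toeplitz_hausdorff_small_weight:
  assumes f: "clinear_on D f" and x: "x1 \<in> D" "x2 \<in> D" "norm x1 = 1" "norm x2 = 1"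
    and t: "0 \<le> t" "t \<le> 1/2"
  shows "\<exists>d1 d2. norm (d1 *\<^sub>C x1 + d2 *\<^sub>C x2) = 1 \<and>
    cinner (f (d1 *\<^sub>C x1 + d2 *\<^sub>C x2)) (d1 *\<^sub>C x1 + d2 *\<^sub>C x2)
      = t * cinner (f x1) x1 + (1 - complex_of_real t) * cinner (f x2) x2 \<and>
    (cmod d1)\<^sup>2 \<le> 32 * t \<and> (cmod d2)\<^sup>2 \<le> 32 * (1 - t)"
    (is "?goal")
proof -
  define a1 a2 where "a1 = cinner (f x1) x1" and "a2 = cinner (f x2) x2"
  define l where "l = t * a1 + (1 - complex_of_real t) * a2"
  define w where "w = a1 - a2"
  \<comment> \<open>\<open>q12\<close> and \<open>q21\<close> are the cross terms of the form
    shifted by the target value \<open>l\<close>; that form has to vanish at the vector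
    sought.\<close>
  define q12 where "q12 = cinner (f x1) x2 - l * cinner x1 x2"
  define q21 where "q21 = cinner (f x2) x1 - l * cinner x2 x1"
  show ?thesis
  proof (cases "w = 0")
    case True
    then have "t * a1 + (1 - t) * a2 = a2" by (simp add: w_def algebra_simps)
    then show ?thesis
      using x t unfolding a1_def a2_def
      by (intro exI[of _ 0] exI[of _ 1]) (simp add: scaleC_of_real[of 1, simplified])
  next
    case False
    \<comment> \<open>For v = s c x1 + sqrt (1 - s^2) x2 the shifted form equals (s^2 - t + 2
      \<kappa> s sqrt (1 - s^2)) w, so a root s suffices. The last condition bounds the squared norm
      of v below by 1/2; normalizing then costs a factor 2, and with s^2 \<le> 16 t this gives 32.
      The bound for the second weight is easy since t \<le> 1/2.\<close>
    have core: ?goal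
      if c: "cmod c = 1" "c * q12 + cnj c * q21 = 2 * complex_of_real \<kappa> * w"
        and s: "0 \<le> s" "s \<le> 1" "s\<^sup>2 - t + 2 * \<kappa> * s * sqrt (1 - s\<^sup>2) = 0" "s\<^sup>2 \<le> 16 * t"
        and n: "1/2 \<le> 1 + 2 * s * sqrt (1 - s\<^sup>2) * Re (c * cinner x1 x2)" for c \<kappa> s
    proof -
      define k where "k = sqrt (1 - s\<^sup>2)"
      have k: "k\<^sup>2 = 1 - s\<^sup>2" "0 \<le> k" using s by (simp_all add: k_def power_le_one)
      define v where "v = (s * c) *\<^sub>C x1 + complex_of_real k *\<^sub>C x2"
      have v: "v \<in> D" "f v = (s * c) *\<^sub>C f x1 + complex_of_real k *\<^sub>C f x2"
        unfolding v_def using f x by (simp_all add: clinear_onD)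
      have cc: "c * cnj c = 1" using c(1) by (metis complex_norm_square of_real_1 one_power2)
      have sk: "complex_of_real s * s = complex_of_real (s\<^sup>2)"
        "complex_of_real k * k = 1 - complex_of_real (s\<^sup>2)"
        by (simp_all add: power2_eq_square k(1)[unfolded power2_eq_square] flip: of_real_mult)
      have "cinner v v = complex_of_real s * s * (c * cnj c) * cinner x1 x1
          + s * k * (c * cinner x1 x2 + cnj c * cinner x2 x1) + complex_of_real k * k * cinner x2 x2"
        unfolding v_def cinner_combination by (simp add: algebra_simps)
      then have vv: "cinner v v = 1 + s * k * (c * cinner x1 x2 + cnj c * cinner x2 x1)"
        by (simp only: cc sk cinner_self x) simp
      have "cinner (f v) v = complex_of_real s * s * (c * cnj c) * a1
          + s * k * (c * cinner (f x1) x2 + cnj c * cinner (f x2) x1) + complex_of_real k * k * a2"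
        unfolding v(2) unfolding v_def cinner_combination a1_def a2_def by (simp add: algebra_simps)
      then have fv: "cinner (f v) v = complex_of_real (s\<^sup>2) * a1 + (1 - complex_of_real (s\<^sup>2)) * a2
          + s * k * (c * cinner (f x1) x2 + cnj c * cinner (f x2) x1)"
        by (simp only: cc sk) simp
      have "cinner (f v) v - l * cinner v v
          = complex_of_real (s\<^sup>2) * a1 + (1 - complex_of_real (s\<^sup>2)) * a2 - l
            + s * k * (c * q12 + cnj c * q21)"
        unfolding fv vv q12_def q21_def by (simp add: algebra_simps)
      also have "\<dots> = complex_of_real (s\<^sup>2 - t + 2 * \<kappa> * s * k) * w"
        unfolding c(2) by (simp add: l_def w_def algebra_simps)
      finally have qv: "cinner (f v) v = l * cinner v v" using s(3) by (simp add: k_def)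
      define N where "N = norm v"
      have "Re (cinner v v) = 1 + 2 * s * k * Re (c * cinner x1 x2)"
        unfolding vv by (subst cinner_commute[of x2 x1]) (simp add: algebra_simps)
      then have N: "N\<^sup>2 \<ge> 1/2" using n by (simp add: N_def k_def cinner_self)
      then have "N \<noteq> 0" "N > 0" using norm_ge_zero[of v] by (auto simp: N_def)
      let ?d = "complex_of_real (inverse N)"
      have norm1: "norm (?d *\<^sub>C v) = 1"
        using \<open>N \<noteq> 0\<close> by (simp add: norm_scaleC N_def norm_inverse)
      have form: "cinner (f (?d *\<^sub>C v)) (?d *\<^sub>C v) = l"
      proof -
        have "cinner (f (?d *\<^sub>C v)) (?d *\<^sub>C v) = complex_of_real (inverse N * inverse N) * (l * cinner v v)"
          using clinear_onD(3)[OF f v(1)] by (simp add: cinner_lin qv)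
        also have "\<dots> = l * complex_of_real (inverse N * inverse N * N\<^sup>2)"
          unfolding cinner_self N_def[symmetric] by (simp add: algebra_simps)
        also have "inverse N * inverse N * N\<^sup>2 = 1"
          using \<open>N \<noteq> 0\<close> by (simp add: power2_eq_square field_simps)
        finally show ?thesis by simp
      qed
      have eq: "?d *\<^sub>C v = (?d * (s * c)) *\<^sub>C x1 + (?d * k) *\<^sub>C x2"
        by (simp add: v_def scaleC_add_right scaleC_scaleC)
      have inv: "(inverse N)\<^sup>2 \<le> 2"
      proof -
        have "inverse (N\<^sup>2) \<le> inverse (1/2)" using N by (intro le_imp_inverse_le) auto
        then show ?thesis by (simp add: power_inverse)
      qed
      have "(cmod (?d * (s * c)))\<^sup>2 = (inverse N)\<^sup>2 * s\<^sup>2"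
        using c(1) by (simp add: norm_mult power_mult_distrib norm_inverse power_inverse flip: of_real_inverse)
      also have "\<dots> \<le> 2 * (16 * t)" by (intro mult_mono inv s) auto
      finally have d1: "(cmod (?d * (s * c)))\<^sup>2 \<le> 32 * t" by simp
      have "(cmod (?d * k))\<^sup>2 = (inverse N)\<^sup>2 * k\<^sup>2"
        by (simp add: norm_mult power_mult_distrib norm_inverse power_inverse flip: of_real_inverse)
      also have "\<dots> \<le> 2 * 1"
      proof -
        have "k\<^sup>2 \<le> 1" using k(1) by simp
        then show ?thesis by (intro mult_mono inv) auto
      qed
      finally have d2: "(cmod (?d * k))\<^sup>2 \<le> 32 * (1 - t)" using t by simp
      show ?goal
        using norm1 form d1 d2 unfolding eq l_def a1_def a2_def by blast
    qed
    \<comment> \<open>This phase makes the sum of the two cross terms a real multiple of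
      \<open>w\<close>, leaving one real equation for s.\<close>
    obtain c where c: "cmod c = 1" "c * (q12 / w - cnj (q21 / w)) = cmod (q12 / w - cnj (q21 / w))"
      using ex_unimodular by blast
    define \<kappa> where "\<kappa> = Re (c * (q12 / w) + cnj c * (q21 / w)) / 2"
    have "Im (c * \<alpha> + cnj c * \<beta>) = Im (c * (\<alpha> - cnj \<beta>))" for \<alpha> \<beta>
      by (simp add: algebra_simps)
    from this[of "q12 / w" "q21 / w"] have "Im (c * (q12 / w) + cnj c * (q21 / w)) = 0" unfolding c(2) by simp
    then have "c * (q12 / w) + cnj c * (q21 / w) = 2 * complex_of_real \<kappa>"
      by (simp add: complex_eq_iff \<kappa>_def)
    then have \<kappa>: "c * q12 + cnj c * q21 = 2 * complex_of_real \<kappa> * w"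
      using False by (simp add: field_simps)
    \<comment> \<open>Replacing c by -c changes the sign of \<kappa> and of the overlap of the two
      vectors. One of these signs can be prescribed.\<close>
    have sgn: "\<exists>c \<kappa>. cmod c = 1 \<and> c * q12 + cnj c * q21 = 2 * complex_of_real \<kappa> * w \<and> P c \<kappa>"
      if "P c \<kappa> \<or> P (- c) (- \<kappa>)" for P
    proof -
      have "- c * q12 + cnj (- c) * q21 = 2 * complex_of_real (- \<kappa>) * w"
        using \<kappa> by (simp add: minus_equation_iff algebra_simps)
      then show ?thesis using that c(1) \<kappa> by (metis norm_minus_cancel)
    qed
    show ?thesis
    \<comment> \<open>For small t the sign is spent on \<kappa>: it gives a root s \<le> sqrt t
      \<le> 1/4, so the weight is controlled and the overlap is too small to matter. For larger t
      the weight bound follows from s \<le> 1, and the sign is spent on a nonnegative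
      overlap.\<close>
    proof (cases "t \<le> 1/16")
      case True
      have "\<kappa> \<ge> 0 \<or> - \<kappa> \<ge> 0" by linarith
      from sgn[of "\<lambda>c \<kappa>. \<kappa> \<ge> 0", OF this] obtain c \<kappa> where
        c: "cmod c = 1" "c * q12 + cnj c * q21 = 2 * complex_of_real \<kappa> * w" "\<kappa> \<ge> 0" by blast
      have "\<exists>s\<ge>0. s \<le> sqrt t \<and> s\<^sup>2 - t + 2 * \<kappa> * s * sqrt (1 - s\<^sup>2) = 0"
        using t c(3) by (intro IVT' continuous_intros) (auto intro!: mult_nonneg_nonneg)
      then obtain s where s: "0 \<le> s" "s \<le> sqrt t" "s\<^sup>2 - t + 2 * \<kappa> * s * sqrt (1 - s\<^sup>2) = 0" by blast
      have "sqrt t \<le> 1/4" using True by (intro real_le_lsqrt) (simp_all add: power2_eq_square)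
      then have "s \<le> 1/4" using s(2) by simp
      have "s\<^sup>2 \<le> t" using s t(1) by (metis power_mono real_sqrt_pow2)
      show ?thesis
      proof (rule core[OF c(1,2) s(1) _ s(3)])
        have b: "cmod (c * cinner x1 x2) \<le> 1"
          using norm_cinner_le[of x1 x2] c(1) x by (simp add: norm_mult)
        have "\<bar>s * sqrt (1 - s\<^sup>2) * Re (c * cinner x1 x2)\<bar> \<le> 1/4 * 1 * 1"
          unfolding abs_mult using \<open>0 \<le> s\<close> \<open>s \<le> 1/4\<close> b abs_Re_le_cmod[of "c * cinner x1 x2"]
          by (intro mult_mono) (auto simp: power_le_one abs_le_iff)
        then show "1/2 \<le> 1 + 2 * s * sqrt (1 - s\<^sup>2) * Re (c * cinner x1 x2)" by simp
      qed (use \<open>s \<le> 1/4\<close> \<open>s\<^sup>2 \<le> t\<close> t in auto)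
    next
      case False
      have "Re (c * cinner x1 x2) \<ge> 0 \<or> Re (- c * cinner x1 x2) \<ge> 0" by auto
      from sgn[of "\<lambda>c \<kappa>. Re (c * cinner x1 x2) \<ge> 0", OF this] obtain c \<kappa> where
        c: "cmod c = 1" "c * q12 + cnj c * q21 = 2 * complex_of_real \<kappa> * w"
        "Re (c * cinner x1 x2) \<ge> 0" by blast
      have "\<exists>s\<ge>0. s \<le> 1 \<and> s\<^sup>2 - t + 2 * \<kappa> * s * sqrt (1 - s\<^sup>2) = 0"
        using t by (intro IVT' continuous_intros) auto
      then obtain s where s: "0 \<le> s" "s \<le> 1" "s\<^sup>2 - t + 2 * \<kappa> * s * sqrt (1 - s\<^sup>2) = 0" by blast
      have "s\<^sup>2 \<le> 1" using s by (simp add: power_le_one)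
      show ?thesis
      proof (rule core[OF c(1,2) s])
        show "s\<^sup>2 \<le> 16 * t" using \<open>s\<^sup>2 \<le> 1\<close> False by simp
        have "0 \<le> s * sqrt (1 - s\<^sup>2) * Re (c * cinner x1 x2)"
          using s(1) \<open>s\<^sup>2 \<le> 1\<close> c(3) by (intro mult_nonneg_nonneg) auto
        then show "1/2 \<le> 1 + 2 * s * sqrt (1 - s\<^sup>2) * Re (c * cinner x1 x2)" by simp
      qed
    qed
  qed
qed


lemma toeplitz_hausdorff_two_points:
  assumes f: "clinear_on D f" and x: "x1 \<in> D" "x2 \<in> D" "norm x1 = 1" "norm x2 = 1"
    and t: "0 \<le> t" "t \<le> 1"
  obtains d1 d2 where "norm (d1 *\<^sub>C x1 + d2 *\<^sub>C x2) = 1"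
    "cinner (f (d1 *\<^sub>C x1 + d2 *\<^sub>C x2)) (d1 *\<^sub>C x1 + d2 *\<^sub>C x2)
      = t * cinner (f x1) x1 + (1 - complex_of_real t) * cinner (f x2) x2"
    "(cmod d1)\<^sup>2 \<le> 32 * t" "(cmod d2)\<^sup>2 \<le> 32 * (1 - t)"
proof (cases "t \<le> 1/2")
  case True
  then show ?thesis
    using toeplitz_hausdorff_small_weight[OF f x t(1)] that by blast
next
  case False
  then have "0 \<le> 1 - t" "1 - t \<le> 1/2" using t by auto
  from toeplitz_hausdorff_small_weight[OF f x(2,1,4,3) this] obtain d2 d1 where
    d: "norm (d2 *\<^sub>C x2 + d1 *\<^sub>C x1) = 1"
      "cinner (f (d2 *\<^sub>C x2 + d1 *\<^sub>C x1)) (d2 *\<^sub>C x2 + d1 *\<^sub>C x1)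
        = (1 - complex_of_real t) * cinner (f x2) x2 + t * cinner (f x1) x1"
      "(cmod d2)\<^sup>2 \<le> 32 * (1 - t)" "(cmod d1)\<^sup>2 \<le> 32 * t"
    by auto
  show ?thesis
    by (rule that[of d1 d2]) (use d in \<open>simp_all add: add.commute\<close>)
qed

lemma convex_num_range:
  assumes f: "clinear_on D f"
  shows "convex {cinner (f x) x | x. x \<in> D \<and> norm x = 1}"
  unfolding convex_alt
proof (intro ballI allI impI)
  fix a b and t :: real
  assume "a \<in> {cinner (f x) x | x. x \<in> D \<and> norm x = 1}"
    "b \<in> {cinner (f x) x | x. x \<in> D \<and> norm x = 1}" and "0 \<le> t \<and> t \<le> 1"
  then have t: "0 \<le> t" "t \<le> 1" by auto
  from \<open>a \<in> _\<close> \<open>b \<in> _\<close> obtain x y where x: "x \<in> D" "norm x = 1" "a = cinner (f x) x"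
    and y: "y \<in> D" "norm y = 1" "b = cinner (f y) y" by blast
  obtain d1 d2 where d: "norm (d1 *\<^sub>C y + d2 *\<^sub>C x) = 1"
    "cinner (f (d1 *\<^sub>C y + d2 *\<^sub>C x)) (d1 *\<^sub>C y + d2 *\<^sub>C x)
      = t * cinner (f y) y + (1 - complex_of_real t) * cinner (f x) x"
    by (rule toeplitz_hausdorff_two_points[OF f y(1) x(1) y(2) x(2) t]) blast
  have "d1 *\<^sub>C y + d2 *\<^sub>C x \<in> D" by (rule clinear_onD(4)[OF f y(1) x(1)])
  moreover have "(1 - t) *\<^sub>R a + t *\<^sub>R b
      = cinner (f (d1 *\<^sub>C y + d2 *\<^sub>C x)) (d1 *\<^sub>C y + d2 *\<^sub>C x)"
    unfolding d(2) by (simp add: x(3) y(3) scaleR_conv_of_real)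
  ultimately show "(1 - t) *\<^sub>R a + t *\<^sub>R b \<in> {cinner (f x) x | x. x \<in> D \<and> norm x = 1}"
    using d(1) by blast
qed

section \<open>Convex combinations under a nonnegative third form\<close>

text \<open>Each merge costs a factor 64 = 2 * 32: 2 from the quasi-subadditivity of
  \<open>p\<close>, 32 from the coefficients. Since these are proportional to the convex weights, a
  point of tiny weight contributes little even if its \<open>p\<close> is large.\<close>

lemma toeplitz_hausdorff_finite:
  fixes p :: "'a::complex_inner \<Rightarrow> real"
  assumes f: "clinear_on D f"
    and p: "\<And>x. p x \<ge> 0" "\<And>x y. p (x + y) \<le> 2 * p x + 2 * p y"
      "\<And>c x. p (c *\<^sub>C x) = (cmod c)\<^sup>2 * p x"
    and "finite I" "\<And>i. i \<in> I \<Longrightarrow> x i \<in> D" "\<And>i. i \<in> I \<Longrightarrow> norm (x i) = 1"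
      "\<And>i. i \<in> I \<Longrightarrow> u i \<ge> 0" "sum u I = 1"
  shows "\<exists>v\<in>D. norm v = 1 \<and>
    cinner (f v) v = (\<Sum>i\<in>I. u i * cinner (f (x i)) (x i)) \<and>
    p v \<le> 64 ^ card I * (\<Sum>i\<in>I. u i * p (x i))"
  using assms(5-)
proof (induction I arbitrary: u rule: finite_induct)
  case (insert j I)
  have "u j + sum u I = 1" using insert.prems(4) insert.hyps by simp
  moreover have "0 \<le> sum u I" by (rule sum_nonneg) (simp add: insert.prems(3))
  moreover have "0 \<le> u j" by (simp add: insert.prems(3))
  ultimately have uj: "0 \<le> u j" "u j \<le> 1" "sum u I = 1 - u j" by auto
  show ?case
  proof (cases "u j = 1")
    case True
    then have "\<forall>i\<in>I. u i = 0"
      using uj(3) insert.prems(3) insert.hyps(1) sum_nonneg_eq_0_iff[of I u] by simp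
    then have "(\<Sum>i\<in>I. u i * p (x i)) = 0" "(\<Sum>i\<in>I. u i * cinner (f (x i)) (x i)) = 0"
      by simp_all
    moreover have "p (x j) \<le> 64 ^ card (insert j I) * p (x j)"
      using mult_right_mono[OF one_le_power[of 64 "card (insert j I)"] p(1)[of "x j"]] by simp
    ultimately show ?thesis
      using insert.hyps insert.prems(1,2) True by (intro bexI[of _ "x j"]) auto
  next
    case False
    define t where "t = u j"
    have t: "0 \<le> t" "t < 1" using uj False by (auto simp: t_def)
    define w where "w i = u i / (1 - t)" for i
    have w: "(1 - t) * w i = u i" for i using t by (simp add: w_def)
    have "sum w I = 1" using uj(3) t by (simp add: w_def t_def flip: sum_divide_distrib)
    then obtain v where v: "v \<in> D" "norm v = 1"
      "cinner (f v) v = (\<Sum>i\<in>I. w i * cinner (f (x i)) (x i))"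
      "p v \<le> 64 ^ card I * (\<Sum>i\<in>I. w i * p (x i))"
      using insert.IH[of w] insert.prems t by (auto simp: w_def)
    have xj: "x j \<in> D" "norm (x j) = 1" using insert.prems by auto
    obtain d1 d2 where d: "norm (d1 *\<^sub>C x j + d2 *\<^sub>C v) = 1"
      "cinner (f (d1 *\<^sub>C x j + d2 *\<^sub>C v)) (d1 *\<^sub>C x j + d2 *\<^sub>C v)
        = t * cinner (f (x j)) (x j) + (1 - complex_of_real t) * cinner (f v) v"
      "(cmod d1)\<^sup>2 \<le> 32 * t" "(cmod d2)\<^sup>2 \<le> 32 * (1 - t)"
      by (rule toeplitz_hausdorff_two_points[OF f xj(1) v(1) xj(2) v(2) t(1) less_imp_le[OF t(2)]]) blast
    let ?v = "d1 *\<^sub>C x j + d2 *\<^sub>C v"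
    have "(1 - complex_of_real t) * cinner (f v) v
        = (\<Sum>i\<in>I. complex_of_real ((1 - t) * w i) * cinner (f (x i)) (x i))"
      unfolding v(3) sum_distrib_left by (simp add: mult.assoc)
    then have form: "cinner (f ?v) ?v = (\<Sum>i\<in>insert j I. u i * cinner (f (x i)) (x i))"
      unfolding d(2) w using insert.hyps by (simp add: t_def)
    let ?s = "\<Sum>i\<in>I. u i * p (x i)"
    have s: "(1 - t) * (\<Sum>i\<in>I. w i * p (x i)) = ?s"
      unfolding sum_distrib_left mult.assoc[symmetric] w ..
    have "p ?v \<le> 2 * ((cmod d1)\<^sup>2 * p (x j)) + 2 * ((cmod d2)\<^sup>2 * p v)"
      using p(2)[of "d1 *\<^sub>C x j" "d2 *\<^sub>C v"] by (simp add: p(3))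
    also have "\<dots> \<le> 2 * (32 * t * p (x j)) + 2 * (32 * (1 - t) * (64 ^ card I * (\<Sum>i\<in>I. w i * p (x i))))"
      using p(1) d t v(4) by (intro add_mono mult_mono mult_nonneg_nonneg) auto
    also have "\<dots> = 64 * (t * p (x j)) + 64 * (64 ^ card I * ?s)"
      unfolding s[symmetric] by (simp add: algebra_simps)
    also have "\<dots> \<le> 64 * (64 ^ card I * (t * p (x j))) + 64 * (64 ^ card I * ?s)"
      using mult_right_mono[OF one_le_power[of 64 "card I"], of "t * p (x j)"] t(1) p(1)[of "x j"]
      by simp
    also have "\<dots> = 64 ^ card (insert j I) * (\<Sum>i\<in>insert j I. u i * p (x i))"
      using insert.hyps by (simp add: t_def algebra_simps)
    finally show ?thesis
      using d(1) form clinear_onD(4)[OF f xj(1) v(1)] by blast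
  qed
qed simp

text \<open>Au-Yeung--Poon convexity of the joint numerical range of three Hermitian forms, in the
  approximate form needed here: the third form is nonnegative and only bounded from above.\<close>

lemma three_forms_separation:
  fixes p :: "'a::complex_inner \<Rightarrow> real"
  assumes f: "clinear_on D f"
    and p: "\<And>x. p x \<ge> 0" "\<And>x y. p (x + y) \<le> 2 * p x + 2 * p y"
      "\<And>c x. p (c *\<^sub>C x) = (cmod c)\<^sup>2 * p x"
  obtains (small) "\<And>\<epsilon>. \<epsilon> > 0 \<Longrightarrow> \<exists>x\<in>D. norm x = 1 \<and> cmod (cinner (f x) x) < \<epsilon> \<and> p x < \<epsilon>"
  | (separated) \<omega> \<gamma> \<delta> where "\<delta> > 0"
      "\<And>x. x \<in> D \<Longrightarrow> norm x = 1 \<Longrightarrow> Re (\<omega> * cinner (f x) x) + \<gamma> * p x > \<delta>"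
proof -
  define S where "S = (\<lambda>x. (cinner (f x) x, p x)) ` {x \<in> D. norm x = 1}"
  \<comment> \<open>By Caratheodory, points of a hull in complex times real, of real dimension 3,
    need at most 4 points of \<open>S\<close>; hence the uniform factor
    \<open>64 ^ 4\<close>.\<close>
  have hull: "\<exists>v\<in>D. norm v = 1 \<and> cinner (f v) v = fst y \<and> p v \<le> 64 ^ 4 * snd y"
    if y: "y \<in> convex hull S" for y
  proof -
    obtain T u where T: "finite T" "T \<subseteq> S" "card T \<le> DIM(complex \<times> real) + 1"
      "\<forall>z\<in>T. 0 \<le> u z" "sum u T = 1" "(\<Sum>z\<in>T. u z *\<^sub>R z) = y"
      using y unfolding convex_hull_caratheodory mem_Collect_eq by blast
    have "card T \<le> 4" using T(3) by simp
    have u: "\<And>z. z \<in> T \<Longrightarrow> 0 \<le> u z" using T(4) by blast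
    have "\<forall>z\<in>T. \<exists>x. x \<in> D \<and> norm x = 1 \<and> z = (cinner (f x) x, p x)"
      using T(2) by (auto simp: S_def)
    then obtain x where x: "\<And>z. z \<in> T \<Longrightarrow> x z \<in> D" "\<And>z. z \<in> T \<Longrightarrow> norm (x z) = 1"
      "\<And>z. z \<in> T \<Longrightarrow> z = (cinner (f (x z)) (x z), p (x z))" by metis
    obtain v where v: "v \<in> D" "norm v = 1"
      "cinner (f v) v = (\<Sum>z\<in>T. u z * cinner (f (x z)) (x z))"
      "p v \<le> 64 ^ card T * (\<Sum>z\<in>T. u z * p (x z))"
      using toeplitz_hausdorff_finite[where x = x and u = u, OF f p T(1) x(1,2) u T(5)] by blast
    have fst: "fst y = (\<Sum>z\<in>T. u z * cinner (f (x z)) (x z))"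
    proof -
      have "fst y = (\<Sum>z\<in>T. u z *\<^sub>R fst z)" by (simp add: fst_sum flip: T(6))
      also have "\<dots> = (\<Sum>z\<in>T. u z * cinner (f (x z)) (x z))"
        by (intro sum.cong refl) (metis x(3) fst_conv scaleR_conv_of_real)
      finally show ?thesis .
    qed
    have snd: "snd y = (\<Sum>z\<in>T. u z * p (x z))"
    proof -
      have "snd y = (\<Sum>z\<in>T. u z *\<^sub>R snd z)" by (simp add: snd_sum flip: T(6))
      also have "\<dots> = (\<Sum>z\<in>T. u z * p (x z))"
        by (intro sum.cong refl) (metis x(3) snd_conv real_scaleR_def)
      finally show ?thesis .
    qed
    have "0 \<le> snd y" unfolding snd using T(4) p(1) by (intro sum_nonneg mult_nonneg_nonneg) auto
    then have "64 ^ card T * snd y \<le> 64 ^ 4 * snd y"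
      using \<open>card T \<le> 4\<close> by (intro mult_right_mono power_increasing) auto
    then show ?thesis using v fst snd by (intro bexI[of _ v]) auto
  qed
  show ?thesis
  proof (cases "0 \<in> closure (convex hull S)")
    case True
    show ?thesis
    proof (rule small)
      fix \<epsilon> :: real assume "\<epsilon> > 0"
      then have "\<epsilon> / 64 ^ 4 > 0" by simp
      with True obtain y where y: "y \<in> convex hull S" "norm y < \<epsilon> / 64 ^ 4"
        unfolding closure_approachable by (metis dist_0_norm dist_commute)
      obtain v where v: "v \<in> D" "norm v = 1" "cinner (f v) v = fst y" "p v \<le> 64 ^ 4 * snd y"
        using hull[OF y(1)] by blast
      have "cmod (fst y) \<le> norm y" "\<bar>snd y\<bar> \<le> norm y"
        using norm_fst_le[of "fst y" "snd y"] norm_snd_le[of "snd y" "fst y"] by simp_all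
      then have "cmod (fst y) < \<epsilon>" "64 ^ 4 * snd y < \<epsilon>"
        using y(2) \<open>\<epsilon> > 0\<close> by (simp_all add: field_simps)
      then show "\<exists>x\<in>D. norm x = 1 \<and> cmod (cinner (f x) x) < \<epsilon> \<and> p x < \<epsilon>"
        using v by (intro bexI[of _ v]) auto
    qed
  next
    case False
    obtain n \<delta> where n: "0 < \<delta>" "\<And>y. y \<in> closure (convex hull S) \<Longrightarrow> inner n y > \<delta>"
      using separating_hyperplane_closed_0[OF _ _ False]
      by (metis closed_closure convex_closure convex_convex_hull)
    show ?thesis
    proof (rule separated[OF n(1)])
      fix x assume "x \<in> D" "norm x = 1"
      then have "(cinner (f x) x, p x) \<in> closure (convex hull S)"
        by (intro subsetD[OF closure_subset] hull_inc) (auto simp: S_def)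
      \<comment> \<open>The real inner product of complex numbers a, b is the real part of cnj a
        times b.\<close>
      from n(2)[OF this] show "Re (cnj (fst n) * cinner (f x) x) + snd n * p x > \<delta>"
        by (simp add: inner_prod_def inner_complex_def)
    qed
  qed
qed

section \<open>The weight is uniformly positive\<close>

lemma clinear_on_sum:
  assumes "clinear_on D f" "finite S" "\<And>i. i \<in> S \<Longrightarrow> g i \<in> D"
  shows "(\<Sum>i\<in>S. g i) \<in> D \<and> f (\<Sum>i\<in>S. g i) = (\<Sum>i\<in>S. f (g i))"
  using assms(2,3)
proof (induction S rule: finite_induct)
  case empty
  have "0 \<in> D" using clinear_onD(1)[OF assms(1)] by (rule complex_vector.subspace_0)
  then show ?case using clinear_onD(3)[OF assms(1), of 0 0] by simp
next
  case (insert i S)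
  then show ?case
    using clinear_onD(1,2)[OF assms(1)] by (simp add: complex_vector.subspace_add)
qed

lemma clinear_on_span_bounded:
  assumes f: "clinear_on (complex_vector.span E) f" and E: "finite E" "orthonormal E"
  obtains M where "M \<ge> 0" "\<And>x. x \<in> complex_vector.span E \<Longrightarrow> norm (f x) \<le> M * norm x"
proof
  show "(\<Sum>e\<in>E. norm (f e)) \<ge> 0" by (simp add: sum_nonneg)
  fix x assume x: "x \<in> complex_vector.span E"
  have mem: "e \<in> complex_vector.span E" if "e \<in> E" for e
    using that by (rule complex_vector.span_base)
  have "x = (\<Sum>e\<in>E. cinner x e *\<^sub>C e)" using oproj_span[OF E x] by (simp add: oproj_def)
  then have "f x = f (\<Sum>e\<in>E. cinner x e *\<^sub>C e)" by simp
  also have "\<dots> = (\<Sum>e\<in>E. f (cinner x e *\<^sub>C e))"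
    using clinear_on_sum[OF f E(1), of "\<lambda>e. cinner x e *\<^sub>C e"] mem
    by (simp add: complex_vector.span_scale)
  also have "\<dots> = (\<Sum>e\<in>E. cinner x e *\<^sub>C f e)"
    using clinear_onD(3)[OF f mem] by (intro sum.cong) auto
  finally have "norm (f x) \<le> (\<Sum>e\<in>E. norm (cinner x e *\<^sub>C f e))"
    by (simp add: norm_sum)
  also have "\<dots> \<le> (\<Sum>e\<in>E. norm x * norm (f e))"
  proof (rule sum_mono)
    fix e assume "e \<in> E"
    then have "cmod (cinner x e) \<le> norm x"
      using norm_cinner_le[of x e] E(2) by (simp add: orthonormal_def)
    then show "norm (cinner x e *\<^sub>C f e) \<le> norm x * norm (f e)"
      by (simp add: norm_scaleC mult_right_mono)
  qed
  finally show "norm (f x) \<le> (\<Sum>e\<in>E. norm (f e)) * norm x"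
    by (simp add: mult.commute flip: sum_distrib_left)
qed

lemma cinner_oproj_self: "cinner (oproj Z x) x = complex_of_real (\<Sum>z\<in>Z. (cmod (cinner x z))\<^sup>2)"
proof -
  have "cinner x z * cinner z x = complex_of_real ((cmod (cinner x z))\<^sup>2)" for z
    by (subst cinner_commute[of z]) (simp add: complex_norm_square del: of_real_power)
  then show ?thesis by (simp add: oproj_def cinner_lin)
qed

lemma finite_rank_scaleC_oproj:
  assumes "finite Z"
  shows "finite_rank_op (\<lambda>x. \<kappa> *\<^sub>C oproj Z x)"
proof -
  have "bounded_linear (\<lambda>x. \<kappa> *\<^sub>C oproj Z x)"
    using bounded_clinear_oproj[of Z] unfolding bounded_clinear_def
    by (intro bounded_linear_compose[OF scaleC.bounded_linear_right]) blast
  then show ?thesis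
    using assms bounded_clinear_oproj[of Z] oproj_in_span[of Z]
    by (auto simp: finite_rank_op_def bounded_clinear_def scaleC_scaleC mult.commute
        intro!: exI[of _ Z] complex_vector.span_scale)
qed

text \<open>One condition leaves a unit vector in two dimensions: normalize the pair of
  \<open>cnj b\<close> and \<open>- cnj a\<close>. It later removes a form value for which no bound
  is available.\<close>

lemma ex_unit_orthogonal_pair:
  "\<exists>\<alpha> \<beta>. (cmod \<alpha>)\<^sup>2 + (cmod \<beta>)\<^sup>2 = 1 \<and> cnj \<alpha> * a + cnj \<beta> * b = 0"
proof (cases "a = 0 \<and> b = 0")
  case True
  then show ?thesis by (intro exI[of _ 1] exI[of _ 0]) simp
next
  case False
  define N where "N = sqrt ((cmod a)\<^sup>2 + (cmod b)\<^sup>2)"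
  have N2: "N\<^sup>2 = (cmod a)\<^sup>2 + (cmod b)\<^sup>2" by (simp add: N_def)
  have "N\<^sup>2 > 0" unfolding N2 using False by (auto simp: sum_power2_gt_zero_iff)
  then have "N \<noteq> 0" by auto
  show ?thesis
  proof (intro exI conjI)
    have "(cmod (cnj b / N))\<^sup>2 + (cmod (- cnj a / N))\<^sup>2 = ((cmod a)\<^sup>2 + (cmod b)\<^sup>2) / N\<^sup>2"
      by (simp add: norm_divide power_divide add_divide_distrib)
    also have "\<dots> = 1" unfolding N2[symmetric] using \<open>N \<noteq> 0\<close> by simp
    finally show "(cmod (cnj b / N))\<^sup>2 + (cmod (- cnj a / N))\<^sup>2 = 1" .
    show "cnj (cnj b / N) * a + cnj (- cnj a / N) * b = 0" by simp
  qed
qed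

section \<open>The pencil in the coordinates given by the inverse square root\<close>

context
  fixes A B :: "'a::chilbert_space operator" and r :: "'a \<Rightarrow> 'a" and c :: real
  assumes A: "linear_operator A" and B: "linear_operator B" and AB: "dom A \<subseteq> dom B"
    and r_sym: "sym_op r" and c_pos: "c > 0" and B_r: "\<And>y. B (r (r y)) = Some y"
    and r_B: "\<And>x. x \<in> dom B \<Longrightarrow> r (r (the (B x))) = x" and below: "bounded_below_by B c"
begin

lemmas r_lin = sym_op_linear[OF r_sym]

lemma r_cinner: "cinner (r x) y = cinner x (r y)"
  using r_sym by (simp add: sym_op_def)

lemma r_0: "r 0 = 0"
  using r_lin(2)[of 0 0] by simp

lemma r_inj: "r x = r y \<Longrightarrow> x = y"
  by (metis B_r option.inject)

lemma r_B_r: "r y \<in> dom B \<Longrightarrow> r (the (B (r y))) = y"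
  by (rule r_inj, rule r_B)

lemma qform_B:
  assumes "x \<in> dom B"
  shows "qform B x = complex_of_real ((norm (r (the (B x))))\<^sup>2)"
proof -
  have "qform B x = cinner (the (B x)) (r (r (the (B x))))" using r_B[OF assms] by simp
  also have "\<dots> = cinner (r (the (B x))) (r (the (B x)))" by (simp add: r_cinner)
  finally show ?thesis by (simp add: cinner_self)
qed

lemma qform_B_r: "r y \<in> dom B \<Longrightarrow> qform B (r y) = complex_of_real ((norm y)\<^sup>2)"
  by (simp add: qform_B r_B_r)

lemma norm_B_ge: "x \<in> dom B \<Longrightarrow> c * (norm x)\<^sup>2 \<le> (norm (r (the (B x))))\<^sup>2"
  using below qform_B[of x] by (force simp: bounded_below_by_def)

lemma norm_r_le: "r y \<in> dom B \<Longrightarrow> c * (norm (r y))\<^sup>2 \<le> (norm y)\<^sup>2"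
  using norm_B_ge[of "r y"] by (simp add: r_B_r)

lemma qform_B_nonzero: "x \<in> dom B \<Longrightarrow> x \<noteq> 0 \<Longrightarrow> qform B x \<noteq> 0"
  using norm_B_ge[of x] c_pos by (auto simp: qform_B mult_le_0_iff not_le)

text \<open>On \<open>dom B\<close> the substitution \<open>x = r y\<close> loses nothing, since
  \<open>y = r (the (B x))\<close> recovers \<open>x\<close>; homogeneity then normalizes
  \<open>y\<close> instead of \<open>x\<close>.\<close>

lemma quot_num_range_sqrt:
  assumes T: "linear_operator T" "dom T \<subseteq> dom B"
  shows "quot_num_range T B = {qform T (r y) | y. r y \<in> dom T \<and> norm y = 1}"
proof (intro equalityI subsetI)
  fix \<mu> assume "\<mu> \<in> quot_num_range T B"
  then obtain x where x: "x \<in> dom T" "qform B x \<noteq> 0" "\<mu> = qform T x / qform B x"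
    by (auto simp: quot_num_range_def)
  define k where "k = norm (r (the (B x)))"
  have "x \<in> dom B" using x(1) T(2) by blast
  then have b: "qform B x = complex_of_real (k\<^sup>2)" by (simp add: qform_B k_def)
  then have "k \<noteq> 0" using x(2) by auto
  define y where "y = complex_of_real (inverse k) *\<^sub>C r (the (B x))"
  have ry: "r y = complex_of_real (inverse k) *\<^sub>C x"
    using \<open>x \<in> dom B\<close> by (simp add: y_def r_lin r_B)
  have "norm y = 1" using \<open>k \<noteq> 0\<close> by (simp add: y_def norm_scaleC k_def norm_inverse)
  moreover have "r y \<in> dom T" unfolding ry using linear_operatorD(4)[OF T(1) x(1)] .
  moreover have "(cmod (complex_of_real (inverse k)))\<^sup>2 = inverse (k\<^sup>2)"
    by (simp add: power_inverse del: of_real_inverse)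
  then have "qform T (r y) = \<mu>"
    unfolding ry qform_scaleC[OF T(1) x(1)] x(3) b
    by (simp only: of_real_inverse) (simp add: divide_inverse mult.commute)
  ultimately show "\<mu> \<in> {qform T (r y) | y. r y \<in> dom T \<and> norm y = 1}" by blast
next
  fix \<mu> assume "\<mu> \<in> {qform T (r y) | y. r y \<in> dom T \<and> norm y = 1}"
  then obtain y where y: "r y \<in> dom T" "norm y = 1" "\<mu> = qform T (r y)" by blast
  then have "qform B (r y) = 1" using T(2) by (subst qform_B_r) auto
  then show "\<mu> \<in> quot_num_range T B"
    unfolding quot_num_range_def using y by (intro CollectI exI[of _ "r y"]) simp
qed

lemma quot_num_range_perturb:
  assumes "bounded_clinear K"
  shows "quot_num_range (op_perturb A K) B =
    {qform A (r y) + cinner (K (r y)) (r y) | y. r y \<in> dom A \<and> norm y = 1}"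
proof -
  have "quot_num_range (op_perturb A K) B =
      {qform (op_perturb A K) (r y) | y. r y \<in> dom A \<and> norm y = 1}"
    using quot_num_range_sqrt[OF linear_operator_op_perturb[OF A assms]] AB by simp
  also have "\<dots> = {qform A (r y) + cinner (K (r y)) (r y) | y. r y \<in> dom A \<and> norm y = 1}"
    by (rule Collect_cong, rule ex_cong1) (metis qform_op_perturb)
  finally show ?thesis .
qed

text \<open>On unit vectors the form of \<open>B\<close> is at least \<open>c\<close>, so the form
  of T - \<mu> B can be divided by it at the cost of a fixed factor.\<close>

lemma pencil_subset_closure_quot:
  assumes T: "linear_operator T" "dom T \<subseteq> dom B"
  shows "pencil_num_range T B \<subseteq> closure (quot_num_range T B)"
proof
  fix \<mu> assume \<mu>: "\<mu> \<in> pencil_num_range T B"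
  show "\<mu> \<in> closure (quot_num_range T B)"
    unfolding closure_approachable
  proof (intro allI impI)
    fix \<epsilon> :: real assume "\<epsilon> > 0"
    then have "\<epsilon> * c > 0" using c_pos by simp
    then obtain x where x: "x \<in> dom T" "norm x = 1" "cmod (qform T x - \<mu> * qform B x) < \<epsilon> * c"
      using \<mu> unfolding pencil_num_range_iff[OF T(2)] by blast
    have "x \<in> dom B" using x(1) T(2) by blast
    then have b: "cmod (qform B x) \<ge> c"
      using norm_B_ge[of x] x(2) by (simp add: qform_B norm_power)
    then have b0: "qform B x \<noteq> 0" using c_pos by auto
    have "cmod (qform T x / qform B x - \<mu>) = cmod (qform T x - \<mu> * qform B x) / cmod (qform B x)"
      using b0 by (simp add: diff_divide_distrib flip: norm_divide)
    also have "\<dots> < (\<epsilon> * c) / c"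
      using x(3) b c_pos by (intro frac_less) auto
    finally have "cmod (qform T x / qform B x - \<mu>) < \<epsilon>" using c_pos by simp
    then show "\<exists>y\<in>quot_num_range T B. dist y \<mu> < \<epsilon>"
      using x(1) b0 unfolding quot_num_range_def dist_norm by blast
  qed
qed

lemma clinear_on_transform:
  "clinear_on {y. r y \<in> dom A} (\<lambda>y. r (the (A (r y))) - \<mu> *\<^sub>C y)"
proof -
  note D = linear_operatorD[OF A]
  have "complex_vector.subspace {y. r y \<in> dom A}"
    using D(1) by (simp add: complex_vector.subspace_def r_lin r_0)
  then show ?thesis
    using D by (simp add: clinear_on_def r_lin scaleC_add_right scaleC.diff_right scaleC_scaleC
        mult.commute algebra_simps)
qed

lemma cinner_transform:
  "norm y = 1 \<Longrightarrow> cinner (r (the (A (r y))) - \<mu> *\<^sub>C y) y = qform A (r y) - \<mu>"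
  by (simp add: cinner_lin r_cinner cinner_self)

lemma convex_quot_num_range_perturb:
  assumes "bounded_clinear K"
  shows "convex (quot_num_range (op_perturb A K) B)"
proof -
  let ?f = "\<lambda>y. r (the (A (r y))) - 0 *\<^sub>C y + r (K (r y))"
  have "clinear_on {y. r y \<in> dom A} ?f"
    using clinear_on_transform[of 0] bounded_clinear_add[OF assms] assms
    unfolding clinear_on_def bounded_clinear_def
    by (simp add: r_lin scaleC_add_right algebra_simps)
  from convex_num_range[OF this] show ?thesis
    unfolding quot_num_range_perturb[OF assms]
    by (simp add: cinner.add_left r_cinner)
qed

section \<open>Points common to all finite rank intersections\<close>

context
  fixes \<mu> :: complex
  assumes \<mu>: "\<And>K. finite_rank_op K \<Longrightarrow> \<mu> \<in> closure (pencil_num_range (op_perturb A K) B)"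
begin

lemma finite_rank_approx:
  assumes K: "finite_rank_op K" and "\<epsilon> > 0"
  obtains y where "r y \<in> dom A" "norm y = 1"
    "cmod (qform A (r y) + cinner (K (r y)) (r y) - \<mu>) < \<epsilon>"
proof -
  have Kl: "bounded_clinear K" using K by (simp add: finite_rank_op_def)
  have "\<mu> \<in> closure (quot_num_range (op_perturb A K) B)"
    using \<mu>[OF K] pencil_subset_closure_quot[OF linear_operator_op_perturb[OF A Kl]] AB
      closure_minimal[OF _ closed_closure] by (metis dom_op_perturb subsetD)
  then obtain w where "w \<in> quot_num_range (op_perturb A K) B" "cmod (w - \<mu>) < \<epsilon>"
    using \<open>\<epsilon> > 0\<close> unfolding closure_approachable dist_norm by blast
  then show ?thesis using that unfolding quot_num_range_perturb[OF Kl] by blast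
qed

text \<open>If \<open>dom A\<close> had finite dimension, its orthogonal projection would act on it
  as the identity, and a large positive multiple of that projection would keep all values of the
  perturbed form at distance at least 1 from \<mu>.\<close>

lemma dom_orthonormal_sequence:
  obtains e where "\<And>n::nat. e n \<in> dom A" "\<And>n. norm (e n) = 1"
    "\<And>m n. m \<noteq> n \<Longrightarrow> cinner (e m) (e n) = 0"
proof (cases rule: finite_basis_or_orthonormal_sequence[OF linear_operatorD(1)[OF A]])
  case (1 E)
  obtain MA where MA: "MA \<ge> 0" "\<And>x. x \<in> dom A \<Longrightarrow> norm (the (A x)) \<le> MA * norm x"
    using clinear_on_span_bounded[of E "\<lambda>x. the (A x)"] A 1 by (auto simp: clinear_on_operator)
  have "clinear_on (complex_vector.span E) (\<lambda>x. the (B x))"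
    using B AB linear_operatorD(1)[OF A] unfolding clinear_on_operator clinear_on_def 1(3)
    by blast
  then obtain MB where MB: "MB \<ge> 0" "\<And>x. x \<in> dom A \<Longrightarrow> norm (the (B x)) \<le> MB * norm x"
    using clinear_on_span_bounded[OF _ 1(1,2)] 1(3) by metis
  \<comment> \<open>\<open>MA\<close> outweighs the form of \<open>A\<close>. Since 1 = <Bx,x> \<le>
    MB |x|^2 for \<open>x = r y\<close> with unit \<open>y\<close>, the other summand contributes at
    least 1 + |\<mu>|.\<close>
  define t where "t = MA + MB * (1 + cmod \<mu>)"
  have "finite_rank_op (\<lambda>x. complex_of_real t *\<^sub>C oproj E x)"
    by (rule finite_rank_scaleC_oproj[OF 1(1)])
  then obtain y where y: "r y \<in> dom A" "norm y = 1"
    "cmod (qform A (r y) + cinner (complex_of_real t *\<^sub>C oproj E (r y)) (r y) - \<mu>) < 1"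
    by (rule finite_rank_approx[where \<epsilon> = 1]) auto
  let ?x = "r y"
  have "oproj E ?x = ?x" using oproj_span[OF 1(1,2)] y(1) 1(3) by simp
  then have *: "cmod (qform A ?x + complex_of_real (t * (norm ?x)\<^sup>2) - \<mu>) < 1"
    using y(3) by (simp add: cinner_scaleC_left cinner_self)
  have a: "cmod (qform A ?x) \<le> MA * (norm ?x)\<^sup>2"
    using norm_cinner_le[of "the (A ?x)" ?x] mult_right_mono[OF MA(2)[OF y(1)] norm_ge_zero[of ?x]]
    by (simp add: power2_eq_square mult.assoc)
  have "1 = cmod (qform B ?x)"
    using y(1,2) AB by (subst qform_B_r) auto
  also have "\<dots> \<le> MB * (norm ?x)\<^sup>2"
    using norm_cinner_le[of "the (B ?x)" ?x] mult_right_mono[OF MB(2)[OF y(1)] norm_ge_zero[of ?x]]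
    by (simp add: power2_eq_square mult.assoc)
  finally have b: "1 + cmod \<mu> \<le> (1 + cmod \<mu>) * (MB * (norm ?x)\<^sup>2)"
    using mult_left_mono[of 1 "MB * (norm ?x)\<^sup>2" "1 + cmod \<mu>"] by simp
  have "t * (norm ?x)\<^sup>2 \<le> cmod (complex_of_real (t * (norm ?x)\<^sup>2))"
    by (metis abs_ge_self norm_of_real)
  also have "\<dots> \<le> cmod (qform A ?x + complex_of_real (t * (norm ?x)\<^sup>2) - \<mu>) + cmod (qform A ?x) + cmod \<mu>"
    using norm_triangle_ineq4[of "qform A ?x + complex_of_real (t * (norm ?x)\<^sup>2) - \<mu>" "qform A ?x - \<mu>"]
      norm_triangle_ineq4[of "qform A ?x" \<mu>] by simp
  also have "\<dots> < 1 + MA * (norm ?x)\<^sup>2 + cmod \<mu>" using * a by linarith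
  finally have "MB * (1 + cmod \<mu>) * (norm ?x)\<^sup>2 < 1 + cmod \<mu>"
    by (simp add: t_def algebra_simps)
  then show ?thesis using b by (simp add: mult_ac)
next
  case (2 e)
  then show ?thesis using that by blast
qed

lemma approx_vectors:
  assumes "finite Z" "\<epsilon> > 0"
  shows "\<exists>y. r y \<in> dom A \<and> norm y = 1 \<and> cmod (qform A (r y) - \<mu>) < \<epsilon> \<and>
    (\<Sum>z\<in>Z. (cmod (cinner (r y) z))\<^sup>2) < \<epsilon>"
proof -
  define p where "p y = (\<Sum>z\<in>Z. (cmod (cinner (r y) z))\<^sup>2)" for y
  have p0: "p y \<ge> 0" for y by (simp add: p_def sum_nonneg)
  have p_add: "p (x + y) \<le> 2 * p x + 2 * p y" for x y
  proof -
    have "(cmod (a + b))\<^sup>2 \<le> 2 * (cmod a)\<^sup>2 + 2 * (cmod b)\<^sup>2" for a b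
    proof -
      have "(cmod (a + b))\<^sup>2 \<le> (cmod a + cmod b)\<^sup>2"
        by (intro power_mono norm_triangle_ineq) simp
      also have "\<dots> \<le> 2 * (cmod a)\<^sup>2 + 2 * (cmod b)\<^sup>2"
        using sum_squares_bound[of "cmod a" "cmod b"] by (simp add: power2_sum)
      finally show ?thesis .
    qed
    then show ?thesis
      unfolding p_def sum_distrib_left sum.distrib[symmetric] r_lin cinner.add_left
      by (intro sum_mono)
  qed
  have p_scale: "p (a *\<^sub>C y) = (cmod a)\<^sup>2 * p y" for a y
    by (simp add: p_def r_lin cinner_lin norm_mult power_mult_distrib sum_distrib_left)
  let ?f = "\<lambda>y. r (the (A (r y))) - \<mu> *\<^sub>C y"
  show ?thesis
  proof (cases rule: three_forms_separation[OF clinear_on_transform[of \<mu>] p0 p_add p_scale])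
    case 1
    from 1[OF assms(2)] obtain y where "r y \<in> dom A" "norm y = 1"
      "cmod (cinner (?f y) y) < \<epsilon>" "p y < \<epsilon>" by blast
    then show ?thesis using cinner_transform[of y \<mu>] by (intro exI[of _ y]) (simp add: p_def)
  next
    case separated: (2 \<omega> \<gamma> \<delta>)
    then have sep: "Re (\<omega> * (qform A (r y) - \<mu>)) + \<gamma> * p y > \<delta>" if "r y \<in> dom A" "norm y = 1" for y
      using separated(2)[of y] that unfolding cinner_transform[OF that(2)] by simp
    show ?thesis
    proof (cases "\<omega> = 0")
      case False
      have "\<delta> / cmod \<omega> > 0" using separated(1) False by simp
      \<comment> \<open>The form of this perturbation is (\<gamma> / \<omega>) p, so multiplying by
        \<omega> reproduces the separating functional; its lower bound \<delta> then keeps the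
        values at distance at least \<delta> / |\<omega>| from \<mu>.\<close>
      with finite_rank_scaleC_oproj[OF assms(1)] obtain y where y: "r y \<in> dom A" "norm y = 1"
        "cmod (qform A (r y) + cinner ((\<gamma> / \<omega>) *\<^sub>C oproj Z (r y)) (r y) - \<mu>) < \<delta> / cmod \<omega>"
        by (rule finite_rank_approx)
      let ?w = "qform A (r y) + (\<gamma> / \<omega>) * p y - \<mu>"
      have "cmod ?w < \<delta> / cmod \<omega>"
        using y(3) by (simp add: cinner_scaleC_left cinner_oproj_self p_def)
      from mult_strict_left_mono[OF this, of "cmod \<omega>"]
      have "cmod (\<omega> * ?w) < \<delta>" unfolding norm_mult using False by simp
      moreover have "\<omega> * ?w = \<omega> * (qform A (r y) - \<mu>) + complex_of_real (\<gamma> * p y)"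
        using False by (simp add: field_simps)
      ultimately have "Re (\<omega> * (qform A (r y) - \<mu>)) + \<gamma> * p y < \<delta>"
        using complex_Re_le_cmod[of "\<omega> * ?w"] by simp
      then show ?thesis using sep[OF y(1,2)] by simp
    next
      case True
      \<comment> \<open>Separation now reads \<gamma> p > \<delta> for all admissible unit
        \<open>y\<close>. Rescaled vectors of an orthonormal sequence refute this: their
        \<open>p\<close> is at most \<open>q n / c\<close> and tends to zero.\<close>
      obtain e :: "nat \<Rightarrow> 'a" where e: "\<And>n. e n \<in> dom A" "\<And>n. norm (e n) = 1"
        "\<And>m n. m \<noteq> n \<Longrightarrow> cinner (e m) (e n) = 0"
        using dom_orthonormal_sequence by blast
      define q where "q n = (\<Sum>z\<in>Z. (cmod (cinner (e n) z))\<^sup>2)" for n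
      have "weakly_null e" by (rule weakly_null_orthonormal[OF e(2,3)])
      then have "(\<lambda>n. cinner (e n) z) \<longlonglongrightarrow> 0" for z by (simp add: weakly_null_def)
      then have "(\<lambda>n. (cmod (cinner (e n) z))\<^sup>2) \<longlonglongrightarrow> 0" for z
        by (intro tendsto_null_power tendsto_norm_zero) auto
      then have "q \<longlonglongrightarrow> 0" unfolding q_def by (intro tendsto_null_sum)
      have "\<delta> * c \<le> \<bar>\<gamma>\<bar> * q n" for n
      proof -
        have dB: "e n \<in> dom B" using e(1) AB by blast
        define k where "k = norm (r (the (B (e n))))"
        have k2: "k\<^sup>2 \<ge> c" using norm_B_ge[OF dB] e(2)[of n] by (simp add: k_def)
        then have "k \<noteq> 0" using c_pos by auto
        define y where "y = complex_of_real (inverse k) *\<^sub>C r (the (B (e n)))"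
        have ry: "r y = complex_of_real (inverse k) *\<^sub>C e n"
          by (simp add: y_def r_lin r_B dB)
        have "norm y = 1" using \<open>k \<noteq> 0\<close> by (simp add: y_def norm_scaleC k_def norm_inverse)
        moreover have "r y \<in> dom A"
          unfolding ry using linear_operatorD(4)[OF A e(1)] .
        ultimately have "\<gamma> * p y > \<delta>" using sep[of y] True by simp
        moreover have "p y = inverse (k\<^sup>2) * q n"
          using \<open>k \<noteq> 0\<close>
          by (simp add: p_def q_def ry cinner_lin norm_mult power_mult_distrib sum_distrib_left
              norm_inverse power_inverse)
        ultimately have "\<delta> * k\<^sup>2 < \<gamma> * q n" using \<open>k \<noteq> 0\<close> by (simp add: field_simps)
        also have "\<dots> \<le> \<bar>\<gamma>\<bar> * q n"
          by (intro mult_right_mono) (auto simp: q_def sum_nonneg)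
        finally show ?thesis
          using mult_left_mono[OF k2, of \<delta>] separated(1) by linarith
      qed
      moreover have "(\<lambda>n. \<bar>\<gamma>\<bar> * q n) \<longlonglongrightarrow> 0"
        using tendsto_mult_right_zero[OF \<open>q \<longlonglongrightarrow> 0\<close>] .
      ultimately have "\<delta> * c \<le> 0" by (intro LIMSEQ_le_const) auto
      then show ?thesis using separated(1) c_pos by (simp add: mult_le_0_iff)
    qed
  qed
qed

text \<open>The vector \<open>r y\<close> found above may be so short that normalizing it destroys the approximate
  orthogonality to \<open>Z\<close>.  Adding a small multiple of a unit vector \<open>r h\<close> cures this; the uncontrolled
  term \<open>\<langle>A r y, r h\<rangle>\<close> is made to vanish by choosing \<open>h\<close> in a two-dimensional space.\<close>

lemma mem_quot_ess_num_range: "\<mu> \<in> quot_ess_num_range A B"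
  unfolding quot_ess_num_range_weak_limits weak_limits_iff
proof (intro allI impI)
  fix Z :: "'a set" and \<epsilon> :: real assume Z: "finite Z" and \<epsilon>: "\<epsilon> > 0"
  obtain e :: "nat \<Rightarrow> 'a" where e: "\<And>n. e n \<in> dom A" "\<And>n. norm (e n) = 1"
    "\<And>m n. m \<noteq> n \<Longrightarrow> cinner (e m) (e n) = 0"
    using dom_orthonormal_sequence by blast
  have "weakly_null e" by (rule weakly_null_orthonormal[OF e(2,3)])
  then have "\<forall>\<^sub>F n in sequentially. \<forall>z\<in>Z. cmod (cinner (e n) z) < \<epsilon> / 4"
    using Z \<epsilon> by (intro weakly_null_eventually_small) auto
  \<comment> \<open>Two orthonormal vectors nearly orthogonal to \<open>Z\<close> span the space
    from which \<open>r h\<close> is taken.\<close>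
  then obtain N where N: "\<And>n z. n \<ge> N \<Longrightarrow> z \<in> Z \<Longrightarrow> cmod (cinner (e n) z) < \<epsilon> / 4"
    unfolding eventually_sequentially by blast
  have eB: "e n \<in> dom B" for n using e(1) AB by blast
  define f where "f y = r (the (A (r y))) - \<mu> *\<^sub>C y" for y
  have f: "clinear_on {y. r y \<in> dom A} f" unfolding f_def by (rule clinear_on_transform)
  define g1 g2 where "g1 = r (the (B (e N)))" and "g2 = r (the (B (e (Suc N))))"
  have rg: "r g1 = e N" "r g2 = e (Suc N)" by (simp_all add: g1_def g2_def r_B eB)
  have g: "g1 \<in> {y. r y \<in> dom A}" "g2 \<in> {y. r y \<in> dom A}" by (simp_all add: rg e(1))
  \<comment> \<open>Both bounds depend on \<open>g1\<close> and \<open>g2\<close> alone, so \<tau>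
    can be fixed before \<open>y\<close> is chosen. This order matters because \<open>f y\<close>
    has no bound in terms of the norm of \<open>y\<close>.\<close>
  define M1 M2 where "M1 = norm g1 + norm g2" and "M2 = norm (f g1) + norm (f g2)"
  have M: "M1 \<ge> 0" "M2 \<ge> 0" by (simp_all add: M1_def M2_def)
  define \<tau> where "\<tau> = Min {1, 1 / (2 * (M1 + 1)), \<epsilon> / (16 * (M2 + 1))}"
  have \<tau>: "\<tau> > 0" using M \<epsilon> by (simp add: \<tau>_def)
  have \<tau>M1: "\<tau> * M1 \<le> 1/2"
  proof -
    have "\<tau> \<le> 1 / (2 * (M1 + 1))" by (simp add: \<tau>_def)
    then have "\<tau> * (M1 + 1) \<le> 1/2" using M by (simp add: field_simps)
    then show ?thesis using \<tau> by (simp add: algebra_simps)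
  qed
  have \<tau>M2: "\<tau> * M2 \<le> \<epsilon> / 16"
  proof -
    have "\<tau> \<le> \<epsilon> / (16 * (M2 + 1))" by (simp add: \<tau>_def)
    then have "\<tau> * (M2 + 1) \<le> \<epsilon> / 16" using M by (simp add: field_simps)
    then show ?thesis using \<tau> by (simp add: algebra_simps)
  qed
  \<comment> \<open>After the correction only norm x \<ge> \<tau> is known, so the inner products of
    \<open>r y\<close> with \<open>Z\<close> must be small relative to \<tau>. The square reflects
    that a sum of squares is controlled.\<close>
  define \<epsilon>' where "\<epsilon>' = min (\<epsilon> / 16) ((\<tau> * \<epsilon> / 2)\<^sup>2)"
  have "\<epsilon>' > 0" using \<epsilon> \<tau> by (simp add: \<epsilon>'_def)
  from approx_vectors[OF Z this] obtain y where y: "r y \<in> dom A" "norm y = 1"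
    "cmod (qform A (r y) - \<mu>) < \<epsilon>'" "(\<Sum>z\<in>Z. (cmod (cinner (r y) z))\<^sup>2) < \<epsilon>'" by blast
  have fy: "cmod (cinner (f y) y) < \<epsilon> / 16"
    using y(3) cinner_transform[OF y(2), of \<mu>] by (simp add: f_def \<epsilon>'_def)
  have yz: "cmod (cinner (r y) z) < \<tau> * \<epsilon> / 2" if "z \<in> Z" for z
  proof -
    have "(cmod (cinner (r y) z))\<^sup>2 \<le> (\<Sum>z\<in>Z. (cmod (cinner (r y) z))\<^sup>2)"
      using Z that by (intro member_le_sum) auto
    then have "(cmod (cinner (r y) z))\<^sup>2 < (\<tau> * \<epsilon> / 2)\<^sup>2" using y(4) by (simp add: \<epsilon>'_def)
    then show ?thesis by (rule power2_less_imp_less) (use \<tau> \<epsilon> in simp)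
  qed
  \<comment> \<open>Changing both signs preserves the first two conditions. The nonnegative real
    part prevents cancellation between \<open>r y\<close> and the correction, which gives norm x
    \<ge> \<tau>.\<close>
  obtain \<alpha> \<beta> where ab: "(cmod \<alpha>)\<^sup>2 + (cmod \<beta>)\<^sup>2 = 1"
    "cnj \<alpha> * cinner (f y) g1 + cnj \<beta> * cinner (f y) g2 = 0"
    "Re (cinner (r y) (\<alpha> *\<^sub>C e N + \<beta> *\<^sub>C e (Suc N))) \<ge> 0"
  proof -
    obtain \<alpha> \<beta> where ab: "(cmod \<alpha>)\<^sup>2 + (cmod \<beta>)\<^sup>2 = 1"
      "cnj \<alpha> * cinner (f y) g1 + cnj \<beta> * cinner (f y) g2 = 0"
      using ex_unit_orthogonal_pair by blast
    show ?thesis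
    proof (cases "Re (cinner (r y) (\<alpha> *\<^sub>C e N + \<beta> *\<^sub>C e (Suc N))) \<ge> 0")
      case True
      then show ?thesis using that ab by blast
    next
      case False
      have "cnj (- \<alpha>) * cinner (f y) g1 + cnj (- \<beta>) * cinner (f y) g2
          = - (cnj \<alpha> * cinner (f y) g1 + cnj \<beta> * cinner (f y) g2)" by simp
      then show ?thesis
        using that[of "- \<alpha>" "- \<beta>"] ab False by (simp add: cinner_lin)
    qed
  qed
  have le1: "cmod \<alpha> \<le> 1" "cmod \<beta> \<le> 1"
  proof -
    have "(cmod \<alpha>)\<^sup>2 \<le> 1" "(cmod \<beta>)\<^sup>2 \<le> 1"
      using ab(1) zero_le_power2[of "cmod \<alpha>"] zero_le_power2[of "cmod \<beta>"] by linarith+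
    then show "cmod \<alpha> \<le> 1" "cmod \<beta> \<le> 1" by (simp_all add: abs_square_le_1)
  qed
  have comb_le: "norm (\<alpha> *\<^sub>C u + \<beta> *\<^sub>C v) \<le> norm u + norm v" for u v :: 'a
  proof -
    have "norm (\<alpha> *\<^sub>C u + \<beta> *\<^sub>C v) \<le> cmod \<alpha> * norm u + cmod \<beta> * norm v"
      by (metis norm_scaleC norm_triangle_ineq)
    also have "\<dots> \<le> 1 * norm u + 1 * norm v"
      using le1 by (intro add_mono mult_right_mono) auto
    finally show ?thesis by simp
  qed
  define h where "h = \<alpha> *\<^sub>C g1 + \<beta> *\<^sub>C g2"
  have rh: "r h = \<alpha> *\<^sub>C e N + \<beta> *\<^sub>C e (Suc N)" by (simp add: h_def r_lin rg)
  have hD: "h \<in> {y. r y \<in> dom A}" unfolding h_def by (rule clinear_onD(4)[OF f g])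
  have norm_h: "norm h \<le> M1" unfolding h_def M1_def by (rule comb_le)
  have norm_fh: "norm (f h) \<le> M2"
    unfolding h_def M2_def clinear_onD(5)[OF f g] by (rule comb_le)
  have fyh: "cinner (f y) h = 0" unfolding h_def using ab(2) by (simp add: cinner_lin)
  have norm_rh: "norm (r h) = 1"
  proof -
    have "cinner (r h) (r h) = complex_of_real ((cmod \<alpha>)\<^sup>2 + (cmod \<beta>)\<^sup>2)"
      unfolding rh cinner_combination
      by (simp add: e(3) cinner_self e(2) flip: complex_norm_square)
    then have "complex_of_real ((norm (r h))\<^sup>2) = complex_of_real 1"
      unfolding cinner_self ab(1) .
    then have "(norm (r h))\<^sup>2 = 1" unfolding of_real_eq_iff .
    then show ?thesis using norm_ge_zero[of "r h"] by (simp add: power2_eq_1_iff)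
  qed
  have hz: "cmod (cinner (r h) z) \<le> \<epsilon> / 2" if "z \<in> Z" for z
  proof -
    have "cmod (cinner (r h) z) \<le> cmod \<alpha> * cmod (cinner (e N) z) + cmod \<beta> * cmod (cinner (e (Suc N)) z)"
      unfolding rh cinner_lin by (metis norm_mult norm_triangle_ineq)
    also have "\<dots> \<le> 1 * (\<epsilon> / 4) + 1 * (\<epsilon> / 4)"
      using le1 N[of N z] N[of "Suc N" z] that by (intro add_mono mult_mono) auto
    finally show ?thesis by simp
  qed
  define y' where "y' = y + complex_of_real \<tau> *\<^sub>C h"
  define x where "x = r y'"
  have x_eq: "x = r y + complex_of_real \<tau> *\<^sub>C r h" by (simp add: x_def y'_def r_lin)
  have y'D: "y' \<in> {y. r y \<in> dom A}"
    using clinear_onD(4)[OF f _ hD, of y 1 \<tau>] y(1) by (simp add: y'_def)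
  then have xA: "x \<in> dom A" by (simp add: x_def)
  then have xB: "x \<in> dom B" using AB by blast
  have "(norm x)\<^sup>2 = (norm (r y))\<^sup>2 + \<tau>\<^sup>2 + 2 * \<tau> * Re (cinner (r y) (r h))"
    unfolding x_eq norm_add_square
    by (simp add: norm_scaleC norm_rh cinner_lin power_mult_distrib)
  moreover have "\<tau> * Re (cinner (r y) (r h)) \<ge> 0"
    using \<tau> ab(3) by (simp add: rh)
  ultimately have "\<tau>\<^sup>2 \<le> (norm x)\<^sup>2" by simp
  then have norm_x: "\<tau> \<le> norm x" by (rule power2_le_imp_le) simp
  \<comment> \<open>Of the two mixed terms, the one with \<open>f y\<close> vanishes by the choice
    of \<open>h\<close>; the other is bounded through the norm of \<open>f h\<close>.\<close>
  have "cinner (f y') y' = cinner (f y) y + \<tau> * cinner (f h) y + \<tau> * (\<tau> * cinner (f h) h)"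
  proof -
    have "f y' = f y + complex_of_real \<tau> *\<^sub>C f h"
      using clinear_onD(5)[OF f _ hD, of y 1 \<tau>] y(1) by (simp add: y'_def)
    then show ?thesis by (simp add: y'_def cinner_lin fyh algebra_simps)
  qed
  then have "cmod (cinner (f y') y')
      \<le> cmod (cinner (f y) y) + \<tau> * cmod (cinner (f h) y) + \<tau> * (\<tau> * cmod (cinner (f h) h))"
    using norm_triangle_ineq[of "cinner (f y) y + \<tau> * cinner (f h) y" "\<tau> * (\<tau> * cinner (f h) h)"]
      norm_triangle_ineq[of "cinner (f y) y" "\<tau> * cinner (f h) y"] \<tau>
    by (simp add: norm_mult)
  also have "\<dots> \<le> \<epsilon> / 16 + \<tau> * M2 + \<tau> * (\<tau> * (M2 * M1))"
  proof (intro add_mono mult_left_mono)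
    show "cmod (cinner (f h) y) \<le> M2"
      using norm_cinner_le[of "f h" y] norm_fh y(2) by simp
    show "cmod (cinner (f h) h) \<le> M2 * M1"
      using norm_cinner_le[of "f h" h] mult_mono[OF norm_fh norm_h M(2) norm_ge_zero] by linarith
  qed (use fy \<tau> in auto)
  also have "\<tau> * (\<tau> * (M2 * M1)) = (\<tau> * M2) * (\<tau> * M1)" by simp
  also have "\<dots> \<le> (\<epsilon> / 16) * (1/2)"
    using \<tau>M1 \<tau>M2 \<tau> M \<epsilon> by (intro mult_mono) auto
  finally have f_small: "cmod (cinner (f y') y') < \<epsilon> / 4" using \<tau>M2 \<epsilon> by simp
  have "norm y \<le> norm y' + norm (complex_of_real \<tau> *\<^sub>C h)"
    using norm_triangle_ineq4[of y' "complex_of_real \<tau> *\<^sub>C h"] by (simp add: y'_def)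
  moreover have "norm (complex_of_real \<tau> *\<^sub>C h) = \<tau> * norm h"
    using \<tau> by (simp add: norm_scaleC)
  moreover have "\<tau> * norm h \<le> 1/2"
    using mult_left_mono[OF norm_h less_imp_le[OF \<tau>]] \<tau>M1 by linarith
  ultimately have "norm y' \<ge> 1/2" using y(2) by simp
  then have y'2: "(norm y')\<^sup>2 \<ge> 1/4" using power_mono[of "1/2" "norm y'" 2] by (simp add: power2_eq_square)
  then have "norm y' \<noteq> 0" by auto
  have quot: "cmod (qform A x / qform B x - \<mu>) < \<epsilon>"
  proof -
    have b: "qform B x = complex_of_real ((norm y')\<^sup>2)"
      using xB unfolding x_def by (rule qform_B_r)
    have "cinner (f y') y' = qform A x - \<mu> * complex_of_real ((norm y')\<^sup>2)"
      by (simp add: f_def x_def cinner_lin r_cinner cinner_self)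
    then have "qform A x / qform B x - \<mu> = cinner (f y') y' / complex_of_real ((norm y')\<^sup>2)"
      using \<open>norm y' \<noteq> 0\<close> unfolding b by (simp add: diff_divide_distrib)
    then have "cmod (qform A x / qform B x - \<mu>) = cmod (cinner (f y') y') / (norm y')\<^sup>2"
      by (simp add: norm_divide norm_power)
    also have "\<dots> < (\<epsilon> / 4) / (1/4)"
      using f_small y'2 by (intro frac_less) auto
    finally show ?thesis by simp
  qed
  define k where "k = complex_of_real (inverse (norm x))"
  define v where "v = k *\<^sub>C x"
  have "norm x > 0" using norm_x \<tau> by linarith
  then have "k \<noteq> 0" by (simp add: k_def)
  have norm_v: "norm v = 1"
    using \<open>norm x > 0\<close> by (simp add: v_def k_def norm_scaleC norm_inverse)
  have "qform A v / qform B v = qform A x / qform B x"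
    unfolding v_def qform_scaleC[OF A xA] qform_scaleC[OF B xB] using \<open>k \<noteq> 0\<close> by simp
  moreover have "v \<in> dom A" unfolding v_def by (rule linear_operatorD(4)[OF A xA])
  moreover have "qform B v \<noteq> 0"
    using \<open>v \<in> dom A\<close> AB norm_v by (intro qform_B_nonzero) auto
  moreover have "cmod (cinner v z) < \<epsilon>" if "z \<in> Z" for z
  proof -
    have "cmod (cinner x z) \<le> cmod (cinner (r y) z) + \<tau> * cmod (cinner (r h) z)"
      unfolding x_eq cinner_lin
      using norm_triangle_ineq[of "cinner (r y) z" "\<tau> * cinner (r h) z"] \<tau>
      by (simp add: norm_mult)
    also have "\<dots> < \<tau> * \<epsilon> / 2 + \<tau> * (\<epsilon> / 2)"
      using yz[OF that] mult_left_mono[OF hz[OF that], of \<tau>] \<tau> by linarith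
    also have "\<dots> = \<tau> * \<epsilon>" by simp
    also have "\<dots> \<le> norm x * \<epsilon>" using norm_x \<epsilon> by (intro mult_right_mono) auto
    finally show ?thesis
      using \<open>norm x > 0\<close>
      by (simp add: v_def k_def cinner_lin norm_mult norm_inverse norm_divide pos_divide_less_eq
          mult.commute divide_inverse[symmetric])
  qed
  ultimately show "\<exists>v\<in>{x \<in> dom A. qform B x \<noteq> 0}. norm v = 1 \<and>
      cmod (qform A v / qform B v - \<mu>) < \<epsilon> \<and> (\<forall>z\<in>Z. cmod (cinner v z) < \<epsilon>)"
    using norm_v quot by (intro bexI[of _ v]) auto
qed

end

section \<open>Comparison with the essential numerical range of the transformed operator\<close>

lemma sandwich_apply:
  "dom ((\<lambda>x. Some (r x)) \<circ>\<^sub>m A \<circ>\<^sub>m (\<lambda>x. Some (r x))) = {y. r y \<in> dom A}"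
  "r y \<in> dom A \<Longrightarrow> the (((\<lambda>x. Some (r x)) \<circ>\<^sub>m A \<circ>\<^sub>m (\<lambda>x. Some (r x))) y) = r (the (A (r y)))"
  by (auto simp: map_comp_def dom_def split: option.splits)

text \<open>Symmetry of \<open>r\<close> carries weak nullity from \<open>Y n\<close> to
  \<open>r (Y n)\<close>, and the lower bound for \<open>B\<close> bounds these vectors, so the form
  of the compact \<open>K\<close> disappears in the limit.\<close>

lemma ess_sandwich_subset_closure_quot:
  assumes K: "compact_op K"
  shows "ess_num_range ((\<lambda>x. Some (r x)) \<circ>\<^sub>m A \<circ>\<^sub>m (\<lambda>x. Some (r x)))
    \<subseteq> closure (quot_num_range (op_perturb A K) B)"
proof
  fix \<mu> assume "\<mu> \<in> ess_num_range ((\<lambda>x. Some (r x)) \<circ>\<^sub>m A \<circ>\<^sub>m (\<lambda>x. Some (r x)))"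
  then obtain Y where Y: "\<And>n. r (Y n) \<in> dom A" "\<And>n. norm (Y n) = 1" "weakly_null Y"
    and lim: "(\<lambda>n. cinner (the (((\<lambda>x. Some (r x)) \<circ>\<^sub>m A \<circ>\<^sub>m (\<lambda>x. Some (r x))) (Y n))) (Y n)) \<longlonglongrightarrow> \<mu>"
    unfolding ess_num_range_def sandwich_apply by blast
  have lim: "(\<lambda>n. qform A (r (Y n))) \<longlonglongrightarrow> \<mu>"
    using lim unfolding sandwich_apply(2)[OF Y(1)] r_cinner .
  have Kl: "bounded_clinear K" using K by (simp add: compact_op_def)
  have "weakly_null (\<lambda>n. r (Y n))"
    using Y(3) by (simp add: weakly_null_def r_cinner)
  moreover have "norm (r (Y n)) \<le> sqrt (inverse c)" for n
  proof (rule real_le_rsqrt)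
    have "r (Y n) \<in> dom B" using Y(1) AB by blast
    then show "(norm (r (Y n)))\<^sup>2 \<le> inverse c"
      using norm_r_le[of "Y n"] Y(2)[of n] c_pos by (simp add: field_simps)
  qed
  ultimately have "(\<lambda>n. cinner (K (r (Y n))) (r (Y n))) \<longlonglongrightarrow> 0"
    by (rule weakly_null_compact_op[OF K])
  from tendsto_add[OF lim this]
  have "(\<lambda>n. qform A (r (Y n)) + cinner (K (r (Y n))) (r (Y n))) \<longlonglongrightarrow> \<mu>" by simp
  moreover have "qform A (r (Y n)) + cinner (K (r (Y n))) (r (Y n))
      \<in> quot_num_range (op_perturb A K) B" for n
    unfolding quot_num_range_perturb[OF Kl] using Y(1,2) by blast
  ultimately show "\<mu> \<in> closure (quot_num_range (op_perturb A K) B)"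
    unfolding closure_sequential
    by (intro exI[of _ "\<lambda>n. qform A (r (Y n)) + cinner (K (r (Y n))) (r (Y n))"]) simp
qed

text \<open>The candidates are B^(1/2) X n, normalized. As B^(1/2) may be unbounded, weak nullity is
  not inherited directly: against \<open>w\<close> in \<open>dom B\<close> the root is moved to
  \<open>w\<close>, and density with unit norms gives the rest.\<close>

lemma quot_ess_subset_ess_sandwich:
  assumes dense: "closure (dom B) = UNIV"
  shows "quot_ess_num_range A B \<subseteq> ess_num_range ((\<lambda>x. Some (r x)) \<circ>\<^sub>m A \<circ>\<^sub>m (\<lambda>x. Some (r x)))"
proof
  fix \<mu> assume "\<mu> \<in> quot_ess_num_range A B"
  then obtain X where X: "\<And>n. X n \<in> dom A" "\<And>n. norm (X n) = 1" "weakly_null X"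
    "(\<lambda>n. qform A (X n) / qform B (X n)) \<longlonglongrightarrow> \<mu>"
    by (auto simp: quot_ess_num_range_def)
  have XB: "X n \<in> dom B" for n using X(1) AB by blast
  define k where "k n = norm (r (the (B (X n))))" for n
  have k2: "(k n)\<^sup>2 \<ge> c" for n using norm_B_ge[OF XB, of n] X(2) by (simp add: k_def)
  then have k0: "k n > 0" for n
    using c_pos norm_ge_zero[of "r (the (B (X n)))"] by (metis k_def less_le not_le zero_power2)
  have k_ge: "k n \<ge> sqrt c" for n using k2 k0 by (simp add: real_le_lsqrt less_imp_le)
  define Y where "Y n = complex_of_real (inverse (k n)) *\<^sub>C r (the (B (X n)))" for n
  have rY: "r (Y n) = complex_of_real (inverse (k n)) *\<^sub>C X n" for n
    by (simp add: Y_def r_lin r_B XB)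
  have norm_Y: "norm (Y n) = 1" for n
    using k0[of n] by (simp add: Y_def norm_scaleC k_def norm_inverse)
  have dom_Y: "r (Y n) \<in> dom A" for n
    unfolding rY by (rule linear_operatorD(4)[OF A X(1)])
  have val: "qform A (r (Y n)) = qform A (X n) / qform B (X n)" for n
  proof -
    have "qform A (r (Y n)) = complex_of_real ((cmod (complex_of_real (inverse (k n))))\<^sup>2) * qform A (X n)"
      unfolding rY by (rule qform_scaleC[OF A X(1)])
    also have "(cmod (complex_of_real (inverse (k n))))\<^sup>2 = inverse ((k n)\<^sup>2)"
      by (simp add: power_inverse del: of_real_inverse)
    finally show ?thesis by (simp add: qform_B[OF XB] k_def divide_inverse mult.commute)
  qed
  have dense_null: "(\<lambda>n. cinner (Y n) w) \<longlonglongrightarrow> 0" if w: "w \<in> dom B" for w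
  proof (rule Lim_null_comparison)
    let ?v = "r (the (B w))"
    have "cinner (Y n) w = inverse (k n) * cinner (X n) ?v" for n
    proof -
      have "cinner (Y n) w = cinner (Y n) (r ?v)" using r_B[OF w] by simp
      also have "\<dots> = cinner (r (Y n)) ?v" by (simp add: r_cinner)
      finally show ?thesis by (simp add: rY cinner_lin)
    qed
    then have "cmod (cinner (Y n) w) = inverse (k n) * cmod (cinner (X n) ?v)" for n
      using k0[of n] by (simp add: norm_mult norm_inverse)
    moreover have "inverse (k n) \<le> inverse (sqrt c)" for n
      using k_ge c_pos by (intro le_imp_inverse_le) auto
    ultimately show "\<forall>\<^sub>F n in sequentially. norm (cinner (Y n) w)
        \<le> inverse (sqrt c) * cmod (cinner (X n) ?v)"
      by (intro always_eventually allI) (simp add: mult_right_mono)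
    have "(\<lambda>n. cinner (X n) ?v) \<longlonglongrightarrow> 0" using X(3) by (simp add: weakly_null_def)
    then show "(\<lambda>n. inverse (sqrt c) * cmod (cinner (X n) ?v)) \<longlonglongrightarrow> 0"
      by (intro tendsto_mult_right_zero tendsto_norm_zero)
  qed
  have "weakly_null Y"
    unfolding weakly_null_def
  proof (intro allI tendstoI)
    fix w :: 'a and \<epsilon> :: real assume "\<epsilon> > 0"
    then obtain u where u: "u \<in> dom B" "norm (u - w) < \<epsilon> / 2"
      using dense closure_approachable[of w "dom B"] half_gt_zero[of \<epsilon>]
      unfolding dist_norm by blast
    have "\<forall>\<^sub>F n in sequentially. dist (cinner (Y n) u) 0 < \<epsilon> / 2"
      using dense_null[OF u(1)] \<open>\<epsilon> > 0\<close> by (intro tendstoD) auto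
    then show "\<forall>\<^sub>F n in sequentially. dist (cinner (Y n) w) 0 < \<epsilon>"
    proof eventually_elim
      case (elim n)
      have "cmod (cinner (Y n) (w - u)) < \<epsilon> / 2"
        using norm_cinner_le[of "Y n" "w - u"] norm_Y[of n] u(2) by (simp add: norm_minus_commute)
      then show ?case
        using elim norm_triangle_ineq[of "cinner (Y n) (w - u)" "cinner (Y n) u"]
        by (simp add: cinner.diff_right)
    qed
  qed
  moreover have "(\<lambda>n. cinner (the (((\<lambda>x. Some (r x)) \<circ>\<^sub>m A \<circ>\<^sub>m (\<lambda>x. Some (r x))) (Y n))) (Y n)) \<longlonglongrightarrow> \<mu>"
    using X(4) unfolding sandwich_apply(2)[OF dom_Y] r_cinner val .
  ultimately show "\<mu> \<in> ess_num_range ((\<lambda>x. Some (r x)) \<circ>\<^sub>m A \<circ>\<^sub>m (\<lambda>x. Some (r x)))"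
    unfolding ess_num_range_def mem_Collect_eq sandwich_apply(1)
    using norm_Y dom_Y by (intro exI[of _ Y]) simp
qed

end

lemma uniformly_positive_not_in_ess_num_range:
  assumes "uniformly_positive B"
  shows "0 \<notin> ess_num_range B"
proof
  assume "0 \<in> ess_num_range B"
  then obtain X where X: "\<And>n. X n \<in> dom B" "\<And>n. norm (X n) = 1" "(\<lambda>n. qform B (X n)) \<longlonglongrightarrow> 0"
    by (auto simp: ess_num_range_def)
  obtain c where c: "c > 0" "bounded_below_by B c"
    using assms by (auto simp: uniformly_positive_def)
  have "c * (norm (X n))\<^sup>2 \<le> Re (qform B (X n))" for n
    using c(2) X(1) unfolding bounded_below_by_def by blast
  then have "c \<le> Re (qform B (X n))" for n by (simp add: X(2))
  moreover have "(\<lambda>n. Re (qform B (X n))) \<longlonglongrightarrow> Re 0" by (intro tendsto_Re X(3))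
  ultimately have "c \<le> Re 0" by (intro LIMSEQ_le_const) auto
  then show False using c(1) by simp
qed

section \<open>The chain of intersections and the final assembly\<close>

lemma intersection_chain:
  assumes A: "linear_operator A" and B: "linear_operator B" and AB: "dom A \<subseteq> dom B"
  defines "w \<equiv> \<lambda>K. closure (quot_num_range (op_perturb A K) B)"
    and "W \<equiv> \<lambda>K. closure (pencil_num_range (op_perturb A K) B)"
  shows "(\<Inter>K\<in>{K. compact_op K}. w K) \<subseteq> (\<Inter>K\<in>{K. finite_rank_op K}. w K)"
    and "(\<Inter>K\<in>{K. finite_rank_op K}. w K) \<subseteq> (\<Inter>K\<in>{K. finite_rank_op K}. W K)"
    and "(\<Inter>K\<in>{K. finite_rank_op K}. W K) = (\<Inter>K\<in>{K. compact_op K}. W K)"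
proof -
  have sub: "{K. finite_rank_op K} \<subseteq> {K. compact_op K}"
    using finite_rank_imp_compact_op by blast
  show "(\<Inter>K\<in>{K. compact_op K}. w K) \<subseteq> (\<Inter>K\<in>{K. finite_rank_op K}. w K)"
    by (intro INF_superset_mono sub order_refl)
  show "(\<Inter>K\<in>{K. finite_rank_op K}. w K) \<subseteq> (\<Inter>K\<in>{K. finite_rank_op K}. W K)"
  proof (rule INF_mono)
    fix K :: "'a \<Rightarrow> 'a" assume "K \<in> {K. finite_rank_op K}"
    then have "linear_operator (op_perturb A K)"
      using linear_operator_op_perturb[OF A] by (simp add: finite_rank_op_def)
    then have "w K \<subseteq> W K"
      unfolding w_def W_def using B AB by (intro closure_mono quot_subset_pencil_num_range) simp_all
    then show "\<exists>L\<in>{K. finite_rank_op K}. w L \<subseteq> W K" using \<open>K \<in> _\<close> by blast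
  qed
  show "(\<Inter>K\<in>{K. finite_rank_op K}. W K) = (\<Inter>K\<in>{K. compact_op K}. W K)"
  proof
    show "(\<Inter>K\<in>{K. finite_rank_op K}. W K) \<subseteq> (\<Inter>K\<in>{K. compact_op K}. W K)"
      unfolding W_def using closure_pencil_num_range_compact_approx[OF A B AB] by blast
    show "(\<Inter>K\<in>{K. compact_op K}. W K) \<subseteq> (\<Inter>K\<in>{K. finite_rank_op K}. W K)"
      by (intro INF_superset_mono sub order_refl)
  qed
qed

theorem theorem2p19:
  fixes A B :: "'a::chilbert_space operator"
  assumes "linear_operator A" and "linear_operator B" and "dom A \<subseteq> dom B"
  shows
    "(0 \<notin> ess_num_range B \<longrightarrow>
        quot_ess_num_range A B
          \<subseteq> (\<Inter>K\<in>{K. compact_op K}. closure (quot_num_range (op_perturb A K) B)) \<and>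
        (\<Inter>K\<in>{K. compact_op K}. closure (quot_num_range (op_perturb A K) B))
          \<subseteq> (\<Inter>K\<in>{K. finite_rank_op K}. closure (quot_num_range (op_perturb A K) B)) \<and>
        (\<Inter>K\<in>{K. finite_rank_op K}. closure (quot_num_range (op_perturb A K) B))
          \<subseteq> (\<Inter>K\<in>{K. finite_rank_op K}. closure (pencil_num_range (op_perturb A K) B)) \<and>
        (\<Inter>K\<in>{K. finite_rank_op K}. closure (pencil_num_range (op_perturb A K) B))
          = (\<Inter>K\<in>{K. compact_op K}. closure (pencil_num_range (op_perturb A K) B)) \<and>
        closure (pencil_ess_num_range A B) \<subseteq> quot_ess_num_range A B) \<and>
     (uniformly_positive B \<longrightarrow>
        quot_ess_num_range A B = ess_num_range (inv_sqrt B \<circ>\<^sub>m A \<circ>\<^sub>m inv_sqrt B) \<and>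
        closed (quot_ess_num_range A B) \<and>
        convex (quot_ess_num_range A B) \<and>
        (\<Inter>K\<in>{K. compact_op K}. closure (quot_num_range (op_perturb A K) B))
          = quot_ess_num_range A B \<and>
        (\<Inter>K\<in>{K. finite_rank_op K}. closure (quot_num_range (op_perturb A K) B))
          = quot_ess_num_range A B \<and>
        (\<Inter>K\<in>{K. finite_rank_op K}. closure (pencil_num_range (op_perturb A K) B))
          = quot_ess_num_range A B \<and>
        (\<Inter>K\<in>{K. compact_op K}. closure (pencil_num_range (op_perturb A K) B))
          = quot_ess_num_range A B)"
    (is "(_ \<longrightarrow> ?I) \<and> (_ \<longrightarrow> ?II)")
proof -
  note chain = intersection_chain[OF assms]
  have w_e_sub: "quot_ess_num_range A B
      \<subseteq> (\<Inter>K\<in>{K. compact_op K}. closure (quot_num_range (op_perturb A K) B))"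
    if "0 \<notin> ess_num_range B"
    using quot_ess_subset_closure_quot[OF assms(1,3) that] by blast
  have part1: ?I if B0: "0 \<notin> ess_num_range B"
  proof -
    have "closure (pencil_ess_num_range A B) \<subseteq> quot_ess_num_range A B"
      by (intro closure_minimal pencil_ess_subset_quot_ess assms(3) B0 closed_quot_ess_num_range)
    then show ?I by (intro conjI w_e_sub[OF B0] chain)
  qed
  have part2: ?II if pos: "uniformly_positive B"
  proof -
    from pos obtain r c where r: "inv_sqrt B = (\<lambda>x. Some (r x))" "sym_op r" "c > 0"
      "\<And>y. B (r (r y)) = Some y" "\<And>x. x \<in> dom B \<Longrightarrow> r (r (the (B x))) = x"
      "bounded_below_by B c" "closure (dom B) = UNIV"
      by (rule uniformly_positive_inv_sqrt) blast
    note setting = assms r(2-6)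
    have w_e: "quot_ess_num_range A B
        \<subseteq> (\<Inter>K\<in>{K. compact_op K}. closure (quot_num_range (op_perturb A K) B))"
      by (rule w_e_sub[OF uniformly_positive_not_in_ess_num_range[OF pos]])
    have W_sub: "(\<Inter>K\<in>{K. finite_rank_op K}. closure (pencil_num_range (op_perturb A K) B))
        \<subseteq> quot_ess_num_range A B"
      using mem_quot_ess_num_range[OF setting] by blast
    \<comment> \<open>A squeeze: w_e lies in the smallest intersection, and the largest one, with W
      and finite rank, lies in w_e, so all four collapse.\<close>
    have eq: "(\<Inter>K\<in>{K. compact_op K}. closure (quot_num_range (op_perturb A K) B))
        = quot_ess_num_range A B"
      by (rule antisym[OF order_trans[OF chain(1) order_trans[OF chain(2) W_sub]] w_e])
    \<comment> \<open>Convexity is read off the intersection: each w(A + K, B) is an ordinary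
      numerical range in the transformed coordinates.\<close>
    have "convex (\<Inter>K\<in>{K. compact_op K}. closure (quot_num_range (op_perturb A K) B))"
      using convex_quot_num_range_perturb[OF setting]
      by (intro convex_INT convex_closure) (simp add: compact_op_def)
    then have convex: "convex (quot_ess_num_range A B)" unfolding eq .
    have "quot_ess_num_range A B = ess_num_range (inv_sqrt B \<circ>\<^sub>m A \<circ>\<^sub>m inv_sqrt B)"
      unfolding r(1)
    proof
      show "quot_ess_num_range A B \<subseteq> ess_num_range ((\<lambda>x. Some (r x)) \<circ>\<^sub>m A \<circ>\<^sub>m (\<lambda>x. Some (r x)))"
        by (rule quot_ess_subset_ess_sandwich[OF setting r(7)])
      show "ess_num_range ((\<lambda>x. Some (r x)) \<circ>\<^sub>m A \<circ>\<^sub>m (\<lambda>x. Some (r x))) \<subseteq> quot_ess_num_range A B"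
        unfolding eq[symmetric] using ess_sandwich_subset_closure_quot[OF setting] by blast
    qed
    moreover have
      "(\<Inter>K\<in>{K. finite_rank_op K}. closure (quot_num_range (op_perturb A K) B))
        = quot_ess_num_range A B"
      by (rule antisym[OF order_trans[OF chain(2) W_sub] order_trans[OF w_e chain(1)]])
    moreover have W_eq:
      "(\<Inter>K\<in>{K. finite_rank_op K}. closure (pencil_num_range (op_perturb A K) B))
        = quot_ess_num_range A B"
      by (rule antisym[OF W_sub order_trans[OF order_trans[OF w_e chain(1)] chain(2)]])
    moreover have
      "(\<Inter>K\<in>{K. compact_op K}. closure (pencil_num_range (op_perturb A K) B))
        = quot_ess_num_range A B"
      by (rule trans[OF chain(3)[symmetric] W_eq])
    ultimately show ?II
      by (intro conjI closed_quot_ess_num_range convex eq)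
  qed
  show ?thesis using part1 part2 by (intro conjI[OF impI impI])
qed

end
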